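(* Let $f(z)=z+z^2+z^3+o(z^3)$ be a prenormalized parabolic germ of diffeomorphism of $(\mathbb{C},0)$ formally conjugated to $f_0(z)=\frac{z}{1-z}$, with attracting petal $V_+$ and repelling petal $V_-$. Then the principal part of area $z\mapsto H^f(z)$ for $f$ is an analytic function on $V_+$, and the principal part of area $z\mapsto H^{f^{\circ -1}}(z)$ for $f^{\circ -1}$ is an analytic function on $V_-$. Moreover, let $H_+$ on $V_+$ and $H_-$ on $V_-$ be the unique sectorially analytic solutions without constant term of the difference equation $$H(z)-H(f(z))=\pi z .$$ Then $$H_+(z)-\frac{\pi}{4}+i\pi^2=H^f(z),\quad z\in V_+,$$ $$H_-(z)-\frac{\pi}{4}=\pi z-H^{f^{\circ -1}}(z),\quad z\in V_-.$$
   Context: Formal changes of variables are tangent to the identity. The germ $f$ has one attracting petal $V_+$ (a domain accumulating at $0$, $f$-invariant, bisected by the negative real direction and tangent at $0$ to the positive real direction, on which forward orbits of $f$ converge to $0$) and one repelling petal $V_-$ (similarly for $f^{\circ -1}$, bisected by the positive real direction and tangent at $0$ to the negative real direction). Directed area: for $z\in V_+$ let $S^f(z)=\{f^{\circ n}(z): n\ge 0\}$ be the orbit, $S^f(z)_\varepsilon$ its $\varepsilon$-neighborhood (the union of the discs of radius $\varepsilon$ centered at points of the orbit), $A(S^f(z)_\varepsilon)$ the area of this set and $t_{S^f(z)_\varepsilon}\in\mathbb{C}$ its center of mass. The directed area is the complex number $A^{\mathbb{C}}(z,\varepsilon)=A(S^f(z)_\varepsilon)\cdot t_{S^f(z)_\varepsilon}$.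 For fixed $z\in V_+$ it is known that, as $\varepsilon\to0$, $$A^{\mathbb{C}}(z,\varepsilon)=q_1\varepsilon^2\log\varepsilon+H^{f}(z)\varepsilon^2+q_2\varepsilon^{5/2}\log\varepsilon+R(z,\varepsilon),\quad R(z,\varepsilon)=O(\varepsilon^{5/2}),$$ with $q_1,q_2\in\mathbb{C}$ independent of $z$. The principal part of area for $f$ is the function $z\mapsto H^f(z)$, $z\in V_+$, given by the coefficient of $\varepsilon^2$. The principal part of area $z\mapsto H^{f^{\circ -1}}(z)$, $z\in V_-$, for $f^{\circ -1}$ is defined in the same way from the directed area of the $\varepsilon$-neighborhood of the orbit $S^{f^{\circ -1}}(z)$ of $f^{\circ -1}$. Sectorially analytic solutions without constant term: the equation has a unique formal solution without constant term $\widehat H\in-\pi\log z+z\mathbb{C}[[z]]$, and $H_+$, $H_-$ are the unique analytic solutions on $V_+$, $V_-$, respectively, admitting $\widehat H$ as ($1$-Gevrey) asymptotic expansion as $z\to0$; here $\log z$ is the branch with $\arg z\in(0,2\pi)$ on $V_+$ and the principal branch ($\arg z\in(-\pi,\pi)$) on $V_-$. *)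

theory Defs
  imports "HOL-Complex_Analysis.Complex_Analysis" "HOL-Library.Landau_Symbols"
begin

definition formally_conjugate :: "complex fps \<Rightarrow> complex fps \<Rightarrow> bool" where
  "formally_conjugate F G \<longleftrightarrow>
     (\<exists>\<phi>. fps_nth \<phi> 0 = 0 \<and> fps_nth \<phi> 1 = 1 \<and> fps_compose \<phi> F = fps_compose G \<phi>)"

text \<open>
  An \<open>F\<close>-invariant petal bisected by the direction \<open>v\<close> (a unit complex number) and tangent
  at the origin to the direction \<open>-v\<close>: it contains a small sector around \<open>v\<close> of every opening
  less than \<open>2 * pi\<close>, so that close to the origin its boundary lies in arbitrarily thin sectors
  around \<open>-v\<close>, and it does not meet the ray of direction \<open>-v\<close> close to the origin.
  The repelling petal of \<open>f\<close> is obtained by taking the inverse of \<open>f\<close> for \<open>F\<close>.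
\<close>

definition petal :: "(complex \<Rightarrow> complex) \<Rightarrow> complex \<Rightarrow> complex set \<Rightarrow> bool" where
  "petal F v V \<longleftrightarrow>
     open V \<and> connected V \<and> 0 \<in> frontier V \<and>
     F ` V \<subseteq> V \<and>
     (\<forall>z\<in>V. (\<lambda>n. (F ^^ n) z) \<longlonglongrightarrow> 0) \<and>
     (\<forall>\<delta>\<in>{0<..<pi}. \<exists>r>0. \<forall>z. 0 < norm z \<and> norm z < r \<and> \<bar>Arg (z / v)\<bar> < pi - \<delta> \<longrightarrow> z \<in> V) \<and>
     (\<exists>r>0. \<forall>t::real. 0 < t \<and> t < r \<longrightarrow> - of_real t * v \<notin> V)"

definition orbit_of :: "(complex \<Rightarrow> complex) \<Rightarrow> complex \<Rightarrow> complex set" where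
  "orbit_of F z = {(F ^^ n) z | n. True}"

definition eps_nbhd :: "complex set \<Rightarrow> real \<Rightarrow> complex set" where
  "eps_nbhd S \<epsilon> = (\<Union>s\<in>S. ball s \<epsilon>)"

definition area :: "complex set \<Rightarrow> real" where
  "area B = measure lborel B"

definition center_of_mass :: "complex set \<Rightarrow> complex" where
  "center_of_mass B = (LINT w:B|lborel. w) / of_real (area B)"

definition directed_area :: "(complex \<Rightarrow> complex) \<Rightarrow> complex \<Rightarrow> real \<Rightarrow> complex" where
  "directed_area F z \<epsilon> =
     of_real (area (eps_nbhd (orbit_of F z) \<epsilon>)) * center_of_mass (eps_nbhd (orbit_of F z) \<epsilon>)"

definition directed_area_expansion ::
  "(complex \<Rightarrow> complex) \<Rightarrow> complex set \<Rightarrow> complex \<Rightarrow> complex \<Rightarrow> (complex \<Rightarrow> complex) \<Rightarrow> bool" where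
  "directed_area_expansion F V q1 q2 h \<longleftrightarrow>
     (\<forall>z\<in>V. (\<lambda>\<epsilon>::real. directed_area F z \<epsilon>
                - (q1 * of_real (\<epsilon>^2 * ln \<epsilon>) + h z * of_real (\<epsilon>^2)
                   + q2 * of_real (\<epsilon> powr (5/2) * ln \<epsilon>)))
            \<in> O[at_right 0](\<lambda>\<epsilon>. of_real (\<epsilon> powr (5/2))))"

definition principal_part_of_area ::
  "(complex \<Rightarrow> complex) \<Rightarrow> complex set \<Rightarrow> complex \<Rightarrow> complex" where
  "principal_part_of_area F V z =
     (THE c. \<exists>q1 q2 h. directed_area_expansion F V q1 q2 h \<and> h z = c)"

text \<open>
  The series \<open>- pi * log z + a(z)\<close> without constant term formally solves
  \<open>H(z) - H(f(z)) = pi * z\<close>, where \<open>F\<close> is the Taylor series of \<open>f\<close> and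
  \<open>log f(z) = log z + log (1 + (f(z)/z - 1))\<close>; \<open>fps_shift 1 F\<close> is the series of \<open>f(z)/z\<close>.
\<close>

definition formal_solution :: "complex fps \<Rightarrow> complex fps \<Rightarrow> bool" where
  "formal_solution F a \<longleftrightarrow>
     fps_nth a 0 = 0 \<and>
     fps_const (of_real pi) * fps_compose (fps_ln 1) (fps_shift 1 F - 1) + (a - fps_compose a F)
       = fps_const (of_real pi) * fps_X"

text \<open>
  \<open>h\<close> has \<open>a\<close> as 1-Gevrey asymptotic expansion at the origin in the petal \<open>V\<close> bisected by \<open>v\<close>.
  As usual the estimates are uniform on the proper subsectors of the sector of opening \<open>2 * pi\<close>.
\<close>

definition gevrey1_asymptotic ::
  "complex \<Rightarrow> complex set \<Rightarrow> (complex \<Rightarrow> complex) \<Rightarrow> complex fps \<Rightarrow> bool" where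
  "gevrey1_asymptotic v V h a \<longleftrightarrow>
     (\<forall>\<delta>\<in>{0<..<pi}. \<exists>r>0. \<exists>C>0. \<exists>M>0. \<forall>N::nat. \<forall>z\<in>V.
        norm z < r \<and> \<bar>Arg (z / v)\<bar> \<le> pi - \<delta> \<longrightarrow>
        norm (h z - (\<Sum>k<N. fps_nth a k * z ^ k)) \<le> C * M ^ N * fact N * norm z ^ N)"

definition log_plus :: "complex \<Rightarrow> complex" where
  "log_plus z = of_real (ln (norm z)) + \<i> * of_real (Arg2pi z)"

text \<open>
  \<open>L\<close> is the branch of the logarithm used on \<open>V\<close>. On the repelling petal the equation is imposed
  at those \<open>z\<close> for which \<open>f z\<close> is again in the petal.
\<close>

definition sectorial_solution ::
  "(complex \<Rightarrow> complex) \<Rightarrow> complex set \<Rightarrow> complex \<Rightarrow> (complex \<Rightarrow> complex) \<Rightarrow> complex set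
     \<Rightarrow> (complex \<Rightarrow> complex) \<Rightarrow> bool" where
  "sectorial_solution f U v L V H \<longleftrightarrow>
     H analytic_on V \<and>
     (\<forall>z\<in>V \<inter> U. f z \<in> V \<longrightarrow> H z - H (f z) = of_real pi * z) \<and>
     (\<exists>a. formal_solution (fps_expansion f 0) a \<and>
          gevrey1_asymptotic v V (\<lambda>z. H z - (- of_real pi * L z)) a)"

end

theory Submission
  imports Defs "HOL-Real_Asymp.Real_Asymp"
begin

text \<open>
  In the coordinate \<open>w = c / z\<close>, with \<open>c = -1\<close> for \<open>f\<close> and \<open>c = 1\<close> for its inverse, the dynamics is
  \<open>w \<mapsto> w + 1 + O(1 / w^2)\<close>, so the orbit is \<open>z n = c / (n + O(1))\<close>. Since the orbit is flat at 0, for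
  small \<open>\<epsilon>\<close> each disc of radius \<open>\<epsilon>\<close> meets the earlier ones inside the last of them only, and a lens,
  the intersection of two consecutive discs, has its center of mass at the middle of the centers. So the directed
  area is exactly the limit of \<open>\<epsilon>^2\<close> times
  \<open>pi * (\<Sum>n\<le>N. z n) - (\<Sum>n<N. lens_area (dist (z n) (z (n + 1)) / \<epsilon>) * (z n + z (n + 1)) / 2)\<close>.
  The lenses are empty for \<open>n\<close> below a multiple of \<open>1 / sqrt \<epsilon>\<close>, hence comparing the second sum with an integral costs
  \<open>O(sqrt \<epsilon>)\<close> only, and the integral is explicit. The coefficient of \<open>\<epsilon>^2\<close> is found to be
  \<open>pi * lim (\<Sum>n<N. z n - c * ln N) + c * pi / 4\<close>, with \<open>q1 = - c * pi / 2\<close> and \<open>q2 = 0\<close>.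
  The same limit comes out of iterating the difference equation, the branch of the logarithm giving the
  constant \<open>i * pi^2\<close> on the attracting petal.
\<close>

section \<open>The area of a lens\<close>

text \<open>Splitting the neighborhood into a tail of disjoint discs and a nucleus would leave a
  nucleus whose shape is hard to describe. Building the union one disc at a time avoids this, and
  the difficulty moves to the claim that a new disc meets the older ones inside its predecessor
  only. Crude estimates do not give it: the deviation of three orbit points from a line and the gain
  from convexity have the same order in the indices, and only the smallness of the radius separates
  them.

  The constant \<open>pi / 4\<close> goes back to the integral of \<open>x * cot x\<close> over
  \<open>[0, pi / 2]\<close>, which is \<open>pi / 2 * ln 2\<close>. Its logarithm is absorbed by
  the threshold 2 at which a lens becomes empty, and half of the area \<open>pi / 2\<close> of a
  half disc remains. The term \<open>pi * z\<close> on the repelling side is an index shift: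
  iterating the difference equation backwards collects the points after \<open>z\<close>, whereas
  the orbit of the inverse contains \<open>z\<close> itself.\<close>

text \<open>
  For \<open>0 \<le> t \<le> 1\<close> the first function is the area of the part of the unit disc over \<open>[0, t]\<close>; the
  second one is the area of the intersection of two unit discs whose centers have distance \<open>x\<close>.
\<close>

definition strip_area :: "real \<Rightarrow> real" where
  "strip_area t = (let s = max (-1) (min 1 t) in arcsin s + s * sqrt (1 - s^2))"

definition lens_area :: "real \<Rightarrow> real" where
  "lens_area x = pi - 2 * strip_area (x / 2)"

lemma strip_area_0 [simp]: "strip_area 0 = 0"
  by (simp add: strip_area_def)

lemma strip_area_ge_1: "t \<ge> 1 \<Longrightarrow> strip_area t = pi / 2"
  by (simp add: strip_area_def min_def)

lemma strip_area_eq: "\<bar>t\<bar> \<le> 1 \<Longrightarrow> strip_area t = arcsin t + t * sqrt (1 - t^2)"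
  by (simp add: strip_area_def)

lemma strip_area_minus [simp]: "strip_area (- t) = - strip_area t"
proof -
  have "max (-1) (min 1 (- t)) = - max (-1) (min 1 t)" by auto
  moreover have "arcsin (- max (-1) (min 1 t)) = - arcsin (max (-1) (min 1 t))"
    by (rule arcsin_minus) auto
  ultimately show ?thesis by (simp add: strip_area_def Let_def)
qed

lemma continuous_on_strip_area: "continuous_on S strip_area"
  unfolding strip_area_def Let_def
  by (intro continuous_intros) auto

lemma DERIV_strip_area:
  assumes "\<bar>t\<bar> < 1"
  shows "(strip_area has_real_derivative 2 * sqrt (1 - t^2)) (at t)"
proof -
  have t: "t^2 < 1" using assms by (simp add: abs_square_less_1)
  have *: "((\<lambda>t. arcsin t + t * sqrt (1 - t^2)) has_real_derivative
      inverse (sqrt (1 - t^2)) + (sqrt (1 - t^2) + t * (inverse (sqrt (1 - t^2)) / 2 * (- 2 * t)))) (at t)"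
    using assms t by (auto intro!: derivative_eq_intros simp: field_simps)
  have "sqrt (1 - t^2) * sqrt (1 - t^2) = 1 - t^2" using t by simp
  then have "inverse (sqrt (1 - t^2)) + (sqrt (1 - t^2) + t * (inverse (sqrt (1 - t^2)) / 2 * (- 2 * t)))
    = 2 * sqrt (1 - t^2)"
    using t by (simp add: field_simps power2_eq_square)
  with * have "((\<lambda>t. arcsin t + t * sqrt (1 - t^2)) has_real_derivative 2 * sqrt (1 - t^2)) (at t)"
    by (rule DERIV_cong)
  then show ?thesis
    by (rule has_field_derivative_transform_within_open[where S = "{-1<..<1}"])
       (use assms in \<open>auto simp: strip_area_eq\<close>)
qed

text \<open>Inside the interval the derivative lies in \<open>[0, 2]\<close>, and clamping the
  argument is 1-Lipschitz. Through this bound an error in the distance of two centers becomes an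
  error in the area of their lens.\<close>

lemma strip_area_Lipschitz: "\<bar>strip_area s - strip_area t\<bar> \<le> 2 * \<bar>s - t\<bar>"
proof -
  have main: "\<bar>strip_area b - strip_area a\<bar> \<le> 2 * (b - a)" if ab: "-1 \<le> a" "a < b" "b \<le> 1" for a b
  proof -
    have "\<exists>l z. z > a \<and> z < b \<and> (strip_area has_real_derivative l) (at z)
      \<and> strip_area b - strip_area a = (b - a) * l"
      by (rule MVT)
         (use ab in \<open>auto intro!: continuous_on_strip_area
            simp: real_differentiable_def intro!: exI DERIV_strip_area\<close>)
    then obtain l z where z: "z > a" "z < b" "(strip_area has_real_derivative l) (at z)"
      "strip_area b - strip_area a = (b - a) * l" by blast
    have l: "l = 2 * sqrt (1 - z^2)"
      using z ab by (intro DERIV_unique[OF z(3)] DERIV_strip_area) auto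
    have "\<bar>z\<bar> < 1" using z ab by auto
    then have "z^2 \<le> 1" by (simp add: abs_square_le_1)
    then have "0 \<le> l" "l \<le> 2" by (auto simp: l)
    then show ?thesis
      using ab mult_left_mono[of l 2 "b - a"] by (simp add: z(4) abs_mult)
  qed
  define cl where "cl = (\<lambda>t::real. max (-1) (min 1 t))"
  have cl: "strip_area t = strip_area (cl t)" "-1 \<le> cl t" "cl t \<le> 1" for t
    by (auto simp: strip_area_def cl_def)
  have "\<bar>strip_area (cl s) - strip_area (cl t)\<bar> \<le> 2 * \<bar>cl s - cl t\<bar>"
    using main[of "cl s" "cl t"] main[of "cl t" "cl s"] cl
    by (cases "cl s" "cl t" rule: linorder_cases) auto
  also have "\<bar>cl s - cl t\<bar> \<le> \<bar>s - t\<bar>" by (auto simp: cl_def)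
  finally show ?thesis using cl(1) by simp
qed

lemma lens_area_Lipschitz: "\<bar>lens_area x - lens_area y\<bar> \<le> 2 * \<bar>x - y\<bar>"
  proof -
  have "\<bar>lens_area x - lens_area y\<bar> = 2 * \<bar>strip_area (x/2) - strip_area (y/2)\<bar>"
    by (simp add: lens_area_def abs_if)
  also have "\<dots> \<le> 2 * (2 * \<bar>x/2 - y/2\<bar>)"
    by (intro mult_left_mono strip_area_Lipschitz) simp
  also have "\<bar>x/2 - y/2\<bar> = \<bar>x - y\<bar> / 2" by (simp add: abs_if)
  finally show ?thesis by simp
qed

lemma lens_area_0 [simp]: "lens_area 0 = pi"
  by (simp add: lens_area_def)

lemma lens_area_ge_2 [simp]: "x \<ge> 2 \<Longrightarrow> lens_area x = 0"
  by (simp add: lens_area_def strip_area_ge_1)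

lemma strip_area_nonneg: "t \<ge> 0 \<Longrightarrow> strip_area t \<ge> 0"
proof -
  assume t: "t \<ge> 0"
  define s where "s = max (-1) (min 1 t)"
  have s: "0 \<le> s" "s \<le> 1" using t by (auto simp: s_def)
  have "arcsin 0 \<le> arcsin s" using s by (intro arcsin_le_arcsin) auto
  then have "0 \<le> arcsin s" by simp
  moreover have "s^2 \<le> 1" using s by (simp add: abs_square_le_1)
  ultimately show ?thesis
    using s by (auto simp: strip_area_def Let_def s_def[symmetric])
qed

lemma strip_area_le: "strip_area t \<le> pi / 2"
proof (cases "t \<ge> 1")
  case False
  show ?thesis
  proof (cases "t \<ge> 0")
    case True
    have "strip_area t \<le> strip_area 1"
    proof (rule DERIV_nonneg_imp_increasing_open[where f = strip_area])
      fix x :: real assume "t < x" "x < 1"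
      then show "\<exists>y. (strip_area has_real_derivative y) (at x) \<and> 0 \<le> y"
        using True DERIV_strip_area[of x] by (intro exI[of _ "2 * sqrt (1 - x^2)"]) (auto simp: abs_square_le_1)
    qed (use False in \<open>auto intro: continuous_on_strip_area\<close>)
    then show ?thesis by (simp add: strip_area_ge_1)
  next
    case False
    have "strip_area (- t) \<ge> 0" using False by (intro strip_area_nonneg) auto
    then show ?thesis using pi_gt_zero by (simp del: pi_gt_zero)
  qed
qed (simp add: strip_area_ge_1)

lemma lens_area_bounds: "x \<ge> 0 \<Longrightarrow> 0 \<le> lens_area x" "x \<ge> 0 \<Longrightarrow> lens_area x \<le> pi"
  using strip_area_le[of "x/2"] strip_area_nonneg[of "x/2"] by (auto simp: lens_area_def)

section \<open>The integral of \<open>x * cot x\<close>\<close>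

text \<open>This integrand appears in \<open>strip_int_2\<close> after the substitution
  \<open>x = 2 * sin s\<close>; the value at 0 is the limit.\<close>

definition xcot :: "real \<Rightarrow> real" where
  "xcot x = (if x = 0 then 1 else x * cos x / sin x)"

lemma continuous_on_xcot: "continuous_on {0..pi/2} xcot"
proof -
  have lim: "((\<lambda>x::real. x * cos x / sin x) \<longlongrightarrow> 1) (at 0)"
  proof -
    have "((\<lambda>x::real. sin x / x) \<longlongrightarrow> 1) (at 0)"
      using DERIV_sin[of "0::real"] by (simp add: has_field_derivative_iff)
    then have "((\<lambda>x::real. cos x / (sin x / x)) \<longlongrightarrow> cos 0 / 1) (at 0)"
      by (intro tendsto_intros) auto
    then show ?thesis by (simp add: mult.commute)
  qed
  have "isCont xcot x" if "x \<in> {0..pi/2}" for x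
  proof (cases "x = 0")
    case True
    have "(xcot \<longlongrightarrow> 1) (at 0)"
      using lim by (rule Lim_transform_eventually) (auto simp: xcot_def eventually_at_filter)
    then show ?thesis by (simp add: True isCont_def xcot_def)
  next
    case False
    have "sin x > 0" using False that pi_gt_zero by (intro sin_gt_zero) auto
    then have "isCont (\<lambda>x. x * cos x / sin x) x" by (intro continuous_intros) auto
    moreover have "eventually (\<lambda>y. xcot y = y * cos y / sin y) (nhds x)"
      using t1_space_nhds[OF False] by eventually_elim (auto simp: xcot_def)
    ultimately show ?thesis by (simp add: isCont_cong)
  qed
  then show ?thesis by (simp add: continuous_at_imp_continuous_on)
qed

lemma DERIV_integral_from_0:
  fixes g :: "real \<Rightarrow> real"
  assumes "continuous_on {0..b} g" and "0 < x" "x < b"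
  shows "((\<lambda>t. integral {0..t} g) has_real_derivative g x) (at x)"
proof -
  have "((\<lambda>t. integral {0..t} g) has_real_derivative g x) (at x within {0..b})"
    by (rule integral_has_real_derivative) (use assms in auto)
  moreover have "at x within {0..b} = at x"
    by (rule at_within_interior) (use assms in auto)
  ultimately show ?thesis by simp
qed

text \<open>
  The duplication formula \<open>2 cot 2t = cot t - tan t\<close> makes the auxiliary function \<open>D\<close> constant.
\<close>

lemma integral_xcot: "integral {0..pi/2} xcot = pi / 2 * ln 2"
proof -
  define M where "M = (\<lambda>t. integral {0..t} xcot)"
  have int: "xcot integrable_on {0..pi/2}"
    by (rule integrable_continuous_real) (rule continuous_on_xcot)
  have contM: "continuous_on {0..pi/2} M"
    unfolding M_def by (rule indefinite_integral_continuous_1[OF int])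
  have DM: "(M has_real_derivative x * cos x / sin x) (at x)" if "0 < x" "x < pi/2" for x
    using DERIV_integral_from_0[OF continuous_on_xcot that] that
    by (simp add: M_def xcot_def)
  define D where "D = (\<lambda>t. M (2*t) - 2 * M t + 2 * M (pi/2 - t) - pi * ln (cos t))"
  have cospos: "cos t > 0" if "0 \<le> t" "t \<le> pi/4" for t :: real
  proof (rule cos_gt_zero_pi)
    show "- (pi/2) < t" "t < pi/2" using that pi_gt_zero by linarith+
  qed
  \<comment> \<open>At \<open>pi / 4\<close> the terms \<open>M t\<close> and
    \<open>M (pi / 2 - t)\<close> cancel, and at 0 the unknown \<open>M (pi / 2)\<close> enters
    twice, so equality of the two ends is a linear equation for the integral.\<close>
  have "D (pi/4) = D 0"
  proof (rule DERIV_isconst_end[where f = D])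
    show "0 < pi/4" by simp
    show "continuous_on {0..pi/4} D"
      unfolding D_def using cospos
      by (intro continuous_intros continuous_on_compose2[OF contM]) force+
    fix t :: real assume t: "0 < t" "t < pi/4"
    have pos: "sin t > 0" "cos t > 0"
      using t by (auto intro!: sin_gt_zero cospos)
    have DM2: "((\<lambda>t. M (2 * t)) has_real_derivative (2*t) * cos (2*t) / sin (2*t) * 2) (at t)"
      by (rule DERIV_chain2[where f = M, OF DM]) (use t in \<open>auto intro!: derivative_eq_intros\<close>)
    have DM3: "((\<lambda>t. M (pi/2 - t)) has_real_derivative
        (pi/2 - t) * cos (pi/2 - t) / sin (pi/2 - t) * (- 1)) (at t)"
      by (rule DERIV_chain2[where f = M, OF DM]) (use t in \<open>auto intro!: derivative_eq_intros\<close>)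
    have "(D has_real_derivative (2*t) * cos (2*t) / sin (2*t) * 2 - 2 * (t * cos t / sin t)
        + 2 * ((pi/2 - t) * cos (pi/2 - t) / sin (pi/2 - t) * (- 1)) - pi * (- sin t / cos t)) (at t)"
      unfolding D_def using t pos
      by (intro DERIV_diff DERIV_add DERIV_cmult DM2 DM3 DM)
         (auto intro!: derivative_eq_intros)
    also have "(2*t) * cos (2*t) / sin (2*t) * 2 - 2 * (t * cos t / sin t)
        + 2 * ((pi/2 - t) * cos (pi/2 - t) / sin (pi/2 - t) * (- 1)) - pi * (- sin t / cos t) = 0"
      using pos unfolding cos_double sin_double cos_diff sin_diff
      by (simp add: field_simps power2_eq_square)
    finally show "(D has_real_derivative 0) (at t)" .
  qed
  moreover have "D 0 = 2 * M (pi/2)" by (simp add: D_def M_def)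
  moreover have "D (pi/4) = M (pi/2) - pi * ln (sqrt 2 / 2)"
    by (simp add: D_def cos_45)
  moreover have "ln (sqrt 2 / 2) = - ln 2 / 2"
    by (simp add: ln_div ln_sqrt)
  ultimately show ?thesis by (simp add: M_def)
qed

section \<open>Integrals of the lens area\<close>

text \<open>\<open>lens_area x / x\<close> is not integrable at 0, so the complement of the lens is
  integrated instead: \<open>x * strip_quot x = pi - lens_area x\<close>. The value 2 at 0 is the
  limit.\<close>

definition strip_quot :: "real \<Rightarrow> real" where
  "strip_quot x = (if x = 0 then 2 else 2 * strip_area (x / 2) / x)"

definition strip_int :: "real \<Rightarrow> real" where
  "strip_int x = integral {0..x} strip_quot"

lemma continuous_on_strip_quot: "continuous_on S strip_quot"
proof -
  have D0: "((\<lambda>x. 2 * strip_area (x / 2)) has_real_derivative 2) (at 0)"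
    using DERIV_strip_area[of 0]
    by (auto intro!: derivative_eq_intros DERIV_chain2[where f = strip_area])
  have "isCont strip_quot x" for x
  proof (cases "x = 0")
    case True
    have "((\<lambda>x. 2 * strip_area (x / 2) / x) \<longlongrightarrow> 2) (at 0)"
      using D0 by (simp add: has_field_derivative_iff)
    then have "(strip_quot \<longlongrightarrow> 2) (at 0)"
      by (rule Lim_transform_eventually) (auto simp: strip_quot_def eventually_at_filter)
    then show ?thesis by (simp add: True isCont_def strip_quot_def)
  next
    case False
    have "isCont strip_area y" for y
      using continuous_on_strip_area[of UNIV] by (simp add: continuous_on_eq_continuous_at)
    then have "isCont (\<lambda>x. strip_area (x / 2)) x"
      by (rule isCont_o2[rotated]) (intro continuous_intros, simp)
    then have "isCont (\<lambda>x. 2 * strip_area (x / 2) / x) x"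
      using False by (intro continuous_intros)
    moreover have "eventually (\<lambda>y. strip_quot y = 2 * strip_area (y / 2) / y) (nhds x)"
      using t1_space_nhds[OF False] by eventually_elim (auto simp: strip_quot_def)
    ultimately show ?thesis by (simp add: isCont_cong)
  qed
  then show ?thesis by (simp add: continuous_at_imp_continuous_on)
qed

lemma DERIV_strip_int:
  assumes "x > 0" shows "(strip_int has_real_derivative 2 * strip_area (x / 2) / x) (at x)"
proof -
  have "((\<lambda>t. integral {0..t} strip_quot) has_real_derivative strip_quot x) (at x)"
    by (rule DERIV_integral_from_0[OF continuous_on_strip_quot[of "{0..x + 1}"]]) (use assms in auto)
  moreover have "strip_quot x = 2 * strip_area (x / 2) / x"
    using assms by (simp add: strip_quot_def)
  ultimately show ?thesis unfolding strip_int_def[abs_def] by simp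
qed

lemma continuous_on_strip_int: "continuous_on {0..b} strip_int"
proof -
  have "strip_quot integrable_on {0..b}"
    by (rule integrable_continuous_real) (rule continuous_on_strip_quot)
  then show ?thesis
    unfolding strip_int_def[abs_def] by (rule indefinite_integral_continuous_1)
qed

text \<open>With \<open>u = x / 2\<close> the integrand is
  \<open>arcsin u / u + sqrt (1 - u^2)\<close>. The second term integrates to
  \<open>strip_area\<close>, and \<open>u = sin s\<close> turns the first one into
  \<open>xcot\<close>. The derivatives are compared on the open interval only, since
  \<open>arcsin\<close> is not differentiable at 1.\<close>

lemma strip_int_2: "strip_int 2 = pi / 2 + pi * ln 2"
proof -
  define M where "M = (\<lambda>t. integral {0..t} xcot)"
  have int: "xcot integrable_on {0..pi/2}"
    by (rule integrable_continuous_real) (rule continuous_on_xcot)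
  have contM: "continuous_on {0..pi/2} M"
    unfolding M_def by (rule indefinite_integral_continuous_1[OF int])
  define D where "D = (\<lambda>x. strip_int x - (2 * M (arcsin (x/2)) + strip_area (x/2)))"
  have arcsin_in: "arcsin u \<in> {0..pi/2}" if "0 \<le> u" "u \<le> 1" for u
    using that arcsin_le_arcsin[of 0 u] arcsin_ubound[of u] by auto
  have "D 2 = D 0"
  proof (rule DERIV_isconst_end[where f = D])
    show "continuous_on {0..2} D"
    proof -
      have "continuous_on {0..2} (\<lambda>x. arcsin (x/2))"
        by (rule continuous_on_arcsin) (auto intro!: continuous_intros)
      then have "continuous_on {0..2} (\<lambda>x. M (arcsin (x/2)))"
        by (rule continuous_on_compose2[OF contM]) (use arcsin_in in force)
      moreover have "continuous_on {0..2::real} (\<lambda>x. strip_area (x/2))"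
        by (rule continuous_on_compose2[OF continuous_on_strip_area[of UNIV]])
           (auto intro!: continuous_intros)
      ultimately show ?thesis
        unfolding D_def by (intro continuous_on_diff continuous_on_add continuous_on_mult
            continuous_on_const continuous_on_strip_int)
    qed
    fix x :: real assume x: "0 < x" "x < 2"
    define u where "u = x / 2"
    have u: "0 < u" "u < 1" using x by (auto simp: u_def)
    then have u2: "u^2 < 1" by (simp add: abs_square_less_1)
    have as: "0 < arcsin u" "arcsin u < pi / 2"
      using u arcsin_less_arcsin[of 0 u] arcsin_less_arcsin[of u 1] by simp_all
    have "xcot (arcsin u) = arcsin u * sqrt (1 - u^2) / u"
      using u as by (simp add: xcot_def cos_arcsin)
    then have DM: "(M has_real_derivative arcsin u * sqrt (1 - u^2) / u) (at (arcsin u))"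
      using DERIV_integral_from_0[OF continuous_on_xcot as] by (simp add: M_def)
    have DM2: "((\<lambda>x. M (arcsin (x/2))) has_real_derivative
        arcsin u * sqrt (1 - u^2) / u * (inverse (sqrt (1 - u^2)) / 2)) (at x)"
      by (rule DERIV_chain2[where f = M])
         (use u DM in \<open>auto intro!: derivative_eq_intros simp: u_def\<close>)
    have DS: "((\<lambda>x. strip_area (x/2)) has_real_derivative 2 * sqrt (1 - u^2) * (1/2)) (at x)"
      by (rule DERIV_chain2[where f = strip_area])
         (use u DERIV_strip_area[of u] in \<open>auto intro!: derivative_eq_intros simp: u_def\<close>)
    have "(D has_real_derivative 2 * strip_area (x / 2) / x - (2 * (arcsin u * sqrt (1 - u^2) / u * (inverse (sqrt (1 - u^2)) / 2))
       + 2 * sqrt (1 - u^2) * (1/2))) (at x)"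
      unfolding D_def by (intro DERIV_diff DERIV_add DERIV_strip_int DM2 DS DERIV_cmult x)
    also have "2 * strip_area (x / 2) / x - (2 * (arcsin u * sqrt (1 - u^2) / u * (inverse (sqrt (1 - u^2)) / 2))
       + 2 * sqrt (1 - u^2) * (1/2)) = 0"
    proof -
      have "2 * strip_area (x / 2) / x = strip_area u / u" by (simp add: u_def)
      also have "\<dots> = arcsin u / u + sqrt (1 - u^2)"
        using u by (simp add: strip_area_eq field_simps)
      finally show ?thesis using u u2 by (simp add: field_simps)
    qed
    finally show "(D has_real_derivative 0) (at x)" .
  qed simp
  moreover have "D 0 = 0" by (simp add: D_def M_def strip_int_def)
  moreover have "D 2 = strip_int 2 - (2 * M (pi/2) + pi/2)"
    by (simp add: D_def strip_area_ge_1)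
  ultimately show ?thesis using integral_xcot by (simp add: M_def)
qed

text \<open>From 2 on the strip is the whole half disc and the integrand is
  \<open>pi / x\<close>.\<close>

lemma strip_int_ge_2: "x \<ge> 2 \<Longrightarrow> strip_int x = pi / 2 + pi * ln x"
proof -
  assume x: "x \<ge> 2"
  define D where "D = (\<lambda>x. strip_int x - pi * ln x)"
  have "D x = D 2"
  proof (cases "x = 2")
    case False
    show ?thesis
    proof (rule DERIV_isconst_end[where f = D])
      show "2 < x" using x False by simp
      show "continuous_on {2..x} D"
        unfolding D_def
        by (intro continuous_on_diff continuous_on_mult continuous_on_const continuous_on_ln continuous_on_id
              continuous_on_subset[OF continuous_on_strip_int[of x]]) auto
      fix y :: real assume y: "2 < y" "y < x"
      then have "(D has_real_derivative 2 * strip_area (y / 2) / y - pi * (1 / y)) (at y)"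
        unfolding D_def by (intro DERIV_diff DERIV_cmult DERIV_strip_int DERIV_ln_divide) auto
      then show "(D has_real_derivative 0) (at y)"
        using y by (simp add: strip_area_ge_1)
    qed
  qed simp
  then show ?thesis using strip_int_2 by (simp add: D_def)
qed

text \<open>
  The constant \<open>pi / 4\<close> makes this primitive of \<open>lens_area (1 / y^2) / y\<close> vanish for small \<open>y\<close>; it is
  the constant that appears in the theorem.
\<close>

definition lens_prim :: "real \<Rightarrow> real" where
  "lens_prim y = pi * ln y - pi / 4 + strip_int (1 / y^2) / 2"

text \<open>Here \<open>y\<close> stands for \<open>t * sqrt e\<close>: the model orbit
  \<open>c / t\<close> has gaps close to \<open>1 / t^2\<close>, so \<open>1 / y^2\<close> is the
  gap divided by the radius.\<close>

lemma DERIV_lens_prim: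
  assumes "y > 0" shows "(lens_prim has_real_derivative lens_area (1 / y^2) / y) (at y)"
proof -
  have *: "((\<lambda>y. strip_int (1 / y^2)) has_real_derivative
      2 * strip_area (1 / y^2 / 2) / (1 / y^2) * (- 2 / y^3)) (at y)"
  proof (rule DERIV_chain2[where f = strip_int])
    show "(strip_int has_real_derivative 2 * strip_area (1 / y^2 / 2) / (1 / y^2)) (at (1 / y^2))"
      using assms by (intro DERIV_strip_int) simp
    show "((\<lambda>y. 1 / y^2) has_real_derivative - 2 / y^3) (at y)"
      using assms by (auto intro!: derivative_eq_intros simp: field_simps eval_nat_numeral)
  qed
  have "(lens_prim has_real_derivative pi * (1 / y) - 0 + 2 * strip_area (1 / y^2 / 2) / (1 / y^2) * (- 2 / y^3) / 2) (at y)"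
    unfolding lens_prim_def[abs_def]
    by (intro DERIV_add DERIV_diff DERIV_const DERIV_cdivide * DERIV_cmult DERIV_ln_divide assms)
  then show ?thesis using assms
    by (simp add: lens_area_def field_simps eval_nat_numeral)
qed

text \<open>This is the range of disjoint discs. The logarithm from \<open>strip_int_ge_2\<close>
  cancels \<open>pi * ln y\<close>, and half of its constant \<open>pi / 2\<close> cancels
  \<open>pi / 4\<close>.\<close>

lemma lens_prim_eq_0:
  assumes "y > 0" "2 * y^2 \<le> 1" shows "lens_prim y = 0"
proof -
  have "1 / y^2 \<ge> 2" using assms by (simp add: field_simps)
  then have "strip_int (1 / y^2) = pi / 2 + pi * ln (1 / y^2)" by (rule strip_int_ge_2)
  also have "ln (1 / y^2) = - 2 * ln y" using assms by (simp add: ln_div ln_realpow)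
  finally show ?thesis by (simp add: lens_prim_def field_simps)
qed

text \<open>For large \<open>y\<close> the gaps are small compared with the radius. As
  \<open>strip_int\<close> vanishes at 0, only the normalizing constant survives; it enters the
  coefficient of \<open>e^2\<close> here.\<close>

lemma lens_prim_asymptotics: "((\<lambda>y. pi * ln y - lens_prim y) \<longlongrightarrow> pi / 4) at_top"
proof -
  have "(strip_int \<longlongrightarrow> strip_int 0) (at 0 within {0..1})"
    using continuous_on_strip_int[of 1] by (simp add: continuous_on_def)
  then have "(strip_int \<longlongrightarrow> 0) (at_right 0)"
    by (simp add: strip_int_def at_within_Icc_at_right)
  moreover have "filterlim (\<lambda>y::real. 1 / y^2) (at_right 0) at_top"
    by real_asymp
  ultimately have "((\<lambda>y. strip_int (1 / y^2)) \<longlongrightarrow> 0) at_top"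
    by (rule filterlim_compose)
  then have "((\<lambda>y. pi / 4 - strip_int (1 / y^2) / 2) \<longlongrightarrow> pi / 4 - 0 / 2) at_top"
    by (intro tendsto_intros) auto
  then show ?thesis by (simp add: lens_prim_def)
qed

section \<open>Overlapping discs in the plane\<close>

text \<open>A Borel measure that is right on boxes is Lebesgue measure. This description makes
  Fubini available on the complex plane.\<close>

lemma lborel_complex_prod: "distr (lborel \<Otimes>\<^sub>M lborel) borel (\<lambda>(x, y). Complex x y) = lborel"
proof (rule lborel_eqI[symmetric])
  have [measurable]: "(\<lambda>(x, y). Complex x y) \<in> borel_measurable (borel \<Otimes>\<^sub>M borel)"
    unfolding borel_prod
    by (intro borel_measurable_continuous_onI) (simp add: Complex_eq split_beta continuous_intros)
  fix l u :: complex
  assume *: "\<And>b. b \<in> Basis \<Longrightarrow> l \<bullet> b \<le> u \<bullet> b"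
  have lu: "Re l \<le> Re u" "Im l \<le> Im u"
    using *[of 1] *[of \<i>] by (auto simp: Basis_complex_def)
  have "(\<lambda>(x, y). Complex x y) -` box l u = {Re l<..<Re u} \<times> {Im l<..<Im u}"
    by (auto simp: box_def Basis_complex_def)
  then have "emeasure (distr (lborel \<Otimes>\<^sub>M lborel) borel (\<lambda>(x, y). Complex x y)) (box l u)
    = emeasure (lborel \<Otimes>\<^sub>M lborel) ({Re l<..<Re u} \<times> {Im l<..<Im u})"
    by (simp add: emeasure_distr space_pair_measure)
  also have "\<dots> = ennreal (Re u - Re l) * ennreal (Im u - Im l)"
    using lu by (simp add: lborel.emeasure_pair_measure_Times)
  also have "\<dots> = (\<Prod>b\<in>Basis. (u - l) \<bullet> b)"
    using lu by (simp add: Basis_complex_def ennreal_mult)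
  finally show "emeasure (distr (lborel \<Otimes>\<^sub>M lborel) borel (\<lambda>(x, y). Complex x y)) (box l u)
    = (\<Prod>b\<in>Basis. (u - l) \<bullet> b)" .
qed simp

text \<open>This second description gives access to the invariance of Lebesgue measure under
  orthogonal maps of \<open>real^2\<close>.\<close>

lemma lborel_complex_vec: "distr lborel borel (\<lambda>v::real^2. Complex (v $ 1) (v $ 2)) = lborel"
proof (rule lborel_eqI[symmetric])
  have [measurable]: "(\<lambda>v::real^2. Complex (v $ 1) (v $ 2)) \<in> borel_measurable borel"
    by (intro borel_measurable_continuous_onI) (simp add: Complex_eq continuous_intros)
  fix l u :: complex
  assume *: "\<And>b. b \<in> Basis \<Longrightarrow> l \<bullet> b \<le> u \<bullet> b"
  have lu: "Re l \<le> Re u" "Im l \<le> Im u"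
    using *[of 1] *[of \<i>] by (auto simp: Basis_complex_def)
  define l' :: "real^2" where "l' = vector [Re l, Im l]"
  define u' :: "real^2" where "u' = vector [Re u, Im u]"
  have "(\<lambda>v::real^2. Complex (v $ 1) (v $ 2)) -` box l u = box l' u'"
    by (intro set_eqI) (simp add: mem_box_cart forall_2 l'_def u'_def in_box_complex_iff)
  then have "emeasure (distr lborel borel (\<lambda>v::real^2. Complex (v $ 1) (v $ 2))) (box l u)
    = emeasure lborel (box l' u')"
    by (simp add: emeasure_distr)
  also have "\<dots> = (\<Prod>b\<in>Basis. (u' - l') \<bullet> b)"
  proof (rule emeasure_lborel_box)
    fix b :: "real^2" assume "b \<in> Basis"
    then obtain i where "b = axis i 1" by (auto simp: Basis_vec_def)
    then show "l' \<bullet> b \<le> u' \<bullet> b"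
      using lu exhaust_2[of i] by (auto simp: inner_axis l'_def u'_def)
  qed
  also have "(\<Prod>b\<in>Basis. (u' - l') \<bullet> b) = (\<Prod>b\<in>Basis. (u - l) \<bullet> b)"
  proof -
    have "(\<Prod>b\<in>(Basis :: (real^2) set). (u' - l') \<bullet> b) = (\<Prod>i\<in>UNIV. (u' - l') $ i)"
    proof -
      have B: "(Basis :: (real^2) set) = (\<lambda>i. axis i 1) ` UNIV" by (auto simp: Basis_vec_def)
      have "inj (\<lambda>i::2. axis i (1::real))" by (auto simp: inj_def axis_eq_axis)
      then show ?thesis
        unfolding B by (subst prod.reindex) (simp_all add: inner_axis)
    qed
    also have "\<dots> = (Re u - Re l) * (Im u - Im l)"
      by (simp add: UNIV_2 u'_def l'_def)
    also have "\<dots> = (\<Prod>b\<in>Basis. (u - l) \<bullet> b)" by (simp add: Basis_complex_def)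
    finally show ?thesis .
  qed
  finally show "emeasure (distr lborel borel (\<lambda>v::real^2. Complex (v $ 1) (v $ 2))) (box l u)
    = (\<Prod>b\<in>Basis. (u - l) \<bullet> b)" .
qed simp

text \<open>A rotation and a translation move any pair of centers to any other pair at the same
  distance, so that a lens may be placed on the real axis.\<close>

lemma measure_lens_dist:
  fixes a b a' b' :: complex
  assumes "dist a b = dist a' b'"
  shows "measure lborel (ball a e \<inter> ball b e) = measure lborel (ball a' e \<inter> ball b' e)"
proof -
  define T where "T = (\<lambda>v::real^2. Complex (v $ 1) (v $ 2))"
  define T' :: "complex \<Rightarrow> real^2" where "T' = (\<lambda>z. vector [Re z, Im z])"
  have [measurable]: "T \<in> borel_measurable borel"
    unfolding T_def
    by (intro borel_measurable_continuous_onI) (simp add: Complex_eq continuous_intros)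
  have dist: "dist (T' z) v = dist z (T v)" for z v
    by (simp add: dist_norm norm_vec_def L2_set_def sum_2 cmod_def T_def T'_def)
  have dist': "dist (T' z) (T' w) = dist z w" for z w
    by (simp add: dist_norm norm_vec_def L2_set_def sum_2 cmod_def T_def T'_def)
  have vec: "measure lborel (ball a e \<inter> ball b e) = measure lebesgue (ball (T' a) e \<inter> ball (T' b) e)" for a b
  proof -
    have "T -` (ball a e \<inter> ball b e) = ball (T' a) e \<inter> ball (T' b) e"
      using dist by auto
    then have "measure (distr lborel borel T) (ball a e \<inter> ball b e) = measure lborel (ball (T' a) e \<inter> ball (T' b) e)"
      by (simp add: measure_distr)
    then show ?thesis
      using lborel_complex_vec by (simp add: T_def measure_completion)
  qed
  \<comment> \<open>Both pairs are brought to one normal form, with centers 0 and \<open>p\<close>;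
    no motion between the two given pairs has to be composed.\<close>
  have rot: "measure lebesgue (ball v e \<inter> ball w e) = measure lebesgue (ball 0 e \<inter> ball p e)"
    if eq: "norm p = dist v w" for v w p :: "real^2"
  proof -
    have "norm p = norm (w - v)" using eq by (simp add: dist_norm norm_minus_commute)
    then obtain f where f: "orthogonal_transformation f" "f p = w - v"
      using orthogonal_transformation_exists by blast
    have "inj f" using f(1) orthogonal_transformation_inj by blast
    then have "f ` (ball 0 e \<inter> ball p e) = ball (f 0) e \<inter> ball (f p) e"
      using image_orthogonal_transformation_ball[OF f(1)] by (simp add: image_Int)
    also have "f 0 = 0" using f(1) by (simp add: orthogonal_transformation_linear linear_0)
    finally have *: "f ` (ball 0 e \<inter> ball p e) = ball 0 e \<inter> ball (w - v) e" using f by simp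
    have "measure lebesgue (ball 0 e \<inter> ball p e) = measure lebesgue (ball 0 e \<inter> ball (w - v) e)"
      using measure_orthogonal_image[OF f(1), of "ball 0 e \<inter> ball p e"] *
      by (simp add: fmeasurable.Int)
    also have "\<dots> = measure lebesgue ((+) v ` (ball 0 e \<inter> ball (w - v) e))"
      by (simp add: measure_translation)
    also have "(+) v ` (ball 0 e \<inter> ball (w - v) e) = ball v e \<inter> ball w e"
      by (simp add: image_Int ball_translation[symmetric])
    finally show ?thesis by simp
  qed
  define p where "p = T' (b - a)"
  have p: "norm p = dist a b"
    by (simp add: p_def T'_def norm_vec_def L2_set_def sum_2 cmod_def dist_norm norm_minus_commute power2_commute)
  show ?thesis
    using rot[of p "T' a" "T' b"] rot[of p "T' a'" "T' b'"] p assms dist' by (simp add: vec)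
qed

text \<open>The \<open>max\<close> lets one formula serve also the empty slices outside the
  lens.\<close>

lemma emeasure_square_less: "emeasure lborel {y::real. y^2 < c} = ennreal (2 * sqrt (max 0 c))"
proof (cases "c > 0")
  case True
  have "y^2 < c \<longleftrightarrow> \<bar>y\<bar> < sqrt c" for y
    using real_sqrt_less_iff[of "y^2" c] by (simp del: real_sqrt_less_iff)
  then have "{y::real. y^2 < c} = {y. \<bar>y\<bar> < sqrt c}"
    by (simp only:)
  also have "\<dots> = {- sqrt c <..< sqrt c}"
    by auto
  finally have "{y::real. y^2 < c} = {- sqrt c <..< sqrt c}" .
  then show ?thesis using True by simp
next
  case False
  have "\<not> y^2 < c" for y :: real
    using False zero_le_power2[of y] by linarith
  then have "{y::real. y^2 < c} = {}" by blast
  then show ?thesis using False by simp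
qed

text \<open>Fubini over vertical slices: both discs restrict the height over \<open>x\<close>, and
  the farther center decides. Hence the maximum in \<open>g\<close> and the cut at the midpoint
  \<open>d / 2\<close>.\<close>

lemma measure_lens_axis:
  assumes "0 < e" "0 \<le> d" "d < 2 * e"
  shows "measure lborel (ball 0 e \<inter> ball (complex_of_real d) e) = e^2 * lens_area (d / e)"
proof -
  define S where "S = ball 0 e \<inter> ball (complex_of_real d) e"
  define g where "g = (\<lambda>x. e^2 - max (x^2) ((x - d)^2))"
  define F where "F = (\<lambda>x. 2 * sqrt (max 0 (g x)))"
  have [measurable]: "(\<lambda>(x, y). Complex x y) \<in> borel_measurable (borel \<Otimes>\<^sub>M borel)"
    unfolding borel_prod
    by (intro borel_measurable_continuous_onI) (simp add: Complex_eq split_beta continuous_intros)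
  have S: "S \<in> sets borel" by (simp add: S_def)
  have mem: "Complex x y \<in> S \<longleftrightarrow> y^2 < g x" for x y
  proof -
    have norm_less: "cmod z < e \<longleftrightarrow> (Re z)^2 + (Im z)^2 < e^2" for z
      using \<open>0 < e\<close> unfolding cmod_power2[symmetric]
      by (meson norm_ge_zero order_less_imp_le power2_less_imp_less power_strict_mono pos2)
    have "cmod (Complex x y) < e \<longleftrightarrow> x^2 + y^2 < e^2"
      by (simp add: norm_less)
    moreover have "cmod (complex_of_real d - Complex x y) < e \<longleftrightarrow> (d - x)^2 + y^2 < e^2"
      by (simp add: norm_less)
    moreover have "(d - x)^2 = (x - d)^2" by (rule power2_commute)
    ultimately show ?thesis by (auto simp: S_def g_def dist_norm max_def)
  qed
  have "emeasure lborel S = emeasure (lborel \<Otimes>\<^sub>M lborel) ((\<lambda>(x, y). Complex x y) -` S)"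
    using S by (subst lborel_complex_prod[symmetric]) (simp add: emeasure_distr space_pair_measure)
  also have "\<dots> = (\<integral>\<^sup>+x. emeasure lborel (Pair x -` ((\<lambda>(x, y). Complex x y) -` S)) \<partial>lborel)"
  proof (rule lborel.emeasure_pair_measure_alt)
    have "(\<lambda>(x, y). Complex x y) -` S \<inter> space (borel \<Otimes>\<^sub>M borel) \<in> sets (borel \<Otimes>\<^sub>M borel)"
      using S by measurable
    then show "(\<lambda>(x, y). Complex x y) -` S \<in> sets (lborel \<Otimes>\<^sub>M lborel)"
      by (simp add: space_pair_measure sets_pair_measure)
  qed
  also have "\<dots> = (\<integral>\<^sup>+x. ennreal (F x) \<partial>lborel)"
  proof (rule nn_integral_cong)
    fix x :: real
    have "Pair x -` ((\<lambda>(x, y). Complex x y) -` S) = {y. y^2 < g x}"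
      using mem by auto
    then show "emeasure lborel (Pair x -` ((\<lambda>(x, y). Complex x y) -` S)) = ennreal (F x)"
      by (simp add: emeasure_square_less F_def)
  qed
  also have "\<dots> = ennreal (e^2 * lens_area (d / e))"
  proof (rule nn_integral_has_integral_lborel)
    show "F \<in> borel_measurable borel"
      unfolding F_def g_def by measurable
    show "0 \<le> F x" for x by (simp add: F_def)
    have cont: "continuous_on A (\<lambda>x. e^2 * strip_area ((x - s) / e))" for A s
      by (intro continuous_intros continuous_on_compose2[OF continuous_on_strip_area[of UNIV]])
         (use \<open>0 < e\<close> in auto)
    have deriv: "((\<lambda>x. e^2 * strip_area ((x - s) / e)) has_vector_derivative F x) (at x)"
      if "\<bar>x - s\<bar> < e" "g x = e^2 - (x - s)^2" for s x
    proof -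
      have "\<bar>(x - s) / e\<bar> < 1" using that \<open>0 < e\<close> by simp
      then have "(strip_area has_real_derivative 2 * sqrt (1 - ((x - s) / e)^2)) (at ((x - s) / e))"
        by (rule DERIV_strip_area)
      moreover have "((\<lambda>x. (x - s) / e) has_real_derivative 1 / e) (at x)"
        using \<open>0 < e\<close> by (auto intro!: derivative_eq_intros)
      ultimately have "((\<lambda>x. strip_area ((x - s) / e)) has_real_derivative
          2 * sqrt (1 - ((x - s) / e)^2) * (1 / e)) (at x)"
        by (rule DERIV_chain2)
      then have *: "((\<lambda>x. e^2 * strip_area ((x - s) / e)) has_real_derivative
          e^2 * (2 * sqrt (1 - ((x - s) / e)^2) * (1 / e))) (at x)"
        by (rule DERIV_cmult)
      have "e^2 * (1 - ((x - s) / e)^2) = g x"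
        using \<open>0 < e\<close> by (simp add: that(2) power_divide field_simps)
      then have "sqrt (g x) = e * sqrt (1 - ((x - s) / e)^2)"
        using \<open>0 < e\<close> by (metis abs_of_pos real_sqrt_abs real_sqrt_mult)
      moreover have "(x - s)^2 < e^2"
        using that(1) power_strict_mono[of "\<bar>x - s\<bar>" e 2] by simp
      ultimately have "F x = e^2 * (2 * sqrt (1 - ((x - s) / e)^2) * (1 / e))"
        using \<open>0 < e\<close> that(2) by (simp add: F_def power2_eq_square)
      with * show ?thesis by (simp add: has_real_derivative_iff_has_vector_derivative)
    qed
    have sq: "x^2 \<le> (x - d)^2 \<longleftrightarrow> d * (2 * x) \<le> d * d" for x
      by (simp add: power2_eq_square algebra_simps)
    \<comment> \<open>Left of the midpoint the center \<open>d\<close> is the farther one, right of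
      it the center 0.\<close>
    have I1: "(F has_integral (e^2 * strip_area ((d/2 - d) / e) - e^2 * strip_area (((d - e) - d) / e))) {d - e..d/2}"
    proof (rule fundamental_theorem_of_calculus_interior[OF _ cont deriv])
      fix x assume x: "x \<in> {d - e<..<d/2}"
      then show "\<bar>x - d\<bar> < e" using assms by auto
      have "x^2 \<le> (x - d)^2" unfolding sq using x assms by (intro mult_left_mono) auto
      then show "g x = e^2 - (x - d)^2" by (simp add: g_def max_def)
    qed (use assms in auto)
    have I2: "(F has_integral (e^2 * strip_area ((e - 0) / e) - e^2 * strip_area ((d/2 - 0) / e))) {d/2..e}"
    proof (rule fundamental_theorem_of_calculus_interior[OF _ cont deriv])
      fix x assume x: "x \<in> {d/2<..<e}"
      then show "\<bar>x - 0\<bar> < e" using assms by auto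
      have "d * d \<le> d * (2 * x)" using x assms by (intro mult_left_mono) auto
      then have "(x - d)^2 \<le> x^2"
        by (simp add: power2_eq_square algebra_simps)
      then show "g x = e^2 - (x - 0)^2" by (simp add: g_def max_def)
    qed (use assms in auto)
    have val: "(e^2 * strip_area ((d/2 - d) / e) - e^2 * strip_area (((d - e) - d) / e))
      + (e^2 * strip_area ((e - 0) / e) - e^2 * strip_area ((d/2 - 0) / e)) = e^2 * lens_area (d / e)"
    proof -
      have "(d/2 - d) / e = - (d / e / 2)" "((d - e) - d) / e = - 1" "(e - 0) / e = 1"
        "(d/2 - 0) / e = d / e / 2"
        using \<open>0 < e\<close> by (auto simp: field_simps)
      then show ?thesis
        by (simp only: strip_area_minus) (simp add: strip_area_ge_1 lens_area_def algebra_simps)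
    qed
    have "(F has_integral (e^2 * lens_area (d / e))) {d - e..e}"
      unfolding val[symmetric] by (rule has_integral_combine[OF _ _ I1 I2]) (use assms in auto)
    \<comment> \<open>Outside the interval \<open>g\<close> is not positive, so the clipped
      integrand vanishes.\<close>
    then show "(F has_integral (e^2 * lens_area (d / e))) UNIV"
    proof (rule has_integral_on_superset)
      fix x assume "x \<notin> {d - e..e}"
      then have "e^2 \<le> x^2 \<or> e^2 \<le> (x - d)^2"
        using assms by (auto simp: not_le abs_le_square_iff[symmetric])
      then show "F x = 0" by (auto simp: F_def g_def max_def)
    qed simp
  qed
  finally show ?thesis
    using assms lens_area_bounds(1)[of "d / e"] by (simp add: S_def measure_def)
qed

lemma measure_lens:
  fixes a b :: complex
  assumes "0 < e"
  shows "measure lborel (ball a e \<inter> ball b e) = e^2 * lens_area (dist a b / e)"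
proof (cases "dist a b < 2 * e")
  case True
  have "dist a b = dist 0 (complex_of_real (dist a b))" by simp
  then have "measure lborel (ball a e \<inter> ball b e)
      = measure lborel (ball 0 e \<inter> ball (complex_of_real (dist a b)) e)"
    by (rule measure_lens_dist)
  also have "\<dots> = e^2 * lens_area (dist a b / e)"
    by (rule measure_lens_axis) (use assms True in auto)
  finally show ?thesis .
next
  case False
  have "ball a e \<inter> ball b e = {}"
  proof (intro equals0I)
    fix p assume "p \<in> ball a e \<inter> ball b e"
    then have "dist a p < e" "dist b p < e" by auto
    with False dist_triangle[of a b p] show False by (simp add: dist_commute)
  qed
  moreover have "dist a b / e \<ge> 2" using False assms by (simp add: field_simps)
  ultimately show ?thesis by simp
qed

section \<open>First moments of discs and lenses\<close>

lemma set_integrable_ident: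
  fixes S :: "complex set"
  assumes "S \<in> sets borel" "bounded S"
  shows "set_integrable lborel S (\<lambda>w. w)"
proof -
  obtain r where "\<forall>y\<in>S. dist 0 y \<le> r" using assms(2) unfolding bounded_any_center[of S 0] ..
  then have sub: "S \<subseteq> cball 0 r" by auto
  have int: "set_integrable lborel (cball 0 r) (\<lambda>w::complex. w)"
    unfolding set_integrable_def by (rule borel_integrable_compact) (auto intro: continuous_on_id)
  show ?thesis by (rule set_integrable_subset[OF int _ sub]) (use assms(1) in simp)
qed

text \<open>The reflection \<open>p \<mapsto> c - p\<close> preserves Lebesgue measure, so the
  integral \<open>I\<close> satisfies \<open>I = measure lborel S *\<^sub>R c - I\<close>.\<close>

lemma LINT_point_symmetric:
  fixes S :: "complex set"
  assumes "S \<in> sets borel" "bounded S" and sym: "\<And>p. c - p \<in> S \<longleftrightarrow> p \<in> S"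
  shows "(LINT w:S|lborel. w) = of_real (measure lborel S) * c / 2"
proof -
  have int: "integrable lborel (\<lambda>w. indicator S w *\<^sub>R w)"
    using set_integrable_ident[OF assms(1,2)] by (simp add: set_integrable_def)
  have int1: "integrable lborel (\<lambda>w. indicator S w *\<^sub>R c)"
    using assms(1) emeasure_bounded_finite[OF assms(2)]
    by (intro integrable_scaleR_left) simp
  have "lborel = distr lborel borel (\<lambda>x. c + (-1) *\<^sub>R x)"
    by (subst lborel_affine[of "-1" c]) (simp_all add: density_1)
  then have "(\<integral>w. indicator S w *\<^sub>R w \<partial>lborel) = (\<integral>w. indicator S w *\<^sub>R w \<partial>distr lborel borel (\<lambda>x. c + (-1) *\<^sub>R x))"
    by simp
  also have "\<dots> = (\<integral>w. indicator S (c + (-1) *\<^sub>R w) *\<^sub>R (c + (-1) *\<^sub>R w) \<partial>lborel)"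
    by (rule integral_distr) (use assms(1) in auto)
  also have "\<dots> = (\<integral>w. indicator S w *\<^sub>R c - indicator S w *\<^sub>R w \<partial>lborel)"
  proof (rule Bochner_Integration.integral_cong)
    fix w
    have "indicator S (c - w) = (indicator S w :: real)" using sym[of w] by (simp add: indicator_def)
    then show "indicator S (c + (-1) *\<^sub>R w) *\<^sub>R (c + (-1) *\<^sub>R w) = indicator S w *\<^sub>R c - indicator S w *\<^sub>R w"
      by (simp add: scaleR_diff_right)
  qed simp
  also have "\<dots> = (\<integral>w. indicator S w *\<^sub>R c \<partial>lborel) - (\<integral>w. indicator S w *\<^sub>R w \<partial>lborel)"
    by (rule Bochner_Integration.integral_diff[OF int1 int])
  also have "(\<integral>w. indicator S w *\<^sub>R c \<partial>lborel) = measure lborel S *\<^sub>R c"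
    using assms(1) emeasure_bounded_finite[OF assms(2)]
    by (subst integral_scaleR_left) auto
  finally show ?thesis
    by (simp add: set_lebesgue_integral_def scaleR_conv_of_real eq_diff_eq mult_2[symmetric] field_simps)
qed

text \<open>The reflection in the midpoint of the centers exchanges the two discs.\<close>

lemma LINT_lens:
  fixes a b :: complex
  assumes "0 < e"
  shows "(LINT w:ball a e \<inter> ball b e|lborel. w) = of_real (e^2 * lens_area (dist a b / e)) * ((a + b) / 2)"
proof -
  have "(LINT w:ball a e \<inter> ball b e|lborel. w) = of_real (measure lborel (ball a e \<inter> ball b e)) * (a + b) / 2"
  proof (rule LINT_point_symmetric)
    fix p
    have "a - (a + b - p) = - (b - p)" "b - (a + b - p) = - (a - p)" by (auto simp: algebra_simps)
    then show "a + b - p \<in> ball a e \<inter> ball b e \<longleftrightarrow> p \<in> ball a e \<inter> ball b e"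
      unfolding Int_iff mem_ball dist_norm by (metis norm_minus_cancel)
  qed (auto intro: bounded_Int)
  then show ?thesis using measure_lens[OF assms] by simp
qed

lemma LINT_ball:
  fixes a :: complex
  assumes "0 < e"
  shows "(LINT w:ball a e|lborel. w) = of_real (pi * e^2) * a"
  using LINT_lens[OF assms, of a a] by simp

section \<open>The union of the discs along an orbit\<close>

lemma LINT_Diff_ball:
  fixes a b :: complex
  assumes "0 < e"
  shows "(LINT w:ball b e - ball a e|lborel. w)
    = of_real (e^2) * (of_real pi * b - of_real (lens_area (dist a b / e)) * ((a + b) / 2))"
proof -
  have "(LINT w:(ball b e - ball a e) \<union> (ball a e \<inter> ball b e)|lborel. w)
    = (LINT w:ball b e - ball a e|lborel. w) + (LINT w:ball a e \<inter> ball b e|lborel. w)"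
    by (rule set_integral_Un)
       (auto intro!: set_integrable_ident intro: bounded_Int bounded_diff bounded_subset[OF bounded_ball])
  moreover have "(ball b e - ball a e) \<union> (ball a e \<inter> ball b e) = ball b e" by auto
  ultimately show ?thesis
    by (simp add: LINT_ball[OF assms] LINT_lens[OF assms] algebra_simps)
qed

text \<open>The formula is exact for every finite union, and the limit is continuity along an
  increasing sequence of sets. For a parabolic orbit both sums diverge logarithmically; only their
  difference converges.\<close>

lemma LINT_union_balls_tendsto:
  fixes z :: "nat \<Rightarrow> complex"
  assumes e: "0 < e" and bdd: "bounded (range z)"
    and triple: "\<And>m n. m < n \<Longrightarrow> ball (z m) e \<inter> ball (z (Suc n)) e \<subseteq> ball (z n) e"
  shows "(\<lambda>N. of_real pi * (\<Sum>n\<le>N. z n)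
      - (\<Sum>n<N. of_real (lens_area (dist (z n) (z (Suc n)) / e)) * ((z n + z (Suc n)) / 2)))
    \<longlonglongrightarrow> (LINT w:(\<Union>n. ball (z n) e)|lborel. w) / of_real (e^2)"
proof -
  define A where "A N = (\<Union>n\<le>N. ball (z n) e)" for N
  have "bounded (\<Union>n. ball (z n) e)"
  proof -
    obtain r where r: "\<And>n. norm (z n) \<le> r" using bdd by (auto simp: bounded_iff)
    have "(\<Union>n. ball (z n) e) \<subseteq> ball 0 (r + e)"
    proof clarify
      fix p n assume "p \<in> ball (z n) e"
      then show "p \<in> ball 0 (r + e)"
        using r[of n] norm_triangle_ineq2[of p "z n"] by (simp add: dist_norm norm_minus_commute)
    qed
    then show ?thesis using bounded_subset bounded_ball by blast
  qed
  then have int: "set_integrable lborel (\<Union>n. ball (z n) e) (\<lambda>w. w)"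
    by (intro set_integrable_ident) auto
  have UA: "(\<Union>N. A N) = (\<Union>n. ball (z n) e)" by (auto simp: A_def)
  have "(\<lambda>N. LINT w:A N|lborel. w) \<longlonglongrightarrow> (LINT w:(\<Union>N. A N)|lborel. w)"
  proof (rule set_integral_cont_up)
    show "A N \<in> sets lborel" for N by (auto simp: A_def)
    show "incseq A" by (force simp: A_def incseq_def)
    show "set_integrable lborel (\<Union> (range A)) (\<lambda>w. w)" using int UA by simp
  qed
  then have lim: "(\<lambda>N. (LINT w:A N|lborel. w) / of_real (e^2)) \<longlonglongrightarrow>
      (LINT w:(\<Union>n. ball (z n) e)|lborel. w) / of_real (e^2)"
    unfolding UA using e by (intro tendsto_intros) auto
  have "(LINT w:A N|lborel. w) = of_real (e^2) * (of_real pi * (\<Sum>n\<le>N. z n)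
      - (\<Sum>n<N. of_real (lens_area (dist (z n) (z (Suc n)) / e)) * ((z n + z (Suc n)) / 2)))" for N
  proof (induction N)
    case 0
    then show ?case by (simp add: A_def LINT_ball[OF e])
  next
    case (Suc N)
    \<comment> \<open>The hypothesis \<open>triple\<close> covers \<open>m < N\<close>; the
      remaining case \<open>m = N\<close> is trivial.\<close>
    have "ball (z (Suc N)) e \<inter> A N \<subseteq> ball (z N) e"
    proof clarify
      fix p assume p: "p \<in> ball (z (Suc N)) e" "p \<in> A N"
      then obtain m where m: "m \<le> N" "p \<in> ball (z m) e" by (auto simp: A_def)
      then show "p \<in> ball (z N) e"
        using triple[of m N] p by (cases "m = N") auto
    qed
    moreover have "ball (z N) e \<subseteq> A N" by (auto simp: A_def)
    ultimately have "A (Suc N) = A N \<union> (ball (z (Suc N)) e - ball (z N) e)"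
      "A N \<inter> (ball (z (Suc N)) e - ball (z N) e) = {}"
      by (auto simp: A_def atMost_Suc)
    moreover have "set_integrable lborel (A N) (\<lambda>w. w)"
      by (rule set_integrable_subset[OF int]) (auto simp: A_def)
    moreover have "set_integrable lborel (ball (z (Suc N)) e - ball (z N) e) (\<lambda>w. w)"
      by (rule set_integrable_subset[OF int]) auto
    ultimately have "(LINT w:A (Suc N)|lborel. w) = (LINT w:A N|lborel. w)
        + (LINT w:ball (z (Suc N)) e - ball (z N) e|lborel. w)"
      by (simp only: set_integral_Un)
    also have "\<dots> = of_real (e^2) * (of_real pi * (\<Sum>n\<le>Suc N. z n)
      - (\<Sum>n<Suc N. of_real (lens_area (dist (z n) (z (Suc n)) / e)) * ((z n + z (Suc n)) / 2)))"
      unfolding Suc.IH LINT_Diff_ball[OF e] by (simp add: algebra_simps)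
    finally show ?case .
  qed
  with lim show ?thesis using e by simp
qed

section \<open>The overlap of two discs inside a third\<close>

text \<open>If \<open>x\<close> lies on the segment from \<open>a\<close> to \<open>b\<close>, the
  vector \<open>l *\<^sub>R (x - a) + m *\<^sub>R (x - b)\<close> vanishes for suitable weights and
  the claim is Stewart's identity. In general the vector costs at most \<open>2 * \<rho>\<close>
  times its length, where \<open>\<rho>\<close> bounds the distance from \<open>x\<close> to a point
  of the overlap, and \<open>small\<close> lets \<open>l * (norm (x - a))^2\<close> pay for
  it.\<close>

lemma ball_Int_ball_subset:
  fixes a b x :: "'a::real_inner"
  assumes pos: "0 < l" "0 \<le> m" and rho: "norm (b - x) + e \<le> \<rho>"
    and small: "2 * \<rho> * norm (l *\<^sub>R (x - a) + m *\<^sub>R (x - b)) \<le> l * (norm (x - a))^2"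
  shows "ball a e \<inter> ball b e \<subseteq> ball x e"
proof clarify
  fix p assume "p \<in> ball a e" "p \<in> ball b e"
  then have pa: "norm (p - a) < e" and pb: "norm (p - b) < e"
    by (auto simp: dist_norm norm_minus_commute)
  define v where "v = l *\<^sub>R (x - a) + m *\<^sub>R (x - b)"
  have eq: "(norm (p - y))^2 = (norm (p - x))^2 + 2 * ((p - x) \<bullet> (x - y)) + (norm (x - y))^2" for y
    by (simp add: power2_norm_eq_inner algebra_simps inner_commute)
  have "norm (p - x) \<le> norm (p - b) + norm (b - x)"
    using norm_triangle_ineq[of "p - b" "b - x"] by simp
  then have "norm (p - x) \<le> \<rho>" using pb rho by simp
  have "(l + m) * (norm (p - x))^2 + (2 * ((p - x) \<bullet> v) + l * (norm (x - a))^2 + m * (norm (x - b))^2)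
    = l * (norm (p - a))^2 + m * (norm (p - b))^2"
    unfolding eq[of a] eq[of b] v_def by (simp add: algebra_simps inner_simps)
  also have "\<dots> < l * e^2 + m * e^2"
    using pos pa pb
    by (intro add_less_le_mono mult_strict_left_mono mult_left_mono power_strict_mono power_mono) auto
  also have "\<dots> = (l + m) * e^2" by (simp add: algebra_simps)
  finally have *: "(l + m) * (norm (p - x))^2 + (2 * ((p - x) \<bullet> v) + l * (norm (x - a))^2 + m * (norm (x - b))^2)
    < (l + m) * e^2" .
  have "- (2 * ((p - x) \<bullet> v)) \<le> 2 * (norm (p - x) * norm v)"
    using Cauchy_Schwarz_ineq2[of "p - x" v] by linarith
  also have "\<dots> \<le> 2 * (\<rho> * norm v)"
    using \<open>norm (p - x) \<le> \<rho>\<close> by (intro mult_left_mono mult_right_mono) auto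
  also have "\<dots> \<le> l * (norm (x - a))^2" using small by (simp add: v_def mult.assoc)
  finally have "0 \<le> 2 * ((p - x) \<bullet> v) + l * (norm (x - a))^2 + m * (norm (x - b))^2"
    using pos zero_le_power2[of "norm (x - b)"] by (simp add: add_increasing2)
  with * have "(l + m) * (norm (p - x))^2 < (l + m) * e^2" by linarith
  then have "(norm (p - x))^2 < e^2" using pos by simp
  moreover have "0 < e" using pa norm_ge_zero[of "p - a"] by linarith
  ultimately have "norm (p - x) < e" by (simp add: power2_less_imp_less)
  then show "p \<in> ball x e" by (simp add: dist_norm norm_minus_commute)
qed

text \<open>All that the area computation uses of an orbit, for either petal: in the coordinate
  \<open>w\<close> it is a translation by 1 with summable errors. The shift in
  \<open>real n + 1\<close> keeps the bound meaningful at \<open>n = 0\<close>.\<close>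

locale asymptotic_orbit =
  fixes z w :: "nat \<Rightarrow> complex" and c :: complex and C :: real
  assumes norm_c: "norm c = 1"
    and C_ge_1: "C \<ge> 1"
    and w_nonzero: "w n \<noteq> 0"
    and z_eq: "z n = c / w n"
    and inj_z: "inj z"
    and w_near: "norm (w n - of_nat n) \<le> C"
    and w_step: "norm (w (Suc n) - w n - 1) \<le> C / (real n + 1)^2"
begin

text \<open>The errors \<open>1 / (n + 1)^2\<close> are dominated by a telescoping sum. In contrast
  to \<open>w_near\<close>, the bound \<open>C * (n - m) / (m * n)\<close> gets small for large
  \<open>m\<close>, as the comparison of three discs requires.\<close>

lemma w_diff:
  assumes "1 \<le> m" "m \<le> n"
  shows "norm (w n - w m - of_nat (n - m)) \<le> C * (1 / real m - 1 / real n)"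
  using assms(2)
proof (induction n rule: dec_induct)
  case base
  then show ?case by simp
next
  case (step n)
  have "norm (w (Suc n) - w m - of_nat (Suc n - m))
    \<le> norm (w n - w m - of_nat (n - m)) + norm (w (Suc n) - w n - 1)"
    using step norm_triangle_ineq[of "w n - w m - of_nat (n - m)" "w (Suc n) - w n - 1"]
    by (simp add: Suc_diff_le algebra_simps)
  also have "\<dots> \<le> C * (1 / real m - 1 / real n) + C / (real n + 1)^2"
    using step.IH w_step[of n] by linarith
  also have "C / (real n + 1)^2 \<le> C * (1 / real n - 1 / real (Suc n))"
  proof -
    have "1 / (real n + 1)^2 \<le> 1 / (real n * (real n + 1))"
      using assms(1) step by (intro divide_left_mono) (auto simp: power2_eq_square)
    also have "\<dots> = 1 / real n - 1 / real (Suc n)"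
      using assms(1) step by (simp add: field_simps)
    finally show ?thesis using C_ge_1 mult_left_mono[of _ _ C] by fastforce
  qed
  finally show ?case by (simp add: algebra_simps)
qed

lemma w_bounds:
  assumes "real n \<ge> 2 * C"
  shows "real n / 2 \<le> Re (w n)" "norm (w n) \<le> 2 * real n" "\<bar>Im (w n)\<bar> \<le> C" "real n / 2 \<le> norm (w n)"
proof -
  have "\<bar>Re (w n - of_nat n)\<bar> \<le> C" "\<bar>Im (w n - of_nat n)\<bar> \<le> C"
    using w_near[of n] abs_Re_le_cmod[of "w n - of_nat n"] abs_Im_le_cmod[of "w n - of_nat n"] by linarith+
  then show *: "real n / 2 \<le> Re (w n)" "\<bar>Im (w n)\<bar> \<le> C" using assms by auto
  then show "real n / 2 \<le> norm (w n)" using complex_Re_le_cmod[of "w n"] by linarith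
  have "norm (w n) \<le> norm (of_nat n :: complex) + norm (w n - of_nat n)"
    using norm_triangle_ineq[of "of_nat n" "w n - of_nat n"] by simp
  then show "norm (w n) \<le> 2 * real n" using w_near[of n] assms C_ge_1 by simp
qed

lemma z_diff: "z m - z n = c * (w n - w m) / (w m * w n)"
  using w_nonzero by (simp add: z_eq field_simps)

lemma z_tendsto_0: "z \<longlonglongrightarrow> 0"
proof (rule Lim_null_comparison)
  show "(\<lambda>n. 2 / real n) \<longlonglongrightarrow> 0" by real_asymp
  have "eventually (\<lambda>n. real n \<ge> 2 * C) sequentially" by real_asymp
  then show "eventually (\<lambda>n. norm (z n) \<le> 2 / real n) sequentially"
    using eventually_gt_at_top[of 0]
  proof eventually_elim
    case (elim n)
    have "norm (z n) = 1 / norm (w n)" by (simp add: z_eq norm_divide norm_c)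
    also have "\<dots> \<le> 1 / (real n / 2)"
      using w_bounds(4)[OF elim(1)] elim(2) by (intro divide_left_mono) (auto simp: w_nonzero)
    finally show ?case by simp
  qed
qed


text \<open>Collects three errors in \<open>triple_Int_tail\<close>:
  \<open>8 * (3 * C + C^2)\<close> from the slopes of \<open>w m\<close> and
  \<open>w (Suc n)\<close>, and \<open>2 * C\<close> from each of the translation errors
  \<open>\<delta>\<close> and \<open>E\<close>.\<close>

definition triple_bound :: real where "triple_bound = 8 * (3 * C + C^2) + 4 * C"

lemma triple_bound_pos: "triple_bound > 0"
  using C_ge_1 by (simp add: triple_bound_def add_pos_pos)

text \<open>The vector left over by the weights and the quadratic gain both have order
  \<open>k / (M * N^2)\<close> with \<open>k = n - m\<close>. Large indices therefore do not decide
  between them; the bound on \<open>8 / n^2 + e\<close> does, with one threshold for all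
  \<open>m\<close> and \<open>n\<close>.\<close>

lemma triple_Int_tail:
  assumes m: "real m \<ge> 2 * C" and mn: "m < n" and e: "8 / (real n)^2 + e \<le> 1 / (128 * triple_bound)"
  shows "ball (z m) e \<inter> ball (z (Suc n)) e \<subseteq> ball (z n) e"
proof -
  define k where "k = real (n - m)"
  define M where "M = real m"
  define N where "N = real n"
  have k: "k \<ge> 1" "k = N - M" using mn by (auto simp: k_def M_def N_def)
  have M: "M \<ge> 2 * C" "M \<ge> 2" "N \<ge> 2 * C" "N \<ge> 2" "N > M"
    using m mn C_ge_1 by (auto simp: M_def N_def)
  define xa ya xb yb where "xa = Re (w m)" and "ya = Im (w m)" and "xb = Re (w (Suc n))" and "yb = Im (w (Suc n))"
  have Sn: "real (Suc n) \<ge> 2 * C" using M by (simp add: N_def)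
  have wa: "M / 2 \<le> xa" "norm (w m) \<le> 2 * M" "\<bar>ya\<bar> \<le> C"
    using w_bounds[OF m] by (auto simp: M_def xa_def ya_def)
  have wb: "(N + 1) / 2 \<le> xb" "norm (w (Suc n)) \<le> 2 * (N + 1)" "\<bar>yb\<bar> \<le> C" "(N + 1) / 2 \<le> norm (w (Suc n))"
    using w_bounds[OF Sn] by (auto simp: N_def xb_def yb_def add.commute)
  have wx: "N / 2 \<le> norm (w n)" "norm (w n) \<le> 2 * N"
    using w_bounds[of n] M by (auto simp: N_def)
  have xpos: "xa > 0" "xb > 0" using wa(1) wb(1) M by auto
  define \<delta> where "\<delta> = w (Suc n) - w n - 1"
  define E where "E = w n - w m - of_real k"
  have \<delta>: "norm \<delta> \<le> C / (N + 1)^2" using w_step[of n] by (simp add: \<delta>_def N_def)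
  have E: "norm E \<le> C * k / (M * N)"
  proof -
    have "norm E \<le> C * (1 / M - 1 / N)"
      using w_diff[of m n] mn M by (simp add: E_def k_def M_def N_def)
    also have "1 / M - 1 / N = k / (M * N)" using M by (simp add: k(2) field_simps)
    finally show ?thesis by simp
  qed
  have F: "norm (w (Suc n) - w m - of_real (k + 1)) \<le> C"
  proof -
    have "norm (w (Suc n) - w m - of_nat (Suc n - m)) \<le> C * (1 / M - 1 / (N + 1))"
      using w_diff[of m "Suc n"] mn M by (simp add: M_def N_def add.commute)
    also have "\<dots> \<le> C * 1"
    proof (rule mult_left_mono)
      have "1 / M \<le> 1" "0 \<le> 1 / (N + 1)" using M by auto
      then show "1 / M - 1 / (N + 1) \<le> 1" by linarith
    qed (use C_ge_1 in simp)
    also have "of_nat (Suc n - m) = complex_of_real (k + 1)" using mn by (simp add: k_def Suc_diff_le)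
    finally show ?thesis by simp
  qed
  txt \<open>
    Multiplying \<open>c / w\<close> by \<open>(norm w)^2 / Re w\<close> gives \<open>c\<close> times a number of real part 1, so that with these
    weights the two vectors from the middle center cancel to first order.
  \<close>
  define l where "l = (norm (w m))^2 / (xa * k)"
  define \<mu> where "\<mu> = (norm (w (Suc n)))^2 / xb"
  have lpos: "l > 0" "\<mu> \<ge> 0" using xpos k w_nonzero by (auto simp: l_def \<mu>_def)
  define ua where "ua = 1 - \<i> * of_real (ya / xa)"
  define ub where "ub = 1 - \<i> * of_real (yb / xb)"
  have cnj_a: "of_real ((norm (w m))^2) / (w m * of_real xa) = ua"
  proof -
    have "of_real ((norm (w m))^2) = w m * cnj (w m)" by (rule complex_norm_square)
    moreover have "cnj (w m) = of_real xa - \<i> * of_real ya"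
      by (simp add: complex_eq_iff xa_def ya_def)
    ultimately show ?thesis using w_nonzero[of m] xpos by (simp add: ua_def field_simps)
  qed
  have cnj_b: "of_real ((norm (w (Suc n)))^2) / (w (Suc n) * of_real xb) = ub"
  proof -
    have "of_real ((norm (w (Suc n)))^2) = w (Suc n) * cnj (w (Suc n))" by (rule complex_norm_square)
    moreover have "cnj (w (Suc n)) = of_real xb - \<i> * of_real yb"
      by (simp add: complex_eq_iff xb_def yb_def)
    ultimately show ?thesis using w_nonzero[of "Suc n"] xpos by (simp add: ub_def field_simps)
  qed
  \<comment> \<open>The divisor \<open>k\<close> in \<open>l\<close> removes the number of steps
    from \<open>m\<close> to \<open>n\<close>, so that this vector and the next one are
    \<open>c / w n\<close>, with opposite signs, times factors that agree up to errors of order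
    \<open>k / (M * N)\<close>.\<close>
  have la: "l *\<^sub>R (z n - z m) = - (c / w n) * (ua * (1 + E / of_real k))"
  proof -
    have "l *\<^sub>R (z n - z m) = (of_real ((norm (w m))^2) / (w m * of_real xa)) * (c * (w m - w n)) / (of_real k * w n)"
      using xpos k by (simp add: z_diff l_def scaleR_conv_of_real)
    also have "\<dots> = - (c / w n) * (ua * ((w n - w m) / of_real k))"
      unfolding cnj_a by (simp add: minus_divide_left[symmetric] algebra_simps diff_divide_distrib)
    also have "(w n - w m) / of_real k = 1 + E / of_real k"
      using k by (simp add: E_def field_simps)
    finally show ?thesis .
  qed
  have mb: "\<mu> *\<^sub>R (z n - z (Suc n)) = (c / w n) * (ub * (1 + \<delta>))"
  proof -
    have "\<mu> *\<^sub>R (z n - z (Suc n)) = (of_real ((norm (w (Suc n)))^2) / (w (Suc n) * of_real xb)) * (c * (w (Suc n) - w n)) / w n"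
      using xpos by (simp add: z_diff \<mu>_def scaleR_conv_of_real)
    then show ?thesis
      unfolding cnj_b by (simp add: \<delta>_def)
  qed
  have u_le: "norm ua \<le> 2" "norm ub \<le> 2"
  proof -
    have "\<bar>ya / xa\<bar> \<le> 1" using wa M xpos by simp
    moreover have "norm ua \<le> norm (1::complex) + norm (\<i> * of_real (ya / xa))"
      unfolding ua_def by (rule norm_triangle_ineq4)
    ultimately show "norm ua \<le> 2" by (simp only: norm_mult norm_of_real norm_ii norm_one)
    have "\<bar>yb / xb\<bar> \<le> 1" using wb M xpos by simp
    moreover have "norm ub \<le> norm (1::complex) + norm (\<i> * of_real (yb / xb))"
      unfolding ub_def by (rule norm_triangle_ineq4)
    ultimately show "norm ub \<le> 2" by (simp only: norm_mult norm_of_real norm_ii norm_one)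
  qed
  have MN: "M * N > 0" using M by simp
  \<comment> \<open>Bounding each slope by a multiple of \<open>1 / M\<close> would be too weak.
    After cross-multiplication, \<open>xb - xa\<close> is of order \<open>k\<close>, and
    \<open>yb - ya\<close> is at most \<open>C / M\<close>, which compensates the factor
    \<open>xa \<le> 2 * M\<close>.\<close>
  have uab: "norm (ub - ua) \<le> 8 * (3 * C + C^2) * k / (M * N)"
  proof -
    have "ub - ua = \<i> * of_real (ya / xa - yb / xb)" by (simp add: ua_def ub_def algebra_simps)
    then have "norm (ub - ua) = \<bar>ya / xa - yb / xb\<bar>" by (simp only: norm_mult norm_ii norm_of_real mult_1)
    also have "ya / xa - yb / xb = (ya * (xb - xa) - (yb - ya) * xa) / (xa * xb)"
      using xpos by (simp add: field_simps)
    also have "\<bar>\<dots>\<bar> = \<bar>ya * (xb - xa) - (yb - ya) * xa\<bar> / (xa * xb)"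
      using xpos by (simp add: abs_mult)
    also have "\<dots> \<le> (2 * (3 * C + C^2) * k) / (M * N / 4)"
    proof (rule frac_le)
      have Fb: "\<bar>xb - xa - (k + 1)\<bar> \<le> C"
        using order.trans[OF abs_Re_le_cmod F] by (simp add: xa_def xb_def)
      have "\<bar>yb - ya\<bar> \<le> C * (1 / M - 1 / (N + 1))"
      proof -
        have "norm (w (Suc n) - w m - of_nat (Suc n - m)) \<le> C * (1 / M - 1 / (N + 1))"
          using w_diff[of m "Suc n"] mn M by (simp add: M_def N_def add.commute)
        from order.trans[OF abs_Im_le_cmod this] show ?thesis by (simp add: ya_def yb_def)
      qed
      also have "\<dots> \<le> C * (1 / M)" using C_ge_1 M by (intro mult_left_mono) auto
      finally have "\<bar>yb - ya\<bar> * \<bar>xa\<bar> \<le> C * (1 / M) * (2 * M)"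
        using wa abs_Re_le_cmod[of "w m"] C_ge_1 M by (intro mult_mono) (auto simp: xa_def)
      also have "\<dots> = 2 * C" using M by simp
      finally have 1: "\<bar>(yb - ya) * xa\<bar> \<le> 2 * C" by (simp add: abs_mult)
      have "\<bar>xb - xa\<bar> \<le> (k + 1) + C" using Fb k by linarith
      then have "\<bar>ya\<bar> * \<bar>xb - xa\<bar> \<le> C * ((k + 1) + C)"
        using wa C_ge_1 by (intro mult_mono) auto
      then have 2: "\<bar>ya * (xb - xa)\<bar> \<le> C * ((k + 1) + C)" by (simp add: abs_mult)
      have "\<bar>ya * (xb - xa) - (yb - ya) * xa\<bar> \<le> C * ((k + 1) + C) + 2 * C"
        using 1 2 by linarith
      also have "\<dots> = C * k + 3 * C + C^2" by (simp add: power2_eq_square algebra_simps)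
      also have "\<dots> \<le> C * k + 3 * C * k + C^2 * k"
        using k C_ge_1 by (intro add_mono) (auto simp: mult_le_cancel_left1)
      also have "\<dots> \<le> 2 * (3 * C + C^2) * k"
      proof -
        have "0 \<le> (2 * C + C^2) * k" using k C_ge_1 by simp
        then show ?thesis by (simp add: algebra_simps)
      qed
      finally show "\<bar>ya * (xb - xa) - (yb - ya) * xa\<bar> \<le> 2 * (3 * C + C^2) * k" .
      have "M / 2 * (N / 2) \<le> xa * xb" using wa wb M xpos by (intro mult_mono) auto
      then show "M * N / 4 \<le> xa * xb" by simp
    qed (use MN k C_ge_1 in auto)
    finally show ?thesis by (simp add: field_simps)
  qed
  have sum: "norm (l *\<^sub>R (z n - z m) + \<mu> *\<^sub>R (z n - z (Suc n))) \<le> 2 / N * (triple_bound * k / (M * N))"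
  proof -
    have "l *\<^sub>R (z n - z m) + \<mu> *\<^sub>R (z n - z (Suc n)) = (c / w n) * ((ub - ua) + ub * \<delta> - ua * (E / of_real k))"
      unfolding la mb by (simp add: algebra_simps)
    then have "norm (l *\<^sub>R (z n - z m) + \<mu> *\<^sub>R (z n - z (Suc n)))
      = 1 / norm (w n) * norm ((ub - ua) + ub * \<delta> - ua * (E / of_real k))"
      by (simp only: norm_mult norm_divide norm_c)
    also have "\<dots> \<le> 1 / (N / 2) * (triple_bound * k / (M * N))"
    proof (rule mult_mono)
      show "1 / norm (w n) \<le> 1 / (N / 2)"
        using wx M by (intro divide_left_mono) (auto simp: w_nonzero)
      have nk: "norm (complex_of_real k) = k" using k(1) by simp
      have "norm ((ub - ua) + ub * \<delta> - ua * (E / of_real k)) \<le> norm (ub - ua) + norm ub * norm \<delta> + norm ua * (norm E / k)"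
        using norm_triangle_ineq4[of "(ub - ua) + ub * \<delta>" "ua * (E / of_real k)"]
          norm_triangle_ineq[of "ub - ua" "ub * \<delta>"]
        unfolding norm_mult norm_divide nk by linarith
      also have "norm ub * norm \<delta> \<le> 2 * C * k / (M * N)"
      proof -
        have "norm \<delta> \<le> C / (M * N)"
        proof (rule order.trans[OF \<delta>])
          have "M * N \<le> (N + 1) * (N + 1)" using M by (intro mult_mono) auto
          then show "C / (N + 1)^2 \<le> C / (M * N)"
            using C_ge_1 MN M by (intro divide_left_mono) (auto simp: power2_eq_square)
        qed
        also have "\<dots> \<le> C * k / (M * N)"
          using C_ge_1 MN k by (intro divide_right_mono) (auto simp: mult_le_cancel_left1)
        finally have "norm ub * norm \<delta> \<le> 2 * (C * k / (M * N))"
          using u_le by (intro mult_mono) auto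
        then show ?thesis by simp
      qed
      also have "norm ua * (norm E / k) \<le> 2 * C * k / (M * N)"
      proof -
        have "norm E / k \<le> C * k / (M * N) / k" using E k by (intro divide_right_mono) auto
        also have "\<dots> = C / (M * N)" using k by simp
        also have "\<dots> \<le> C * k / (M * N)"
          using C_ge_1 MN k by (intro divide_right_mono) (auto simp: mult_le_cancel_left1)
        finally have "norm ua * (norm E / k) \<le> 2 * (C * k / (M * N))"
          using u_le k by (intro mult_mono) auto
        then show ?thesis by simp
      qed
      finally have "norm ((ub - ua) + ub * \<delta> - ua * (E / of_real k))
        \<le> 8 * (3 * C + C^2) * k / (M * N) + 2 * C * k / (M * N) + 2 * C * k / (M * N)"
        using uab by linarith
      also have "\<dots> = triple_bound * k / (M * N)" by (simp add: triple_bound_def add_divide_distrib algebra_simps)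
      finally show "norm ((ub - ua) + ub * \<delta> - ua * (E / of_real k)) \<le> triple_bound * k / (M * N)" .
    qed (use M in auto)
    finally show ?thesis by simp
  qed
  have lower: "k / (32 * M * N^2) \<le> l * (norm (z n - z m))^2"
  proof -
    have "norm (z n - z m) = norm (w n - w m) / (norm (w n) * norm (w m))"
      by (simp only: z_diff norm_mult norm_divide norm_c mult_1 norm_minus_commute)
    then have "l * (norm (z n - z m))^2 = (norm (w n - w m))^2 / (xa * k * (norm (w n))^2)"
      using w_nonzero[of m] w_nonzero[of n] xpos k(1)
      by (simp add: l_def power_mult_distrib power_divide)
    also have "\<dots> \<ge> (k / 2)^2 / ((2 * M) * k * (2 * N)^2)"
    proof (rule frac_le)
      have "norm E \<le> k / 2"
      proof (rule order.trans[OF E])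
        have "2 * C \<le> M * N" using M C_ge_1 mult_mono[of "2 * C" M 1 N] by simp
        then show "C * k / (M * N) \<le> k / 2"
          using MN k by (simp add: field_simps)
      qed
      moreover have "k \<le> norm (w n - w m) + norm E"
      proof -
        have "k = norm (complex_of_real k)" using k(1) by simp
        also have "complex_of_real k = (w n - w m) - E" by (simp add: E_def)
        finally show ?thesis using norm_triangle_ineq4[of "w n - w m" E] by linarith
      qed
      ultimately have "k / 2 \<le> norm (w n - w m)" by linarith
      then show "(k / 2)^2 \<le> (norm (w n - w m))^2" using k by (intro power_mono) auto
      have "xa \<le> 2 * M" using wa complex_Re_le_cmod[of "w m"] by (simp add: xa_def)
      then show "xa * k * (norm (w n))^2 \<le> (2 * M) * k * (2 * N)^2"
        using wx k xpos by (intro mult_mono power_mono) auto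
    qed (use xpos k w_nonzero in auto)
    also have "(k / 2)^2 / ((2 * M) * k * (2 * N)^2) = k / (32 * M * N^2)"
      using k M by (simp add: power2_eq_square field_simps)
    finally show ?thesis .
  qed
  \<comment> \<open>\<open>2 * \<rho> * 2 * triple_bound = 1 / 32\<close>, the constant in
    \<open>lower\<close>.\<close>
  define \<rho> where "\<rho> = 1 / (128 * triple_bound)"
  show ?thesis
  proof (rule ball_Int_ball_subset[OF lpos])
    have "norm (z (Suc n) - z n) = norm (w (Suc n) - w n) / (norm (w n) * norm (w (Suc n)))"
      by (simp add: z_diff norm_mult norm_divide norm_c norm_minus_commute mult.commute)
    also have "\<dots> \<le> 2 / (N / 2 * (N / 2))"
    proof (rule frac_le)
      have "norm (w (Suc n) - w n) \<le> 1 + norm \<delta>"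
        using norm_triangle_ineq[of 1 \<delta>] by (simp add: \<delta>_def)
      also have "norm \<delta> \<le> 1"
      proof (rule order.trans[OF \<delta>])
        have "C * 1 \<le> (N + 1) * (N + 1)" using M C_ge_1 by (intro mult_mono) auto
        then show "C / (N + 1)^2 \<le> 1" using M by (simp add: power2_eq_square)
      qed
      finally show "norm (w (Suc n) - w n) \<le> 2" by simp
      show "N / 2 * (N / 2) \<le> norm (w n) * norm (w (Suc n))"
        using wx wb M by (intro mult_mono) auto
    qed (use M in auto)
    also have "\<dots> = 8 / N^2" by (simp add: power2_eq_square)
    finally show "norm (z (Suc n) - z n) + e \<le> \<rho>" using e by (simp add: N_def \<rho>_def)
    have "2 * \<rho> * norm (l *\<^sub>R (z n - z m) + \<mu> *\<^sub>R (z n - z (Suc n))) \<le> 2 * \<rho> * (2 / N * (triple_bound * k / (M * N)))"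
      using sum triple_bound_pos by (intro mult_left_mono) (auto simp: \<rho>_def)
    also have "\<dots> = k / (32 * M * N^2)"
      using triple_bound_pos by (simp add: \<rho>_def power2_eq_square field_simps)
    finally show "2 * \<rho> * norm (l *\<^sub>R (z n - z m) + \<mu> *\<^sub>R (z n - z (Suc n))) \<le> l * (norm (z n - z m))^2"
      using lower by linarith
  qed
qed

text \<open>The orbit is injective and accumulates only at 0, which is none of its points. This
  serves the finitely many \<open>m\<close> that the tail estimate does not reach.\<close>

lemma isolated_point:
  "\<exists>e>0. \<forall>n. n \<noteq> m \<longrightarrow> e \<le> dist (z m) (z n)"
proof -
  have zm: "z m \<noteq> 0" using w_nonzero norm_c by (auto simp: z_eq)
  obtain n0 where n0: "\<And>n. n \<ge> n0 \<Longrightarrow> norm (z n) < norm (z m) / 2"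
    using LIMSEQ_D[OF z_tendsto_0, of "norm (z m) / 2"] zm by auto
  define F where "F = insert (norm (z m) / 2) ((\<lambda>n. dist (z m) (z n)) ` ({..<n0} - {m}))"
  have F: "finite F" "F \<noteq> {}" by (auto simp: F_def)
  have "Min F > 0"
    using F zm inj_z by (subst Min_gr_iff) (auto simp: F_def inj_eq)
  moreover have "Min F \<le> dist (z m) (z n)" if "n \<noteq> m" for n
  proof (cases "n < n0")
    case True
    then show ?thesis using F that by (intro Min_le) (auto simp: F_def)
  next
    case False
    have "Min F \<le> norm (z m) / 2" using F by (intro Min_le) (auto simp: F_def)
    also have "\<dots> \<le> dist (z m) (z n)"
      using n0[of n] False norm_triangle_ineq2[of "z m" "z n"] by (simp add: dist_norm)
    finally show ?thesis .
  qed
  ultimately show ?thesis by blast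
qed

text \<open>For the first indices \<open>m\<close> the disc around \<open>z m\<close> is disjoint
  from the later ones once \<open>e\<close> is small. For the others the allowance
  \<open>1 / (128 * triple_bound)\<close> is shared equally between \<open>8 / n^2\<close> and
  \<open>e\<close>.\<close>

lemma triple_Int:
  "eventually (\<lambda>e. \<forall>m n. m < n \<longrightarrow> ball (z m) e \<inter> ball (z (Suc n)) e \<subseteq> ball (z n) e) (at_right 0)"
proof -
  have "eventually (\<lambda>M. 2 * C \<le> real M) sequentially" by real_asymp
  moreover have "eventually (\<lambda>M. 8 / (real M)^2 \<le> 1 / (256 * triple_bound)) sequentially"
  proof -
    have "(\<lambda>M. 8 / (real M)^2) \<longlonglongrightarrow> 0" by real_asymp
    then have "eventually (\<lambda>M. 8 / (real M)^2 < 1 / (256 * triple_bound)) sequentially"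
      using triple_bound_pos by (intro order_tendstoD(2)) auto
    then show ?thesis by eventually_elim simp
  qed
  ultimately have "eventually (\<lambda>M. 2 * C \<le> real M \<and> 8 / (real M)^2 \<le> 1 / (256 * triple_bound)) sequentially"
    by eventually_elim simp
  then obtain M where M: "2 * C \<le> real M" "8 / (real M)^2 \<le> 1 / (256 * triple_bound)"
    by (auto simp: eventually_sequentially)
  have "\<forall>m. \<exists>e>0. \<forall>n. n \<noteq> m \<longrightarrow> e \<le> dist (z m) (z n)" using isolated_point by blast
  then obtain d where d: "\<And>m. d m > 0" "\<And>m n. n \<noteq> m \<Longrightarrow> d m \<le> dist (z m) (z n)" by metis
  have "eventually (\<lambda>e. \<forall>m\<in>{..<M}. 2 * e < d m) (at_right 0)"
  proof (intro eventually_ball_finite ballI)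
    fix m
    show "eventually (\<lambda>e. 2 * e < d m) (at_right 0)"
      using d(1)[of m] by (auto simp: eventually_at_right_field intro!: exI[of _ "d m / 2"])
  qed simp
  moreover have "eventually (\<lambda>e. e < 1 / (256 * triple_bound)) (at_right 0)"
    using triple_bound_pos by (auto simp: eventually_at_right_field intro!: exI[of _ "1 / (256 * triple_bound)"])
  ultimately show ?thesis
  proof eventually_elim
    case (elim e)
    show ?case
    proof (intro allI impI)
      fix m n :: nat assume mn: "m < n"
      show "ball (z m) e \<inter> ball (z (Suc n)) e \<subseteq> ball (z n) e"
      proof (cases "m < M")
        case True
        then have *: "2 * e < dist (z m) (z (Suc n))" using elim(1) d(2)[of "Suc n" m] mn by force
        have "ball (z m) e \<inter> ball (z (Suc n)) e = {}"
        proof (intro equals0I)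
          fix p assume "p \<in> ball (z m) e \<inter> ball (z (Suc n)) e"
          then have "dist (z m) p < e" "dist (z (Suc n)) p < e" by auto
          with * dist_triangle[of "z m" "z (Suc n)" p] show False by (simp add: dist_commute)
        qed
        then show ?thesis by simp
      next
        case False
        then have Mn: "M \<le> m" "M \<le> n" "M > 0" using mn M C_ge_1 by (auto intro: gr0I)
        show ?thesis
        proof (rule triple_Int_tail[OF _ mn])
          show "2 * C \<le> real m" using M Mn by linarith
          have "8 / (real n)^2 \<le> 8 / (real M)^2"
            using Mn by (intro divide_left_mono power_mono) auto
          then show "8 / (real n)^2 + e \<le> 1 / (128 * triple_bound)"
            using M(2) elim(2) by (simp add: field_simps)
        qed
      qed
    qed
  qed
qed

end

section \<open>Comparison of the lens sum with an integral\<close>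

text \<open>\<open>2 / N - 2 / (N + 1)\<close> dominates \<open>1 / N^2\<close>, so the induction
  carries the sharper bound \<open>2 / p - 2 / N\<close>.\<close>

lemma sum_inverse_squares_tail:
  assumes "p \<ge> 1"
  shows "(\<Sum>n\<in>{n1..<N}. if n < p then 0 else 1 / (real n)^2) \<le> 2 / real p"
proof -
  have "(\<Sum>n<N. if n < p then 0 else 1 / (real n)^2) \<le> (if N < p then 0 else 2 / real p - 2 / real N)"
  proof (induction N)
    case (Suc N)
    show ?case
    proof (cases "N < p")
      case True
      then have "real (Suc N) = real p \<or> Suc N < p" by auto
      then show ?thesis using Suc True by auto
    next
      case False
      then have N: "real N \<ge> 1" using assms by simp
      have "1 / (real N)^2 = 2 / (real N * (2 * real N))"
        by (simp add: power2_eq_square)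
      also have "\<dots> \<le> 2 / (real N * (real N + 1))"
        using N by (intro divide_left_mono mult_left_mono) auto
      also have "\<dots> = 2 / real N - 2 / (real N + 1)" using N by (simp add: field_simps)
      finally show ?thesis using Suc False by (simp add: add.commute)
    qed
  qed simp
  also have "\<dots> \<le> 2 / real p" by simp
  finally have "(\<Sum>n<N. if n < p then 0 else 1 / (real n)^2) \<le> 2 / real p" .
  moreover have "(\<Sum>n\<in>{n1..<N}. if n < p then 0 else 1 / (real n)^2)
      \<le> (\<Sum>n<N. if n < p then 0 else 1 / (real n)^2)"
    by (rule sum_mono2) auto
  ultimately show ?thesis by linarith
qed

context asymptotic_orbit
begin

text \<open>The point \<open>t\<close> is arbitrary between \<open>n\<close> and
  \<open>n + 1\<close> because the mean value theorem will choose it; \<open>w n\<close> and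
  \<open>w (Suc n)\<close> are both within \<open>C + 1\<close> of it.\<close>

lemma inverse_w_near:
  assumes n: "real n \<ge> 2 * C" and j: "j = n \<or> j = Suc n" and t: "real n \<le> t" "t \<le> real n + 1"
  shows "norm (1 / w j - 1 / of_real t) \<le> 2 * (C + 1) / (real n)^2"
proof -
  have n0: "real n > 0" using n C_ge_1 by linarith
  have w: "norm (w j) \<ge> real n / 2" using w_bounds(4)[of j] j n by auto
  have "norm (of_real t - w j) \<le> norm (w j - of_nat j) + norm (of_real t - of_nat j :: complex)"
    using norm_triangle_ineq4[of "of_real t - of_nat j" "w j - of_nat j"] by (simp add: algebra_simps)
  also have "norm (of_real t - of_nat j :: complex) = \<bar>t - real j\<bar>"
    by (metis norm_of_real of_real_diff of_real_of_nat_eq)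
  finally have diff: "norm (of_real t - w j) \<le> C + 1" using w_near[of j] j t by auto
  have "1 / w j - 1 / of_real t = (of_real t - w j) / (w j * of_real t)"
    using w_nonzero[of j] t n0 by (simp add: field_simps)
  then have "norm (1 / w j - 1 / of_real t) = norm (of_real t - w j) / (norm (w j) * t)"
    using t n0 by (simp add: norm_divide norm_mult)
  also have "\<dots> \<le> (C + 1) / (real n / 2 * real n)"
    using diff w t n0 C_ge_1 by (intro frac_le mult_mono) auto
  finally show ?thesis by (simp add: power2_eq_square mult.commute)
qed

definition mid :: "nat \<Rightarrow> complex" where "mid n = (z n + z (Suc n)) / 2"

lemma mid_near:
  assumes n: "real n \<ge> 2 * C" and t: "real n \<le> t" "t \<le> real n + 1"
  shows "norm (mid n - c / of_real t) \<le> 2 * (C + 1) / (real n)^2"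
proof -
  have "mid n - c / of_real t = c * ((1 / w n - 1 / of_real t) + (1 / w (Suc n) - 1 / of_real t)) / 2"
    by (simp add: mid_def z_eq algebra_simps add_divide_distrib diff_divide_distrib)
  then have "norm (mid n - c / of_real t) = norm ((1 / w n - 1 / of_real t) + (1 / w (Suc n) - 1 / of_real t)) / 2"
    by (simp only: norm_divide norm_mult norm_c mult_1 norm_numeral)
  also have "\<dots> \<le> (2 * (C + 1) / (real n)^2 + 2 * (C + 1) / (real n)^2) / 2"
    by (intro divide_right_mono order.trans[OF norm_triangle_ineq] add_mono inverse_w_near[OF n _ t]) auto
  also have "\<dots> = 2 * (C + 1) / (real n)^2" by (simp only: field_sum_of_halves add_divide_distrib)
  finally show ?thesis .
qed

text \<open>The gap is the modulus of \<open>(1 + \<delta>) / (w n * w (Suc n))\<close>. Exchanging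
  the two denominators for \<open>t\<close> one after the other and dropping \<open>\<delta>\<close>
  gives three errors of order \<open>1 / n^3\<close>.\<close>

lemma dist_near:
  assumes n: "real n \<ge> 2 * C" and t: "real n \<le> t" "t \<le> real n + 1"
  shows "\<bar>dist (z n) (z (Suc n)) - 1 / t^2\<bar> \<le> 10 * (C + 1) / (real n)^3"
proof -
  define N where "N = real n"
  have n0: "N > 0" using n C_ge_1 by (simp add: N_def)
  define \<delta> where "\<delta> = w (Suc n) - w n - 1"
  have w: "norm (w n) \<ge> N / 2" "norm (w (Suc n)) \<ge> N / 2"
    using w_bounds(4)[of n] w_bounds(4)[of "Suc n"] n by (auto simp: N_def)
  have "dist (z n) (z (Suc n)) = norm ((1 + \<delta>) / (w n * w (Suc n)))"
    unfolding dist_norm norm_minus_commute[of "z n"] z_diff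
    by (simp add: \<delta>_def norm_mult norm_divide norm_c norm_minus_commute mult.commute)
  moreover have "1 / t^2 = norm (1 / (of_real t)^2 :: complex)" using t n0 by (simp add: norm_divide norm_power)
  ultimately have "\<bar>dist (z n) (z (Suc n)) - 1 / t^2\<bar> \<le> norm ((1 + \<delta>) / (w n * w (Suc n)) - 1 / (of_real t)^2)"
    using norm_triangle_ineq3[of "(1 + \<delta>) / (w n * w (Suc n))" "1 / (of_real t)^2 :: complex"] by simp
  also have "(1 + \<delta>) / (w n * w (Suc n)) - 1 / (of_real t)^2
    = (1 / w n - 1 / of_real t) / w (Suc n) + (1 / w (Suc n) - 1 / of_real t) / of_real t + \<delta> / (w n * w (Suc n))"
    using w_nonzero t n0 by (simp add: N_def field_simps power2_eq_square)
  also have "norm \<dots> \<le> norm (1 / w n - 1 / of_real t) / norm (w (Suc n))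
      + norm (1 / w (Suc n) - 1 / of_real t) / t + norm \<delta> / (norm (w n) * norm (w (Suc n)))"
    (is "norm (?x + ?y + ?z) \<le> _")
  proof -
    have "norm (?x + ?y + ?z) \<le> norm ?x + norm ?y + norm ?z"
      using norm_triangle_ineq[of "?x + ?y" ?z] norm_triangle_ineq[of ?x ?y] by linarith
    then show ?thesis using t n0 by (simp add: norm_divide norm_mult N_def)
  qed
  \<comment> \<open>In the last term \<open>norm (w (Suc n))\<close> is bounded below by
    \<open>1 / 2\<close> only, since \<open>\<delta>\<close> is already of order
    \<open>1 / N^2\<close>.\<close>
  also have "\<dots> \<le> (2 * (C + 1) / N^2) / (N / 2) + (2 * (C + 1) / N^2) / N + (C / N^2) / (N / 2 * (1 / 2))"
  proof (intro add_mono frac_le)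
    show "norm (1 / w n - 1 / of_real t) \<le> 2 * (C + 1) / N^2" "norm (1 / w (Suc n) - 1 / of_real t) \<le> 2 * (C + 1) / N^2"
      unfolding N_def by (rule inverse_w_near[OF n _ t]; simp)+
    have "norm \<delta> \<le> C / (N + 1)^2" using w_step[of n] by (simp add: \<delta>_def N_def)
    also have "\<dots> \<le> C / N^2" using n0 C_ge_1 by (intro divide_left_mono power_mono) auto
    finally show "norm \<delta> \<le> C / N^2" .
    have "1 / 2 \<le> N / 2" using n C_ge_1 by (simp add: N_def)
    then have "1 / 2 \<le> norm (w (Suc n))" using w by linarith
    then show "N / 2 * (1 / 2) \<le> norm (w n) * norm (w (Suc n))"
      using w n0 by (intro mult_mono) auto
  qed (use t n0 w C_ge_1 in \<open>auto simp: N_def\<close>)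
  also have "\<dots> = (4 * (C + 1) + 2 * (C + 1) + 4 * C) / N^3"
    using n0 by (simp add: field_simps eval_nat_numeral)
  also have "\<dots> \<le> 10 * (C + 1) / N^3"
    using n0 by (intro divide_right_mono) auto
  finally show ?thesis by (simp add: N_def)
qed

text \<open>The threshold makes the cubic error of \<open>dist_near\<close> at most half of the main
  term \<open>1 / n^2\<close>.\<close>

lemma dist_ge:
  assumes "real n \<ge> 20 * (C + 1)"
  shows "dist (z n) (z (Suc n)) \<ge> 1 / (2 * (real n)^2)"
proof -
  have n: "real n \<ge> 2 * C" "real n > 0" using assms C_ge_1 by auto
  have "10 * (C + 1) / (real n)^3 \<le> (real n / 2) / (real n)^3"
    using assms n by (intro divide_right_mono) auto
  also have "\<dots> = 1 / (2 * (real n)^2)" using n by (simp add: power2_eq_square power3_eq_cube)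
  finally have "10 * (C + 1) / (real n)^3 \<le> 1 / (2 * (real n)^2)" .
  moreover have "1 / (real n)^2 = 1 / (2 * (real n)^2) + 1 / (2 * (real n)^2)" by simp
  ultimately show ?thesis using dist_near[OF n(1), of "real n"] by linarith
qed

text \<open>
  By the mean value theorem, the increment of \<open>lens_prim\<close> is the lens term of the index \<open>t\<close>
  between \<open>n\<close> and \<open>n + 1\<close>, for the orbit \<open>c / t\<close>.
\<close>

lemma lens_term_near:
  assumes n: "real n \<ge> 20 * (C + 1)" and e: "e > 0"
  shows "norm (of_real (lens_area (dist (z n) (z (Suc n)) / e)) * mid n
      - c * of_real (lens_prim (real (Suc n) * sqrt e) - lens_prim (real n * sqrt e)))
    \<le> (if 16 * (real n)^2 * e < 1 then 0 else 400 * (C + 1) / (real n)^2)"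
proof (cases "16 * (real n)^2 * e < 1")
  case True
  have n1: "real n \<ge> 1" using n C_ge_1 by auto
  \<comment> \<open>The factor 16 is generous: it makes the true lens empty despite the lower bound
    \<open>1 / (2 * n^2)\<close> for the gap, and \<open>lens_prim\<close> vanish even at
    \<open>Suc n\<close>, which is at most \<open>2 * n\<close>.\<close>
  have "2 \<le> 1 / (2 * (real n)^2) / e"
    using True e n1 by (simp add: field_simps)
  also have "\<dots> \<le> dist (z n) (z (Suc n)) / e"
    using dist_ge[OF n] e by (intro divide_right_mono) auto
  finally have "lens_area (dist (z n) (z (Suc n)) / e) = 0" by simp
  moreover have "lens_prim (real j * sqrt e) = 0" if j: "j = n \<or> j = Suc n" for j
  proof (rule lens_prim_eq_0)
    show "0 < real j * sqrt e" using j n1 e by auto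
    have "(real j)^2 \<le> (2 * real n)^2" using j n1 by (intro power_mono) auto
    then have "2 * ((real j)^2 * e) \<le> 2 * ((2 * real n)^2 * e)" using e by (intro mult_left_mono mult_right_mono) auto
    also have "\<dots> = (16 * (real n)^2 * e) / 2" by (simp add: power_mult_distrib)
    also have "\<dots> \<le> 1" using True by linarith
    finally show "2 * (real j * sqrt e)^2 \<le> 1"
      using e by (simp add: power_mult_distrib)
  qed
  from this[of n] this[of "Suc n"] have "lens_prim (real n * sqrt e) = 0" "lens_prim (real (Suc n) * sqrt e) = 0"
    by blast+
  ultimately show ?thesis using True by (simp del: of_nat_Suc)
next
  case False
  define N where "N = real n"
  have n1: "N \<ge> 1" "N \<ge> 2 * C" using n C_ge_1 by (auto simp: N_def)
  have "\<exists>y. N * sqrt e < y \<and> y < (N + 1) * sqrt e \<and> lens_prim ((N + 1) * sqrt e) - lens_prim (N * sqrt e)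
      = ((N + 1) * sqrt e - N * sqrt e) * (lens_area (1 / y^2) / y)"
  proof (rule MVT2)
    show "N * sqrt e < (N + 1) * sqrt e" using e by simp
    fix y assume "N * sqrt e \<le> y"
    moreover have "N * sqrt e > 0" using n1 e by simp
    ultimately show "DERIV lens_prim y :> lens_area (1 / y^2) / y" by (intro DERIV_lens_prim) linarith
  qed
  then obtain y where y: "N * sqrt e < y" "y < (N + 1) * sqrt e"
    "lens_prim ((N + 1) * sqrt e) - lens_prim (N * sqrt e) = sqrt e * (lens_area (1 / y^2) / y)"
    by (auto simp: algebra_simps)
  define t where "t = y / sqrt e"
  have t: "N \<le> t" "t \<le> N + 1" using y e by (auto simp: t_def field_simps)
  have yt: "y = t * sqrt e" using e by (simp add: t_def)
  have "1 / y^2 = 1 / t^2 / e" using e by (simp add: yt power_mult_distrib)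
  then have incr: "lens_prim ((N + 1) * sqrt e) - lens_prim (N * sqrt e) = lens_area (1 / t^2 / e) / t"
    unfolding y(3) using e t n1 by (simp add: yt)
  define d where "d = dist (z n) (z (Suc n))"
  have "of_real (lens_area (d / e)) * mid n - c * of_real (lens_area (1 / t^2 / e) / t)
    = of_real (lens_area (d / e)) * (mid n - c / of_real t)
      + c * of_real ((lens_area (d / e) - lens_area (1 / t^2 / e)) / t)"
    by (simp add: algebra_simps diff_divide_distrib)
  also have "norm \<dots> \<le> \<bar>lens_area (d / e)\<bar> * norm (mid n - c / of_real t)
      + \<bar>lens_area (d / e) - lens_area (1 / t^2 / e)\<bar> / t"
    using t n1 by (intro order.trans[OF norm_triangle_ineq])
      (simp add: norm_mult norm_c abs_divide norm_divide del: of_real_diff of_real_divide)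
  also have "\<dots> \<le> 4 * (2 * (C + 1) / N^2) + 2 * (160 * (C + 1) / N) / N"
  proof (intro add_mono mult_mono frac_le)
    have "0 \<le> d / e" using e by (simp add: d_def)
    then show "\<bar>lens_area (d / e)\<bar> \<le> 4"
      using lens_area_bounds[of "d / e"] pi_less_4 by linarith
    show "norm (mid n - c / of_real t) \<le> 2 * (C + 1) / N^2"
      using mid_near[of n t] t n1 by (simp add: N_def)
    \<comment> \<open>The rescaling costs a factor \<open>1 / e\<close>, which in this case is at
      most \<open>16 * N^2\<close>, so the cubic error of the gap still leaves
      \<open>1 / N\<close>.\<close>
    have "\<bar>lens_area (d / e) - lens_area (1 / t^2 / e)\<bar> \<le> 2 * \<bar>d / e - 1 / t^2 / e\<bar>"
      by (rule lens_area_Lipschitz)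
    also have "d / e - 1 / t^2 / e = (d - 1 / t^2) * (1 / e)"
      by (simp add: diff_divide_distrib)
    also have "\<bar>(d - 1 / t^2) * (1 / e)\<bar> = \<bar>d - 1 / t^2\<bar> * (1 / e)"
      using e by (simp only: abs_mult abs_of_pos zero_less_divide_1_iff)
    also have "\<dots> \<le> (10 * (C + 1) / N^3) * (16 * N^2)"
    proof (rule mult_mono)
      show "\<bar>d - 1 / t^2\<bar> \<le> 10 * (C + 1) / N^3"
        using dist_near[of n t] t n1 by (simp add: N_def d_def)
      show "1 / e \<le> 16 * N^2" using False e by (simp add: N_def field_simps)
    qed (use C_ge_1 n1 e in auto)
    also have "\<dots> = 160 * (C + 1) / N" using n1 by (simp add: field_simps eval_nat_numeral)
    finally show "\<bar>lens_area (d / e) - lens_area (1 / t^2 / e)\<bar> \<le> 2 * (160 * (C + 1) / N)" by simp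
  qed (use n1 t C_ge_1 in auto)
  also have "\<dots> = 328 * (C + 1) / N^2"
    by (simp add: power2_eq_square add_divide_distrib[symmetric])
  also have "\<dots> \<le> 400 * (C + 1) / N^2" using C_ge_1 by (intro divide_right_mono mult_right_mono) auto
  finally show ?thesis
    using False incr by (simp add: N_def d_def add.commute)
qed

text \<open>Write \<open>pi * ln N\<close> as
  \<open>pi * ln (N * sqrt e) - pi * ln (sqrt e)\<close>. The first logarithm cancels the summed
  lens terms up to \<open>pi / 4\<close>, the second one is the source of the term in
  \<open>ln e\<close>.\<close>

lemma directed_integral_asymptotics:
  assumes h: "(\<lambda>N. (\<Sum>n\<le>N. z n) - c * of_real (ln (real N))) \<longlonglongrightarrow> h"
  shows "\<exists>B. eventually (\<lambda>e. norm ((LINT w:(\<Union>n. ball (z n) e)|lborel. w) / of_real (e^2)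
      - (of_real pi * h + c * of_real (pi / 4 - pi / 2 * ln e))) \<le> B * sqrt e) (at_right 0)"
proof -
  obtain n1 :: nat where n1: "real n1 \<ge> 20 * (C + 1)" using real_arch_simple by blast
  then have n1pos: "real n1 > 0" using C_ge_1 by auto
  have bdd: "bounded (range z)"
    using z_tendsto_0 convergent_imp_bounded by blast
  have "eventually (\<lambda>e. \<forall>n\<in>{..<n1}. 2 * e < dist (z n) (z (Suc n))) (at_right 0)"
  proof (intro eventually_ball_finite ballI)
    fix n
    have "dist (z n) (z (Suc n)) > 0" using inj_z by (simp add: inj_eq)
    then show "eventually (\<lambda>e. 2 * e < dist (z n) (z (Suc n))) (at_right 0)"
      by (auto simp: eventually_at_right_field intro!: exI[of _ "dist (z n) (z (Suc n)) / 2"])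
  qed simp
  moreover have "eventually (\<lambda>e. e < 1 / (2 * (real n1)^2)) (at_right 0)"
    using n1pos by (auto simp: eventually_at_right_field intro!: exI[of _ "1 / (2 * (real n1)^2)"])
  moreover have "eventually (\<lambda>e::real. e > 0) (at_right 0)"
    by (auto simp: eventually_at_right_field intro!: exI[of _ 1])
  ultimately have "eventually (\<lambda>e. norm ((LINT w:(\<Union>n. ball (z n) e)|lborel. w) / of_real (e^2)
      - (of_real pi * h + c * of_real (pi / 4 - pi / 2 * ln e))) \<le> 3200 * (C + 1) * sqrt e) (at_right 0)"
    using triple_Int
  proof eventually_elim
    case (elim e)
    define \<eta> where "\<eta> = sqrt e"
    have \<eta>: "\<eta> > 0" using elim by (simp add: \<eta>_def)
    define L where "L n = of_real (lens_area (dist (z n) (z (Suc n)) / e)) * mid n" for n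
    define T where "T n = L n - c * of_real (lens_prim (real (Suc n) * \<eta>) - lens_prim (real n * \<eta>))" for n
    define X where "X N = of_real pi * (\<Sum>n\<le>N. z n) - (\<Sum>n<N. L n)" for N
    define Y where "Y N = of_real pi * ((\<Sum>n\<le>N. z n) - c * of_real (ln (real N)))
      + c * of_real (pi * ln (real N * \<eta>) - lens_prim (real N * \<eta>)) - c * of_real (pi * ln \<eta>)" for N
    have X: "X \<longlonglongrightarrow> (LINT w:(\<Union>n. ball (z n) e)|lborel. w) / of_real (e^2)"
      unfolding X_def L_def mid_def
      by (rule LINT_union_balls_tendsto[OF elim(3) bdd]) (use elim(4) in blast)
    have "filterlim (\<lambda>N. real N * \<eta>) at_top sequentially"
      using \<eta> by real_asymp
    then have "(\<lambda>N. pi * ln (real N * \<eta>) - lens_prim (real N * \<eta>)) \<longlonglongrightarrow> pi / 4"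
      by (rule filterlim_compose[OF lens_prim_asymptotics])
    then have Y: "Y \<longlonglongrightarrow> of_real pi * h + c * of_real (pi / 4) - c * of_real (pi * ln \<eta>)"
      unfolding Y_def by (intro tendsto_intros h)
    have L0: "L n = 0" if "n < n1" for n
    proof -
      have "2 \<le> dist (z n) (z (Suc n)) / e" using elim that by (auto simp: field_simps intro: less_imp_le)
      then show ?thesis by (simp add: L_def)
    qed
    \<comment> \<open>The telescoping sum of \<open>lens_prim\<close> thus has no boundary term at
      \<open>n1\<close>.\<close>
    have K0: "lens_prim (real n1 * \<eta>) = 0"
    proof (rule lens_prim_eq_0)
      show "2 * (real n1 * \<eta>)^2 \<le> 1"
        using elim n1pos by (simp add: \<eta>_def power_mult_distrib field_simps)
    qed (use \<eta> n1pos in simp)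
    have XY: "norm (X N - Y N) \<le> 3200 * (C + 1) * \<eta>" if N: "N \<ge> n1" for N
    proof -
      have Npos: "real N > 0" using n1pos N by linarith
      have "(\<Sum>n<N. L n) = (\<Sum>n<n1. L n) + (\<Sum>n\<in>{n1..<N}. L n)"
        using N by (metis atLeast0LessThan sum.atLeastLessThan_concat zero_le)
      also have "(\<Sum>n<n1. L n) = 0" using L0 by simp
      also have "(\<Sum>n\<in>{n1..<N}. L n) = (\<Sum>n\<in>{n1..<N}. T n)
          + c * of_real (\<Sum>n\<in>{n1..<N}. lens_prim (real (Suc n) * \<eta>) - lens_prim (real n * \<eta>))"
        by (simp add: T_def sum_subtractf[symmetric] sum.distrib[symmetric] sum_distrib_left of_real_sum del: of_real_diff of_nat_Suc)
      also have "(\<Sum>n\<in>{n1..<N}. lens_prim (real (Suc n) * \<eta>) - lens_prim (real n * \<eta>)) = lens_prim (real N * \<eta>)"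
        using sum_Suc_diff'[OF N, of "\<lambda>n. lens_prim (real n * \<eta>)"] K0 by simp
      finally have "X N - Y N = - (\<Sum>n\<in>{n1..<N}. T n)"
        using \<eta> Npos by (simp add: X_def Y_def ln_mult algebra_simps)
      then have "norm (X N - Y N) \<le> (\<Sum>n\<in>{n1..<N}. norm (T n))"
        by (simp add: norm_sum)
      \<comment> \<open>The condition \<open>16 * n^2 * e < 1\<close> of
        \<open>lens_term_near\<close> means \<open>n < 1 / (4 * \<eta>)\<close>. The tail of the
        inverse squares from there is at most \<open>8 * \<eta>\<close>, whence the constant
        3200.\<close>
      also have "\<dots> \<le> (\<Sum>n\<in>{n1..<N}. 400 * (C + 1) * (if n < nat \<lceil>1 / (4 * \<eta>)\<rceil> then 0 else 1 / (real n)^2))"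
      proof (rule sum_mono)
        fix n assume n: "n \<in> {n1..<N}"
        then have "real n \<ge> 20 * (C + 1)" using n1 by simp
        then have le: "norm (T n) \<le> (if 16 * (real n)^2 * e < 1 then 0 else 400 * (C + 1) / (real n)^2)"
          unfolding T_def L_def \<eta>_def by (rule lens_term_near) (rule elim(3))
        show "norm (T n) \<le> 400 * (C + 1) * (if n < nat \<lceil>1 / (4 * \<eta>)\<rceil> then 0 else 1 / (real n)^2)"
        proof (cases "n < nat \<lceil>1 / (4 * \<eta>)\<rceil>")
          case True
          then have "real n < 1 / (4 * \<eta>)" by linarith
          then have "4 * real n * \<eta> < 1" using \<eta> by (simp add: field_simps)
          then have "(4 * real n * \<eta>)^2 < 1" using \<eta> by (simp add: abs_square_less_1)
          then have "16 * (real n)^2 * e < 1" using elim by (simp add: \<eta>_def power_mult_distrib)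
          then show ?thesis using le True by simp
        next
          case False
          then show ?thesis using le C_ge_1 by (auto split: if_splits intro: order.trans)
        qed
      qed
      also have "\<dots> = 400 * (C + 1) * (\<Sum>n\<in>{n1..<N}. if n < nat \<lceil>1 / (4 * \<eta>)\<rceil> then 0 else 1 / (real n)^2)"
        by (simp add: sum_distrib_left)
      also have "\<dots> \<le> 400 * (C + 1) * (2 / real (nat \<lceil>1 / (4 * \<eta>)\<rceil>))"
        using C_ge_1 \<eta> by (intro mult_left_mono sum_inverse_squares_tail) (auto simp: Suc_le_eq)
      also have "\<dots> \<le> 400 * (C + 1) * (2 / (1 / (4 * \<eta>)))"
      proof (intro mult_left_mono divide_left_mono)
        show "1 / (4 * \<eta>) \<le> real (nat \<lceil>1 / (4 * \<eta>)\<rceil>)" by linarith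
      qed (use C_ge_1 \<eta> in auto)
      also have "\<dots> = 3200 * (C + 1) * \<eta>" by simp
      finally show ?thesis .
    qed
    \<comment> \<open>The bound does not depend on \<open>N\<close>, so it passes to the limit for
      this fixed radius.\<close>
    have "norm ((LINT w:(\<Union>n. ball (z n) e)|lborel. w) / of_real (e^2)
        - (of_real pi * h + c * of_real (pi / 4) - c * of_real (pi * ln \<eta>))) \<le> 3200 * (C + 1) * \<eta>"
    proof (rule Lim_norm_ubound)
      show "(\<lambda>N. X N - Y N) \<longlonglongrightarrow> (LINT w:(\<Union>n. ball (z n) e)|lborel. w) / of_real (e^2)
        - (of_real pi * h + c * of_real (pi / 4) - c * of_real (pi * ln \<eta>))"
        by (intro tendsto_diff X Y)
      show "eventually (\<lambda>N. norm (X N - Y N) \<le> 3200 * (C + 1) * \<eta>) sequentially"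
        using XY eventually_sequentially by blast
    qed simp
    moreover have "of_real pi * h + c * of_real (pi / 4) - c * of_real (pi * ln \<eta>)
        = of_real pi * h + c * of_real (pi / 4 - pi / 2 * ln e)"
      using elim by (simp add: \<eta>_def ln_sqrt algebra_simps)
    ultimately show ?case by (simp only: \<eta>_def)
  qed
  then show ?thesis by blast
qed

end

section \<open>Orbits in a petal\<close>

text \<open>Satisfied by \<open>f\<close> with \<open>c = -1\<close> and by its inverse with
  \<open>c = 1\<close>. The exponent 2 in \<open>step\<close> matters: along an orbit
  \<open>norm z\<close> decays like \<open>1 / n\<close>, so the errors are summable.\<close>

locale parabolic_petal =
  fixes F :: "complex \<Rightarrow> complex" and V :: "complex set" and c :: complex and A r :: real
  assumes norm_c: "norm c = 1"
    and open_V: "open V"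
    and hol: "F holomorphic_on V"
    and F_V: "F ` V \<subseteq> V"
    and zero_notin: "0 \<notin> V"
    and conv: "z \<in> V \<Longrightarrow> (\<lambda>n. (F ^^ n) z) \<longlonglongrightarrow> 0"
    and r_pos: "r > 0" and A_nonneg: "A \<ge> 0"
    and step: "z \<in> V \<Longrightarrow> norm z < r \<Longrightarrow> norm (c / F z - c / z - 1) \<le> A * (norm z)^2"
begin

lemma iter_in: "z \<in> V \<Longrightarrow> (F ^^ n) z \<in> V"
  using F_V by (induction n) auto

lemma c_nonzero: "c \<noteq> 0"
  using norm_c by auto

lemma iter_nonzero: "z \<in> V \<Longrightarrow> (F ^^ n) z \<noteq> 0"
  using iter_in zero_notin by metis

definition coord :: "nat \<Rightarrow> complex \<Rightarrow> complex" where
  "coord n z = c / (F ^^ n) z"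

lemma coord_nonzero: "z \<in> V \<Longrightarrow> coord n z \<noteq> 0"
  using iter_nonzero c_nonzero by (simp add: coord_def)

lemma iter_eq: "z \<in> V \<Longrightarrow> (F ^^ n) z = c / coord n z"
  using iter_nonzero c_nonzero by (simp add: coord_def)

lemma coord_add: "coord (m + n) z = coord m ((F ^^ n) z)"
  by (simp add: coord_def funpow_add)

lemma holomorphic_iter: "(F ^^ n) holomorphic_on V"
proof (induction n)
  case 0
  then show ?case by (simp add: id_def holomorphic_on_ident)
next
  case (Suc n)
  have "F \<circ> (F ^^ n) holomorphic_on V"
    using Suc hol iter_in by (intro holomorphic_on_compose_gen[where t = V]) auto
  then show ?case by (simp only: funpow.simps)
qed

text \<open>A repeated value makes the orbit periodic; being also convergent to 0, it would contain
  0.\<close>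

lemma inj_orbit:
  assumes "z \<in> V" shows "inj (\<lambda>n. (F ^^ n) z)"
proof (rule linorder_injI)
  fix m n :: nat assume mn: "m < n"
  show "(F ^^ m) z \<noteq> (F ^^ n) z"
  proof
    assume eq: "(F ^^ m) z = (F ^^ n) z"
    define p where "p = n - m"
    have p: "p > 0" "n = p + m" using mn by (auto simp: p_def)
    have per: "(F ^^ p) ((F ^^ m) z) = (F ^^ m) z" using eq p by (simp add: funpow_add)
    have "(F ^^ (p * k)) ((F ^^ m) z) = (F ^^ m) z" for k
      by (induction k) (simp_all add: funpow_add per)
    moreover have "(\<lambda>k. (F ^^ (p * k)) ((F ^^ m) z)) \<longlonglongrightarrow> 0"
    proof -
      have "filterlim (\<lambda>k. p * k) at_top sequentially" using p(1) by (simp add: mult_nat_left_at_top)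
      then show ?thesis
        using filterlim_compose[OF conv[OF iter_in[OF assms]]] by blast
    qed
    ultimately have "(F ^^ m) z = 0" by (simp add: LIMSEQ_const_iff)
    then show False using iter_nonzero[OF assms] by blast
  qed
qed

text \<open>Chosen so that \<open>norm (c / z) \<ge> R\<close> forces \<open>norm z < r\<close> and
  a step error of at most \<open>1 / 2\<close>.\<close>

definition R :: real where "R = max 1 (max (2 / r) (2 * A))"

lemma R_ge: "R \<ge> 1" "R > 1 / r" "A / R^2 \<le> 1 / 2"
proof -
  show "R \<ge> 1" by (simp add: R_def)
  have "1 / r < 2 / r" using r_pos by (simp add: divide_strict_right_mono)
  then show "R > 1 / r" by (simp add: R_def)
  have "2 * A \<le> R" by (simp add: R_def)
  also have "R \<le> R^2" using \<open>R \<ge> 1\<close> by (simp add: power2_eq_square)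
  finally show "A / R^2 \<le> 1 / 2" using \<open>R \<ge> 1\<close> by (simp add: field_simps)
qed

lemma large_step:
  assumes z: "z \<in> V" and large: "norm (c / z) \<ge> R"
  shows "norm (c / F z - c / z - 1) \<le> A / (norm (c / z))^2" "norm (c / F z - c / z - 1) \<le> 1 / 2"
proof -
  have z0: "z \<noteq> 0" using z zero_notin by auto
  have n: "norm (c / z) = 1 / norm z" by (simp add: norm_divide norm_c)
  have "1 / norm z > 1 / r" using large n R_ge by linarith
  then have "norm z < r" using z0 r_pos by (simp add: field_simps)
  from step[OF z this] show *: "norm (c / F z - c / z - 1) \<le> A / (norm (c / z))^2"
    unfolding n by (simp add: power_divide)
  have "A / (norm (c / z))^2 \<le> A / R^2"
    using large R_ge(1) A_nonneg by (intro divide_left_mono power_mono) (auto intro!: mult_pos_pos)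
  then show "norm (c / F z - c / z - 1) \<le> 1 / 2" using * R_ge(3) by linarith
qed

text \<open>Each step raises the real part by at least \<open>1 / 2\<close>, so the orbit stays in
  the half-plane and \<open>coord n z\<close> grows linearly. This growth makes the step errors
  summable, uniformly in the starting point.\<close>

lemma half_plane:
  assumes z: "z \<in> V" and Re: "Re (c / z) \<ge> R"
  shows "Re (coord n z) \<ge> R + real n / 2"
    and "norm (coord (Suc n) z - coord n z - 1) \<le> 4 * A / (real n + 1)^2"
    and "norm (coord n z - c / z - of_nat n) \<le> 8 * A"
proof -
  have Re_n: "Re (coord n z) \<ge> R + real n / 2" for n
  proof (induction n)
    case 0
    then show ?case using Re by (simp add: coord_def)
  next
    case (Suc n)
    have "norm (c / (F ^^ n) z) \<ge> R"
      using Suc complex_Re_le_cmod[of "coord n z"] by (simp add: coord_def)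
    from large_step(2)[OF iter_in[OF z] this]
    have "\<bar>Re (coord (Suc n) z - coord n z - 1)\<bar> \<le> 1 / 2"
      using abs_Re_le_cmod[of "coord (Suc n) z - coord n z - 1"] by (simp add: coord_def)
    then have "Re (coord (Suc n) z) \<ge> Re (coord n z) + 1 / 2" unfolding abs_le_iff by simp
    then show ?case using Suc by (simp add: field_simps)
  qed
  then show "Re (coord n z) \<ge> R + real n / 2" .
  have st: "norm (coord (Suc n) z - coord n z - 1) \<le> 4 * A / (real n + 1)^2" for n
  proof -
    have nw: "norm (coord n z) \<ge> R + real n / 2"
      using Re_n[of n] complex_Re_le_cmod[of "coord n z"] by linarith
    have "norm (coord (Suc n) z - coord n z - 1) \<le> A / (norm (coord n z))^2"
      using large_step(1)[OF iter_in[OF z], of n] nw by (simp add: coord_def)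
    also have "\<dots> \<le> A / ((real n + 1) / 2)^2"
    proof (intro divide_left_mono power_mono)
      show "(real n + 1) / 2 \<le> norm (coord n z)" using nw R_ge(1) by (simp add: field_simps)
      then show "0 < (norm (coord n z))^2 * ((real n + 1) / 2)^2" using coord_nonzero[OF z] by simp
    qed (use A_nonneg in auto)
    finally show ?thesis by (simp add: power_divide mult.commute)
  qed
  then show "norm (coord (Suc n) z - coord n z - 1) \<le> 4 * A / (real n + 1)^2" .
  \<comment> \<open>The subtracted \<open>4 * A / n\<close> pays for the later steps by telescoping.
    The value at \<open>n = 0\<close> is separate because the first step alone costs
    \<open>4 * A\<close>.\<close>
  have "norm (coord n z - c / z - of_nat n) \<le> (if n = 0 then 0 else 8 * A - 4 * A * (1 / real n))"
  proof (induction n)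
    case 0
    then show ?case by (simp add: coord_def)
  next
    case (Suc n)
    have "norm (coord (Suc n) z - c / z - of_nat (Suc n))
      \<le> norm (coord n z - c / z - of_nat n) + norm (coord (Suc n) z - coord n z - 1)"
      using norm_triangle_ineq[of "coord n z - c / z - of_nat n" "coord (Suc n) z - coord n z - 1"]
      by (simp add: algebra_simps)
    also have "\<dots> \<le> (if n = 0 then 0 else 8 * A - 4 * A * (1 / real n)) + 4 * A * (1 / (real n + 1)^2)"
      using Suc st[of n] by simp
    also have "\<dots> \<le> 8 * A - 4 * A * (1 / (real n + 1))"
    proof (cases "n = 0")
      case False
      have "1 / (real n + 1)^2 \<le> 1 / (real n * (real n + 1))"
        using False by (intro divide_left_mono) (auto simp: power2_eq_square)
      also have "\<dots> = 1 / real n - 1 / (real n + 1)" using False by (simp add: field_simps)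
      finally have "4 * A * (1 / (real n + 1)^2) \<le> 4 * A * (1 / real n - 1 / (real n + 1))"
        using A_nonneg by (intro mult_left_mono) auto
      also have "\<dots> = 4 * A * (1 / real n) - 4 * A * (1 / (real n + 1))"
        by (rule right_diff_distrib)
      finally show ?thesis using False by simp
    qed simp
    finally show ?case by (simp add: add.commute)
  qed
  also have "\<dots> \<le> 8 * A" using A_nonneg by simp
  finally show "norm (coord n z - c / z - of_nat n) \<le> 8 * A" .
qed

text \<open>Convergence to 0 makes \<open>c / z\<close> large but does not control its direction;
  then, however, every step raises the real part by at least \<open>1 / 2\<close>. The margin 1
  leaves room for nearby starting points in \<open>uniform_limit_reg_sum\<close>.\<close>

lemma eventually_half_plane:
  assumes z: "z \<in> V"
  shows "\<exists>n. Re (coord n z) \<ge> R + 1"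
proof -
  have "eventually (\<lambda>n. norm ((F ^^ n) z) < 1 / R) sequentially"
    using tendsto_norm[OF conv[OF z]] R_ge(1) by (intro order_tendstoD(2)) auto
  then obtain n0 where n0: "\<And>n. n \<ge> n0 \<Longrightarrow> norm ((F ^^ n) z) < 1 / R"
    by (auto simp: eventually_sequentially)
  have large: "norm (c / (F ^^ n) z) \<ge> R" if "n \<ge> n0" for n
    using n0[OF that] iter_nonzero[OF z, of n] R_ge(1)
    by (simp add: norm_divide norm_c field_simps)
  have "Re (coord (n0 + k) z) \<ge> Re (coord n0 z) + real k / 2" for k
  proof (induction k)
    case (Suc k)
    have "norm (coord (Suc (n0 + k)) z - coord (n0 + k) z - 1) \<le> 1 / 2"
      using large_step(2)[OF iter_in[OF z] large[of "n0 + k"]] by (simp add: coord_def)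
    then have "\<bar>Re (coord (Suc (n0 + k)) z - coord (n0 + k) z - 1)\<bar> \<le> 1 / 2"
      using abs_Re_le_cmod order.trans by blast
    then have "Re (coord (Suc (n0 + k)) z) \<ge> Re (coord (n0 + k) z) + 1 / 2" unfolding abs_le_iff by simp
    then show ?case using Suc by (simp add: field_simps)
  qed simp
  moreover obtain k :: nat where "real k \<ge> 2 * (R + 1 - Re (coord n0 z))"
    using real_arch_simple by blast
  ultimately have "Re (coord (n0 + k) z) \<ge> R + 1"
    by (smt (verit, best) field_sum_of_halves)
  then show ?thesis by blast
qed

text \<open>The estimates hold from the entry into the half-plane on; the finitely many earlier
  terms are absorbed into the constant by \<open>Bseq_offset\<close>.\<close>

lemma asymptotic_orbit_iter:
  assumes z: "z \<in> V"
  shows "\<exists>C. asymptotic_orbit (\<lambda>n. (F ^^ n) z) (\<lambda>n. coord n z) c C"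
proof -
  obtain n0 where n0: "Re (coord n0 z) \<ge> R + 1" using eventually_half_plane[OF z] by blast
  define z0 where "z0 = (F ^^ n0) z"
  have z0: "z0 \<in> V" "Re (c / z0) \<ge> R" using iter_in[OF z] n0 by (auto simp: z0_def coord_def)
  have shift: "coord (k + n0) z = coord k z0" for k by (simp add: coord_add z0_def)
  have "Bseq (\<lambda>n. coord n z - of_nat n)"
  proof (rule Bseq_offset)
    have "norm (coord (k + n0) z - of_nat (k + n0)) \<le> 8 * A + norm (c / z0 - of_nat n0)" for k
      using half_plane(3)[OF z0, of k] norm_triangle_ineq[of "coord k z0 - c / z0 - of_nat k" "c / z0 - of_nat n0"]
      by (simp add: shift algebra_simps)
    then show "Bseq (\<lambda>k. coord (k + n0) z - of_nat (k + n0))" by (rule BseqI')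
  qed
  then obtain C1 where C1: "\<And>n. norm (coord n z - of_nat n) \<le> C1" by (auto simp: Bseq_def)
  have "Bseq (\<lambda>n. (coord (Suc n) z - coord n z - 1) * of_real ((real n + 1)^2))"
  proof (rule Bseq_offset)
    have "norm ((coord (Suc (k + n0)) z - coord (k + n0) z - 1) * of_real ((real (k + n0) + 1)^2)) \<le> 4 * A * (real n0 + 1)^2" for k
    proof -
      have "norm (coord (Suc (k + n0)) z - coord (k + n0) z - 1) \<le> 4 * A / (real k + 1)^2"
        using half_plane(2)[OF z0, of k] shift[of k] shift[of "Suc k"] by simp
      \<comment> \<open>Decay counted from the entry time becomes decay counted from the start, at
        the cost of a constant factor.\<close>
      moreover have "(real (k + n0) + 1)^2 \<le> ((real k + 1) * (real n0 + 1))^2"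
        by (intro power_mono) (auto simp: algebra_simps)
      ultimately have "norm (coord (Suc (k + n0)) z - coord (k + n0) z - 1) * (real (k + n0) + 1)^2
        \<le> 4 * A / (real k + 1)^2 * ((real k + 1) * (real n0 + 1))^2"
        using A_nonneg by (intro mult_mono) auto
      also have "\<dots> = 4 * A * (real n0 + 1)^2" by (simp add: power_mult_distrib)
      finally show ?thesis by (simp only: norm_mult norm_of_real abs_power2)
    qed
    then show "Bseq (\<lambda>k. (coord (Suc (k + n0)) z - coord (k + n0) z - 1) * of_real ((real (k + n0) + 1)^2))"
      by (rule BseqI')
  qed
  then obtain C2 where C2: "\<And>n. norm ((coord (Suc n) z - coord n z - 1) * of_real ((real n + 1)^2)) \<le> C2"
    by (auto simp: Bseq_def)
  have C2': "norm (coord (Suc n) z - coord n z - 1) \<le> C2 / (real n + 1)^2" for n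
  proof -
    have "norm (coord (Suc n) z - coord n z - 1) * (real n + 1)^2 \<le> C2"
      using C2[of n] by (simp only: norm_mult norm_of_real abs_power2)
    then show ?thesis by (simp add: pos_le_divide_eq)
  qed
  define C where "C = max 1 (max C1 C2)"
  have "asymptotic_orbit (\<lambda>n. (F ^^ n) z) (\<lambda>n. coord n z) c C"
  proof
    fix n
    show "norm (coord n z - of_nat n) \<le> C" using C1[of n] by (simp add: C_def)
    have "C2 / (real n + 1)^2 \<le> C / (real n + 1)^2"
      by (intro divide_right_mono) (auto simp: C_def)
    then show "norm (coord (Suc n) z - coord n z - 1) \<le> C / (real n + 1)^2" using C2'[of n] by linarith
  qed (use norm_c coord_nonzero[OF z] iter_eq[OF z] inj_orbit[OF z] in \<open>auto simp: C_def\<close>)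
  then show ?thesis by blast
qed

section \<open>The regularized orbit sum\<close>

text \<open>Used in place of \<open>1 / n\<close> because its partial sums are exactly logarithms;
  the convention \<open>ln 0 = 0\<close> makes the term at \<open>n = 0\<close> vanish.\<close>

definition log_incr :: "nat \<Rightarrow> real" where
  "log_incr n = ln (real (Suc n)) - ln (real n)"

lemma sum_log_incr: "(\<Sum>n<N. log_incr n) = ln (real N)"
proof -
  have "(\<Sum>n<N. log_incr n) = ln (real N) - ln (real 0)"
    unfolding log_incr_def by (rule sum_lessThan_telescope)
  then show ?thesis by simp
qed

lemma log_incr_near: "n \<ge> 1 \<Longrightarrow> \<bar>1 / real n - log_incr n\<bar> \<le> 1 / (real n)^2"
proof -
  assume n: "n \<ge> 1"
  have "log_incr n = ln (real (Suc n) / real n)"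
    unfolding log_incr_def using n by (subst ln_div) auto
  also have "real (Suc n) / real n = 1 + 1 / real n" using n by (simp add: field_simps)
  finally have "log_incr n = ln (1 + 1 / real n)" .
  then show ?thesis
    using abs_ln_one_plus_x_minus_x_bound_nonneg[of "1 / real n"] n
    by (simp add: power_divide abs_minus_commute)
qed

text \<open>Dropping the first point of an orbit lowers this value by that point, so
  \<open>pi * reg_sum\<close> solves \<open>H z - H (F z) = pi * z\<close>. It is the link between
  the area and the sectorial solutions.\<close>

definition reg_sum :: "complex \<Rightarrow> complex" where
  "reg_sum z = (\<Sum>n. (F ^^ n) z - c * of_real (log_incr n))"

text \<open>By continuity of \<open>coord n0\<close> one entry time \<open>n0\<close> serves a whole
  neighborhood, and the constants in \<open>half_plane\<close> do not depend on the point. The terms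
  are then uniformly of order \<open>1 / n^2\<close>.\<close>

lemma uniform_limit_reg_sum:
  assumes z: "z \<in> V"
  shows "\<exists>d>0. cball z d \<subseteq> V \<and>
    uniform_limit (cball z d) (\<lambda>N x. \<Sum>n<N. (F ^^ n) x - c * of_real (log_incr n)) reg_sum sequentially"
proof -
  obtain n0 where n0: "Re (coord n0 z) \<ge> R + 1" using eventually_half_plane[OF z] by blast
  have cont: "continuous_on V (coord n0)"
    unfolding coord_def[abs_def] using iter_nonzero
    by (intro continuous_intros holomorphic_on_imp_continuous_on holomorphic_iter) auto
  define B where "B = ball (coord n0 z) 1"
  have "open (V \<inter> coord n0 -` B)"
    by (rule continuous_open_preimage[OF cont open_V]) (simp add: B_def)
  moreover have "z \<in> V \<inter> coord n0 -` B" using z by (simp add: B_def)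
  ultimately obtain d where d: "d > 0" "cball z d \<subseteq> V \<inter> coord n0 -` B"
    by (meson open_contains_cball)
  define D where "D = norm (coord n0 z) + 1 + 8 * A + real n0"
  have D0: "D \<ge> 0" using A_nonneg by (simp add: D_def)
  \<comment> \<open>From \<open>2 * n0 + 1\<close> on, at least half of the iterations happen in the
    half-plane, which gives \<open>norm (coord n x) \<ge> n / 4\<close>.\<close>
  have bound: "norm ((F ^^ n) x - c * of_real (log_incr n)) \<le> (4 * D + 1) * (1 / (real n)^2)"
    if x: "x \<in> cball z d" and n: "n \<ge> 2 * n0 + 1" for x n
  proof -
    have xV: "x \<in> V" and xB: "norm (coord n0 x - coord n0 z) < 1"
      using d(2) x by (auto simp: B_def dist_norm subset_iff norm_minus_commute[of "coord n0 z"])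
    define x0 where "x0 = (F ^^ n0) x"
    define k where "k = n - n0"
    have k: "n = k + n0" "real k \<ge> real n / 2" using n by (auto simp: k_def)
    have "\<bar>Re (coord n0 x - coord n0 z)\<bar> \<le> 1" using xB abs_Re_le_cmod[of "coord n0 x - coord n0 z"] by linarith
    then have x0: "x0 \<in> V" "Re (c / x0) \<ge> R"
      using iter_in[OF xV] n0 by (auto simp: x0_def coord_def)
    have coord_n: "coord n x = coord k x0" unfolding k(1) coord_add x0_def ..
    have "norm (c / x0) \<le> norm (coord n0 z) + 1"
      using xB norm_triangle_ineq2[of "coord n0 x" "coord n0 z"] by (simp add: x0_def coord_def)
    moreover have "norm (coord k x0 - c / x0 - of_nat k) \<le> 8 * A" by (rule half_plane(3)[OF x0])
    moreover have "norm (of_nat n - coord n x) \<le> norm (coord k x0 - c / x0 - of_nat k) + norm (c / x0) + norm (of_nat n0 :: complex)"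
    proof -
      have "of_nat n - coord n x = of_nat n0 - (c / x0) - (coord k x0 - c / x0 - of_nat k)"
        unfolding coord_n by (simp add: k(1))
      then show ?thesis
        using norm_triangle_ineq4[of "of_nat n0 - (c / x0)" "coord k x0 - c / x0 - of_nat k"]
          norm_triangle_ineq4[of "of_nat n0" "c / x0"] by simp
    qed
    ultimately have diff: "norm (of_nat n - coord n x) \<le> D" by (simp add: D_def)
    have "Re (coord n x) \<ge> R + real k / 2" unfolding coord_n by (rule half_plane(1)[OF x0])
    then have w: "norm (coord n x) \<ge> real n / 4"
      using complex_Re_le_cmod[of "coord n x"] R_ge(1) k(2) by linarith
    have n1: "real n > 0" using n by simp
    have "(F ^^ n) x - c / of_nat n = c * (of_nat n - coord n x) / (coord n x * of_nat n)"
      using coord_nonzero[OF xV, of n] n1 by (simp add: iter_eq[OF xV] field_simps)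
    then have "norm ((F ^^ n) x - c / of_nat n) = norm (of_nat n - coord n x) / (norm (coord n x) * real n)"
      by (simp add: norm_mult norm_divide norm_c)
    also have "\<dots> \<le> D / (real n / 4 * real n)"
      using diff w n1 D0 by (intro frac_le mult_mono) auto
    finally have 1: "norm ((F ^^ n) x - c / of_nat n) \<le> 4 * D * (1 / (real n)^2)"
      by (simp add: power2_eq_square mult.commute)
    have "c / of_nat n - c * of_real (log_incr n) = c * of_real (1 / real n - log_incr n)"
      by (simp add: algebra_simps)
    then have "norm (c / of_nat n - c * of_real (log_incr n)) = \<bar>1 / real n - log_incr n\<bar>"
      by (simp only: norm_mult norm_c norm_of_real mult_1)
    also have "\<dots> \<le> 1 / (real n)^2" using n by (intro log_incr_near) simp
    finally have 2: "norm (c / of_nat n - c * of_real (log_incr n)) \<le> 1 / (real n)^2" .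
    have "norm ((F ^^ n) x - c * of_real (log_incr n))
      \<le> norm ((F ^^ n) x - c / of_nat n) + norm (c / of_nat n - c * of_real (log_incr n))"
      using norm_triangle_ineq[of "(F ^^ n) x - c / of_nat n" "c / of_nat n - c * of_real (log_incr n)"] by simp
    then show ?thesis
      using 1 2 unfolding distrib_right mult_1 by linarith
  qed
  have "uniform_limit (cball z d) (\<lambda>N x. \<Sum>n<N. (F ^^ n) x - c * of_real (log_incr n)) reg_sum sequentially"
    unfolding reg_sum_def[abs_def]
  proof (rule Weierstrass_m_test_ev)
    show "eventually (\<lambda>n. \<forall>x\<in>cball z d. norm ((F ^^ n) x - c * of_real (log_incr n)) \<le> (4 * D + 1) * (1 / (real n)^2)) sequentially"
      unfolding eventually_sequentially using bound by blast
    show "summable (\<lambda>n. (4 * D + 1) * (1 / (real n)^2))"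
      using inverse_power_summable[of 2, where ?'a = real]
      by (intro summable_mult) (simp add: inverse_eq_divide)
  qed
  then show ?thesis using d by blast
qed

lemma holomorphic_reg_sum: "reg_sum holomorphic_on V"
proof (rule holomorphic_uniform_sequence[OF open_V])
  show "(\<lambda>x. \<Sum>n<N. (F ^^ n) x - c * of_real (log_incr n)) holomorphic_on V" for N
    by (intro holomorphic_intros holomorphic_iter)
  show "\<exists>d>0. cball x d \<subseteq> V \<and>
    uniform_limit (cball x d) (\<lambda>N x. \<Sum>n<N. (F ^^ n) x - c * of_real (log_incr n)) reg_sum sequentially"
    if "x \<in> V" for x
    by (rule uniform_limit_reg_sum[OF that])
qed

lemma reg_sum_tendsto:
  assumes z: "z \<in> V"
  shows "(\<lambda>N. (\<Sum>n<N. (F ^^ n) z) - c * of_real (ln (real N))) \<longlonglongrightarrow> reg_sum z"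
proof -
  obtain d where "d > 0"
    "uniform_limit (cball z d) (\<lambda>N x. \<Sum>n<N. (F ^^ n) x - c * of_real (log_incr n)) reg_sum sequentially"
    using uniform_limit_reg_sum[OF z] by blast
  then have "(\<lambda>N. \<Sum>n<N. (F ^^ n) z - c * of_real (log_incr n)) \<longlonglongrightarrow> reg_sum z"
    by (auto intro: tendsto_uniform_limitI[where S = "cball z d"])
  then show ?thesis
    by (simp add: sum_subtractf sum_log_incr flip: sum_distrib_left of_real_sum)
qed

text \<open>Orbits approach 0 in the direction \<open>c\<close>; this fixes the limiting argument in
  the logarithm of the orbit.\<close>

lemma of_nat_times_iter_tendsto:
  assumes z: "z \<in> V"
  shows "(\<lambda>n. of_nat n * (F ^^ n) z) \<longlonglongrightarrow> c"
proof -
  obtain C where "asymptotic_orbit (\<lambda>n. (F ^^ n) z) (\<lambda>n. coord n z) c C"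
    using asymptotic_orbit_iter[OF z] by blast
  then interpret asymptotic_orbit "\<lambda>n. (F ^^ n) z" "\<lambda>n. coord n z" c C .
  have "(\<lambda>n. (coord n z - of_nat n) / of_nat n) \<longlonglongrightarrow> 0"
  proof (rule Lim_null_comparison)
    show "(\<lambda>n. C / real n) \<longlonglongrightarrow> 0" by real_asymp
    show "eventually (\<lambda>n. norm ((coord n z - of_nat n) / of_nat n) \<le> C / real n) sequentially"
      using w_near by (intro always_eventually allI) (simp add: norm_divide divide_right_mono)
  qed
  then have "(\<lambda>n. c / (1 + (coord n z - of_nat n) / of_nat n)) \<longlonglongrightarrow> c / (1 + 0)"
    by (intro tendsto_intros) auto
  moreover have "eventually (\<lambda>n. c / (1 + (coord n z - of_nat n) / of_nat n) = of_nat n * (F ^^ n) z) sequentially"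
    using eventually_gt_at_top[of 0]
  proof eventually_elim
    case (elim n)
    then have "1 + (coord n z - of_nat n) / of_nat n = coord n z / of_nat n" by (simp add: field_simps)
    then show ?case using iter_eq[OF z] by simp
  qed
  ultimately show ?thesis by (simp add: filterlim_cong)
qed

text \<open>Brings the orbit into the sector around \<open>c\<close> where
  \<open>gevrey1_asymptotic\<close> applies with \<open>\<delta> = pi / 2\<close>.\<close>

lemma eventually_Re_pos:
  assumes z: "z \<in> V"
  shows "eventually (\<lambda>n. Re ((F ^^ n) z / c) > 0) sequentially"
proof -
  have "(\<lambda>n. Re (of_nat n * (F ^^ n) z / c)) \<longlonglongrightarrow> Re (c / c)"
    by (intro tendsto_intros of_nat_times_iter_tendsto[OF z] c_nonzero)
  then have "eventually (\<lambda>n. Re (of_nat n * (F ^^ n) z / c) > 0) sequentially"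
    using c_nonzero by (intro order_tendstoD(1)) auto
  then show ?thesis
  proof eventually_elim
    case (elim n)
    have "of_nat n * (F ^^ n) z / c = of_real (real n) * ((F ^^ n) z / c)" by simp
    also have "Re \<dots> = real n * Re ((F ^^ n) z / c)" by (simp only: Re_complex_of_real times_complex.simps Im_complex_of_real mult_zero_left diff_zero)
    finally have "Re (of_nat n * (F ^^ n) z / c) = real n * Re ((F ^^ n) z / c)" .
    then show ?case using elim by (simp add: zero_less_mult_iff)
  qed
qed

end

section \<open>The principal part of area\<close>

text \<open>After division by the square of the radius, the \<open>q2\<close> term and the error
  tend to 0. The unbounded logarithm then forces \<open>q1 = 0\<close>, and \<open>h = 0\<close>
  remains. This makes the \<open>THE\<close> in \<open>principal_part_of_area\<close>
  meaningful.\<close>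

lemma expansion_coeff_eq_0:
  fixes q1 h q2 :: complex
  assumes "(\<lambda>\<epsilon>::real. q1 * of_real (\<epsilon>^2 * ln \<epsilon>) + h * of_real (\<epsilon>^2) + q2 * of_real (\<epsilon> powr (5/2) * ln \<epsilon>))
    \<in> O[at_right 0](\<lambda>\<epsilon>. of_real (\<epsilon> powr (5/2)))"
  shows "h = 0"
proof -
  define G where "G = (\<lambda>\<epsilon>::real. q1 * of_real (\<epsilon>^2 * ln \<epsilon>) + h * of_real (\<epsilon>^2) + q2 * of_real (\<epsilon> powr (5/2) * ln \<epsilon>))"
  obtain K where K: "eventually (\<lambda>\<epsilon>. norm (G \<epsilon>) \<le> K * norm (of_real (\<epsilon> powr (5/2)) :: complex)) (at_right 0)"
    using assms unfolding G_def by (elim landau_o.bigE)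
  have pos: "eventually (\<lambda>\<epsilon>::real. \<epsilon> > 0 \<and> \<epsilon> < 1) (at_right 0)"
    by (auto simp: eventually_at_right_field intro!: exI[of _ 1])
  have lim: "((\<lambda>\<epsilon>. G \<epsilon> / of_real (\<epsilon>^2)) \<longlongrightarrow> 0) (at_right 0)"
  proof (rule Lim_null_comparison)
    show "((\<lambda>\<epsilon>. K * \<epsilon> powr (1/2)) \<longlongrightarrow> 0) (at_right 0)" by real_asymp
    show "eventually (\<lambda>\<epsilon>. norm (G \<epsilon> / of_real (\<epsilon>^2)) \<le> K * \<epsilon> powr (1/2)) (at_right 0)"
      using K pos
    proof eventually_elim
      case (elim \<epsilon>)
      have "norm (G \<epsilon> / of_real (\<epsilon>^2)) = norm (G \<epsilon>) / \<epsilon>^2" by (simp add: norm_divide norm_power)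
      also have "\<dots> \<le> K * \<epsilon> powr (5/2) / \<epsilon>^2" using elim by (intro divide_right_mono) auto
      also have "\<epsilon> powr (5/2) = \<epsilon> powr (1/2) * \<epsilon>^2"
      proof -
        have "\<epsilon> powr (5/2) = \<epsilon> powr (1/2 + 2)" by simp
        also have "\<dots> = \<epsilon> powr (1/2) * \<epsilon> powr 2" by (rule powr_add)
        finally show ?thesis using elim by simp
      qed
      finally show ?case using elim by simp
    qed
  qed
  have G: "eventually (\<lambda>\<epsilon>. G \<epsilon> / of_real (\<epsilon>^2) = q1 * of_real (ln \<epsilon>) + h + q2 * of_real (\<epsilon> powr (1/2) * ln \<epsilon>)) (at_right 0)"
    using pos
  proof eventually_elim
    case (elim \<epsilon>)
    have "\<epsilon> powr (5/2) = \<epsilon> powr (1/2) * \<epsilon>^2"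
    proof -
      have "\<epsilon> powr (5/2) = \<epsilon> powr (1/2 + 2)" by simp
      also have "\<dots> = \<epsilon> powr (1/2) * \<epsilon> powr 2" by (rule powr_add)
      finally show ?thesis using elim by simp
    qed
    then have p: "of_real (\<epsilon> powr (5/2) * ln \<epsilon>) = of_real (\<epsilon> powr (1/2) * ln \<epsilon>) * complex_of_real (\<epsilon>^2)"
      by simp
    have "complex_of_real (\<epsilon>^2) \<noteq> 0" using elim by simp
    then show ?case unfolding G_def p of_real_mult[of "\<epsilon>^2"]
      by (simp add: add_divide_distrib del: of_real_power of_real_mult)
  qed
  have lim1: "((\<lambda>\<epsilon>. q1 * of_real (ln \<epsilon>) + h + q2 * of_real (\<epsilon> powr (1/2) * ln \<epsilon>)) \<longlongrightarrow> 0) (at_right 0)"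
    using Lim_transform_eventually[OF lim G] .
  have sm: "((\<lambda>\<epsilon>::real. \<epsilon> powr (1/2) * ln \<epsilon>) \<longlongrightarrow> 0) (at_right 0)" by real_asymp
  have "((\<lambda>\<epsilon>. q2 * of_real (\<epsilon> powr (1/2) * ln \<epsilon>)) \<longlongrightarrow> q2 * of_real 0) (at_right 0)"
    by (intro tendsto_mult tendsto_const tendsto_of_real sm)
  from tendsto_diff[OF lim1 this] have lim2: "((\<lambda>\<epsilon>. q1 * of_real (ln \<epsilon>) + h) \<longlongrightarrow> 0) (at_right 0)" by simp
  have il: "((\<lambda>\<epsilon>::real. 1 / ln \<epsilon>) \<longlongrightarrow> 0) (at_right 0)" by real_asymp
  \<comment> \<open>Dividing by the logarithm isolates \<open>q1\<close>, since
    \<open>h / ln \<epsilon>\<close> tends to 0.\<close>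
  have "((\<lambda>\<epsilon>. (q1 * of_real (ln \<epsilon>) + h) * of_real (1 / ln \<epsilon>) - h * of_real (1 / ln \<epsilon>)) \<longlongrightarrow> 0 * of_real 0 - h * of_real 0) (at_right 0)"
    by (intro tendsto_diff tendsto_mult tendsto_const tendsto_of_real il lim2)
  moreover have "eventually (\<lambda>\<epsilon>. (q1 * of_real (ln \<epsilon>) + h) * of_real (1 / ln \<epsilon>) - h * of_real (1 / ln \<epsilon>) = q1) (at_right 0)"
    using pos
  proof eventually_elim
    case (elim \<epsilon>)
    then have "complex_of_real (ln \<epsilon>) \<noteq> 0" by simp
    then show ?case by (simp add: field_simps del: of_real_eq_0_iff)
  qed
  ultimately have "((\<lambda>\<epsilon>::real. q1) \<longlongrightarrow> 0 * of_real 0 - h * of_real 0) (at_right 0)"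
    by (rule Lim_transform_eventually)
  then have "q1 = 0" by (simp add: tendsto_const_iff)
  with lim2 show "h = 0" by (simp add: tendsto_const_iff)
qed

text \<open>Two admissible expansions may a priori differ in all three coefficients, so their
  difference is treated as an expansion of 0.\<close>

lemma principal_part_of_area_eqI:
  assumes ex: "directed_area_expansion F V q1 q2 h" and z: "z \<in> V"
  shows "principal_part_of_area F V z = h z"
  unfolding principal_part_of_area_def
proof (rule the_equality)
  show "\<exists>q1 q2 k. directed_area_expansion F V q1 q2 k \<and> k z = h z" using ex by blast
  fix d assume "\<exists>q1 q2 k. directed_area_expansion F V q1 q2 k \<and> k z = d"
  then obtain p1 p2 k where k: "directed_area_expansion F V p1 p2 k" "k z = d" by blast
  have "(\<lambda>\<epsilon>. (directed_area F z \<epsilon> - (q1 * of_real (\<epsilon>^2 * ln \<epsilon>) + h z * of_real (\<epsilon>^2) + q2 * of_real (\<epsilon> powr (5/2) * ln \<epsilon>)))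
      - (directed_area F z \<epsilon> - (p1 * of_real (\<epsilon>^2 * ln \<epsilon>) + k z * of_real (\<epsilon>^2) + p2 * of_real (\<epsilon> powr (5/2) * ln \<epsilon>))))
    \<in> O[at_right 0](\<lambda>\<epsilon>. of_real (\<epsilon> powr (5/2)))"
    by (rule sum_in_bigo(2)) (use ex k(1) z in \<open>unfold directed_area_expansion_def, blast+\<close>)
  then have "(\<lambda>\<epsilon>::real. (p1 - q1) * of_real (\<epsilon>^2 * ln \<epsilon>) + (k z - h z) * of_real (\<epsilon>^2) + (p2 - q2) * of_real (\<epsilon> powr (5/2) * ln \<epsilon>))
    \<in> O[at_right 0](\<lambda>\<epsilon>. of_real (\<epsilon> powr (5/2)))"
    by (simp add: algebra_simps)
  then have "k z - h z = 0" by (rule expansion_coeff_eq_0)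
  then show "d = h z" using k by simp
qed

context parabolic_petal
begin

text \<open>\<open>center_of_mass\<close> divides by the area, so the product returns the integral
  once the area is nonzero; a single disc already ensures that.\<close>

lemma directed_area_eq:
  assumes z: "z \<in> V" and e: "e > 0"
  shows "directed_area F z e = (LINT w:(\<Union>n. ball ((F ^^ n) z) e)|lborel. w)"
proof -
  have E: "eps_nbhd (orbit_of F z) e = (\<Union>n. ball ((F ^^ n) z) e)"
    by (auto simp: eps_nbhd_def orbit_of_def)
  have "area (eps_nbhd (orbit_of F z) e) \<noteq> 0"
  proof -
    have "bounded (range (\<lambda>n. (F ^^ n) z))"
      using conv[OF z] convergent_imp_bounded by blast
    then obtain B where B: "\<And>n. norm ((F ^^ n) z) \<le> B" by (auto simp: bounded_iff)
    have "(\<Union>n. ball ((F ^^ n) z) e) \<subseteq> ball 0 (B + e)"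
    proof clarify
      fix p n assume "p \<in> ball ((F ^^ n) z) e"
      then show "p \<in> ball 0 (B + e)"
        using B[of n] norm_triangle_ineq2[of p "(F ^^ n) z"] by (simp add: dist_norm norm_minus_commute)
    qed
    then have "bounded (\<Union>n. ball ((F ^^ n) z) e)" using bounded_subset bounded_ball by blast
    then have fin: "emeasure lborel (\<Union>n. ball ((F ^^ n) z) e) < \<infinity>" by (rule emeasure_bounded_finite)
    have "measure lborel (ball z e) \<le> measure lborel (\<Union>n. ball ((F ^^ n) z) e)"
    proof (rule measure_mono_fmeasurable)
      show "ball z e \<subseteq> (\<Union>n. ball ((F ^^ n) z) e)" using UN_upper[of 0 UNIV "\<lambda>n. ball ((F ^^ n) z) e"] by simp
      show "(\<Union>n. ball ((F ^^ n) z) e) \<in> fmeasurable lborel"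
        using fin by (intro fmeasurableI) auto
    qed simp
    moreover have "measure lborel (ball z e) = e^2 * pi"
      using measure_lens[OF e, of z z] by simp
    moreover have "0 < e^2 * pi" using e by simp
    ultimately show ?thesis unfolding area_def E by linarith
  qed
  then show ?thesis by (simp add: directed_area_def center_of_mass_def E)
qed

lemma directed_area_expansion_reg_sum:
  "directed_area_expansion F V (- c * of_real (pi / 2)) 0 (\<lambda>z. of_real pi * reg_sum z + c * of_real (pi / 4))"
  unfolding directed_area_expansion_def
proof
  fix z assume z: "z \<in> V"
  obtain C where "asymptotic_orbit (\<lambda>n. (F ^^ n) z) (\<lambda>n. coord n z) c C"
    using asymptotic_orbit_iter[OF z] by blast
  then interpret asymptotic_orbit "\<lambda>n. (F ^^ n) z" "\<lambda>n. coord n z" c C .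
  \<comment> \<open>The union of discs up to \<open>N\<close> involves the point with index
    \<open>N\<close>, which \<open>reg_sum_tendsto\<close> leaves out; it tends to 0.\<close>
  have "(\<lambda>N. ((\<Sum>n<N. (F ^^ n) z) - c * of_real (ln (real N))) + (F ^^ N) z) \<longlonglongrightarrow> reg_sum z + 0"
    by (intro tendsto_add reg_sum_tendsto conv z)
  then have "(\<lambda>N. (\<Sum>n\<le>N. (F ^^ n) z) - c * of_real (ln (real N))) \<longlonglongrightarrow> reg_sum z"
    by (simp add: lessThan_Suc_atMost[symmetric] algebra_simps)
  from directed_integral_asymptotics[OF this] obtain B where
    B: "eventually (\<lambda>e. norm ((LINT w:(\<Union>n. ball ((F ^^ n) z) e)|lborel. w) / of_real (e^2)
      - (of_real pi * reg_sum z + c * of_real (pi / 4 - pi / 2 * ln e))) \<le> B * sqrt e) (at_right 0)" by blast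
  have pos: "eventually (\<lambda>e::real. e > 0) (at_right 0)"
    by (auto simp: eventually_at_right_field intro!: exI[of _ 1])
  have "eventually (\<lambda>e. norm (directed_area F z e - (- c * of_real (pi / 2) * of_real (e^2 * ln e)
      + (of_real pi * reg_sum z + c * of_real (pi / 4)) * of_real (e^2) + 0 * of_real (e powr (5/2) * ln e)))
      \<le> B * norm (of_real (e powr (5/2)) :: complex)) (at_right 0)"
    using B pos
  proof eventually_elim
    case (elim e)
    define I where "I = (LINT w:(\<Union>n. ball ((F ^^ n) z) e)|lborel. w)"
    have "directed_area F z e - (- c * of_real (pi / 2) * of_real (e^2 * ln e)
      + (of_real pi * reg_sum z + c * of_real (pi / 4)) * of_real (e^2) + 0 * of_real (e powr (5/2) * ln e))
      = of_real (e^2) * (I / of_real (e^2) - (of_real pi * reg_sum z + c * of_real (pi / 4 - pi / 2 * ln e)))"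
      using elim(2) by (simp add: directed_area_eq[OF z elim(2)] I_def field_simps)
    also have "norm \<dots> \<le> e^2 * (B * sqrt e)"
      using mult_left_mono[OF elim(1), of "e^2"] unfolding I_def norm_mult norm_of_real by simp
    also have "\<dots> = B * norm (of_real (e powr (5/2)) :: complex)"
    proof -
      have "e powr (5/2) = e powr (1/2 + 2)" by simp
      also have "\<dots> = e powr (1/2) * e powr 2" by (rule powr_add)
      also have "\<dots> = sqrt e * e^2" using elim by (simp add: powr_half_sqrt)
      finally show ?thesis using elim by (simp only: norm_of_real) (simp add: abs_mult)
    qed
    finally show ?case .
  qed
  then show "(\<lambda>e. directed_area F z e - (- c * of_real (pi / 2) * of_real (e^2 * ln e)
      + (of_real pi * reg_sum z + c * of_real (pi / 4)) * of_real (e^2) + 0 * of_real (e powr (5/2) * ln e)))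
      \<in> O[at_right 0](\<lambda>e. of_real (e powr (5/2)))"
    by (rule bigoI)
qed

lemma principal_part_eq:
  "z \<in> V \<Longrightarrow> principal_part_of_area F V z = of_real pi * reg_sum z + c * of_real (pi / 4)"
  by (rule principal_part_of_area_eqI[OF directed_area_expansion_reg_sum])

lemma principal_part_analytic: "principal_part_of_area F V analytic_on V"
proof -
  have "(\<lambda>z. of_real pi * reg_sum z + c * of_real (pi / 4)) holomorphic_on V"
    by (intro holomorphic_intros holomorphic_reg_sum)
  then have "principal_part_of_area F V holomorphic_on V"
    by (rule holomorphic_transform) (simp add: principal_part_eq)
  then show ?thesis using open_V by (simp add: analytic_on_open)
qed

text \<open>The estimate with \<open>N = 1\<close>, on the sector that the orbit eventually enters,
  bounds \<open>h\<close> by a multiple of \<open>norm z\<close>. The missing constant term of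
  \<open>a\<close> fixes the additive constant of the solution.\<close>

lemma gevrey_orbit_tendsto:
  assumes g: "gevrey1_asymptotic c V h a" and a: "fps_nth a 0 = 0" and z: "z \<in> V"
  shows "(\<lambda>n. h ((F ^^ n) z)) \<longlonglongrightarrow> 0"
proof -
  have "pi / 2 \<in> {0<..<pi}" by simp
  from bspec[OF g[unfolded gevrey1_asymptotic_def] this]
  obtain r C M where rCM: "r > 0" "C > 0" "M > 0"
    and est: "\<And>N z. z \<in> V \<Longrightarrow> norm z < r \<Longrightarrow> \<bar>Arg (z / c)\<bar> \<le> pi - pi / 2 \<Longrightarrow>
        norm (h z - (\<Sum>k<N. fps_nth a k * z ^ k)) \<le> C * M ^ N * fact N * norm z ^ N"
    by blast
  show ?thesis
  proof (rule Lim_null_comparison)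
    have "(\<lambda>n. C * M * norm ((F ^^ n) z)) \<longlonglongrightarrow> C * M * 0"
      by (intro tendsto_mult tendsto_const tendsto_norm_zero conv z)
    then show "(\<lambda>n. C * M * norm ((F ^^ n) z)) \<longlonglongrightarrow> 0" by simp
    have "eventually (\<lambda>n. norm ((F ^^ n) z) < r) sequentially"
      using tendsto_norm_zero[OF conv[OF z]] rCM(1) by (rule order_tendstoD(2))
    then show "eventually (\<lambda>n. norm (h ((F ^^ n) z)) \<le> C * M * norm ((F ^^ n) z)) sequentially"
      using eventually_Re_pos[OF z]
    proof eventually_elim
      case (elim n)
      have "\<bar>Arg ((F ^^ n) z / c)\<bar> < pi / 2" using elim(2) Arg_Re_pos by blast
      then show ?case
        using est[OF iter_in[OF z] elim(1), of 1] a by simp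
    qed
  qed
qed

end

section \<open>Sectorial solutions\<close>

text \<open>
  The hypothesis \<open>o(z^3)\<close> improves to \<open>O(z^4)\<close> by holomorphy; a mere \<open>o(z^3)\<close> would not make
  the deviations of the orbit from a translation summable.
\<close>

lemma prenormalized_step:
  fixes f :: "complex \<Rightarrow> complex"
  assumes U: "open U" "0 \<in> U" and hol: "f holomorphic_on U"
    and small: "(\<lambda>z. f z - (z + z^2 + z^3)) \<in> o[at 0](\<lambda>z. z^3)"
  shows "\<exists>A\<ge>0. \<exists>r>0. \<forall>z. z \<noteq> 0 \<longrightarrow> norm z < r \<longrightarrow> norm (1 / z - 1 / f z - 1) \<le> A * (norm z)^2"
proof -
  define q where "q z = (if z = 0 then 0 else (f z - (z + z^2 + z^3)) / z^3)" for z
  have q0: "(q \<longlongrightarrow> q 0) (at 0 within U)"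
  proof -
    have "((\<lambda>z. (f z - (z + z^2 + z^3)) / z^3) \<longlongrightarrow> 0) (at 0)"
      using small by (rule smalloD_tendsto)
    then have "(q \<longlongrightarrow> 0) (at 0)"
      by (rule Lim_transform_eventually) (auto simp: q_def eventually_at_filter)
    then have "(q \<longlongrightarrow> 0) (at 0 within U)" by (rule tendsto_within_subset) simp
    then show ?thesis by (simp add: q_def)
  qed
  \<comment> \<open>The singularity at 0 is removable because \<open>small\<close> makes
    \<open>q\<close> continuous there; differentiability at 0 then gives
    \<open>norm (q z) \<le> B * norm z\<close>.\<close>
  have "q holomorphic_on U"
  proof (rule no_isolated_singularity'[where K = "{0}"])
    have "(\<lambda>z. (f z - (z + z^2 + z^3)) / z^3) holomorphic_on U - {0}"
      by (intro holomorphic_intros holomorphic_on_subset[OF hol]) auto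
    then show "q holomorphic_on U - {0}"
      by (rule holomorphic_transform) (simp add: q_def)
  qed (use q0 U in auto)
  then have "q field_differentiable at 0"
    using U holomorphic_on_imp_differentiable_at by blast
  then obtain D where "(q has_field_derivative D) (at 0)" by (auto simp: field_differentiable_def)
  then have "((\<lambda>z. q z / z) \<longlongrightarrow> D) (at 0)" by (simp add: has_field_derivative_iff q_def)
  from tendsto_norm[OF this] have "eventually (\<lambda>z. norm (q z / z) < norm D + 1) (at 0)"
    by (rule order_tendstoD(2)) simp
  then obtain d where d: "d > 0" "\<And>z. z \<noteq> 0 \<Longrightarrow> norm z < d \<Longrightarrow> norm (q z / z) < norm D + 1"
    by (auto simp: eventually_at dist_norm)
  define B where "B = norm D + 1"
  have B: "B \<ge> 1" by (simp add: B_def)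
  \<comment> \<open>On this disc both \<open>norm z\<close> and \<open>B * norm z\<close> are at
    most \<open>1 / 4\<close>, which keeps \<open>norm g\<close> above \<open>1 / 2\<close>.\<close>
  define r where "r = min d (1 / (4 * B))"
  have r: "r > 0" using d B by (simp add: r_def)
  have est: "norm (1 / z - 1 / f z - 1) \<le> 2 * (2 * B + 1) * (norm z)^2" if z: "z \<noteq> 0" "norm z < r" for z
  proof -
    define t where "t = norm z"
    have t: "0 < t" "t < 1 / (4 * B)" using z by (auto simp: t_def r_def)
    have "1 / (4 * B) \<le> 1 / 4" using B by (simp add: field_simps)
    then have t4: "t \<le> 1 / 4" using t by linarith
    have Bt: "B * t \<le> 1 / 4" using t B by (simp add: field_simps)
    have q: "norm (q z) \<le> B * t"
      using d(2)[of z] z by (simp add: B_def t_def r_def norm_divide field_simps)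
    define g where "g = 1 + z + z^2 + z^2 * q z"
    have f: "f z = z * g"
      using z by (simp add: g_def q_def field_simps eval_nat_numeral)
    have t2: "t^2 \<le> 1 / 16" using power_mono[OF t4, of 2] t by (simp add: power2_eq_square)
    have n2: "norm (z^2 * q z) \<le> t^2 * (B * t)"
      using q by (simp add: norm_mult norm_power t_def mult_left_mono)
    have n2': "t^2 * (B * t) \<le> 1 / 16 * (1 / 4)"
      using t2 Bt B t by (intro mult_mono) auto
    have "norm (z + z^2 + z^2 * q z) \<le> t + t^2 + t^2 * (B * t)"
      using norm_triangle_ineq[of "z + z^2" "z^2 * q z"] norm_triangle_ineq[of z "z^2"] n2
      by (simp add: t_def norm_power)
    also have "\<dots> \<le> 1 / 2" using t4 t2 n2' by linarith
    finally have "norm (z + z^2 + z^2 * q z) \<le> 1 / 2" .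
    moreover have "1 \<le> norm g + norm (z + z^2 + z^2 * q z)"
      using norm_triangle_ineq4[of g "z + z^2 + z^2 * q z"] by (simp add: g_def)
    ultimately have g: "norm g \<ge> 1 / 2" by linarith
    then have g0: "g \<noteq> 0" by auto
    \<comment> \<open>The coefficient 1 of \<open>z^3\<close> cancels the term linear in
      \<open>z\<close>; this is the effect of the prenormalization.\<close>
    have "1 / z - 1 / f z - 1 = (z * q z - z^2 - z^2 * q z) / g"
      using z g0 unfolding f by (simp add: field_simps) (simp add: g_def algebra_simps power2_eq_square)
    then have "norm (1 / z - 1 / f z - 1) = norm (z * q z - z^2 - z^2 * q z) / norm g"
      by (simp add: norm_divide)
    also have "\<dots> \<le> (t * (B * t) + t^2 + t^2 * (B * t)) / (1 / 2)"
    proof (rule frac_le)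
      have "norm (z * q z) \<le> t * (B * t)" using q by (simp add: norm_mult t_def mult_left_mono)
      then show "norm (z * q z - z^2 - z^2 * q z) \<le> t * (B * t) + t^2 + t^2 * (B * t)"
        using norm_triangle_ineq4[of "z * q z - z^2" "z^2 * q z"] norm_triangle_ineq4[of "z * q z" "z^2"] n2
        by (simp add: t_def norm_power)
    qed (use g t B in auto)
    also have "\<dots> \<le> 2 * (2 * B + 1) * t^2"
    proof -
      have "t^2 * (B * t) \<le> t^2 * B"
        using t t4 B by (intro mult_left_mono) (auto simp: mult_le_cancel_left1)
      then show ?thesis by (simp add: algebra_simps power2_eq_square)
    qed
    finally show ?thesis by (simp add: t_def)
  qed
  show ?thesis
    using est r B by (intro exI[of _ "2 * (2 * B + 1)"] exI[of _ r] conjI allI impI) auto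
qed

section \<open>The petals of the germ and of its inverse\<close>

text \<open>A neighborhood of 0 would meet the ray of direction \<open>- v\<close> arbitrarily close
  to 0.\<close>

lemma zero_notin_petal: "petal F v V \<Longrightarrow> 0 \<notin> V"
proof
  assume p: "petal F v V" and 0: "0 \<in> V"
  have "open V" using p by (simp add: petal_def)
  then obtain e where e: "e > 0" "ball 0 e \<subseteq> V" using 0 by (meson open_contains_ball)
  obtain r where r: "r > 0" "\<And>t::real. 0 < t \<Longrightarrow> t < r \<Longrightarrow> - of_real t * v \<notin> V"
    using p unfolding petal_def by blast
  define k where "k = norm v + 1"
  have k: "k > 0" "norm v \<le> k" using norm_ge_zero[of v] unfolding k_def by linarith+
  define t where "t = min (r / 2) (e / (2 * k))"
  have t: "0 < t" "t < r" using r(1) e(1) k by (auto simp: t_def)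
  have "t * norm v \<le> e / (2 * k) * k"
    using t e k by (intro mult_mono) (auto simp: t_def)
  also have "\<dots> = e / 2" using k by simp
  finally have "- of_real t * v \<in> ball 0 e" using t e by (simp add: norm_mult)
  then show False using r(2)[OF t] e by blast
qed

lemma attracting_petal:
  assumes "open U" and "0 \<in> U" and "f holomorphic_on U"
    and "(\<lambda>z. f z - (z + z^2 + z^3)) \<in> o[at 0](\<lambda>z. z^3)"
    and petal: "petal f (-1) V" and "V \<subseteq> U"
  shows "\<exists>A r. parabolic_petal f V (-1) A r"
proof -
  obtain A r where A: "A \<ge> 0" "r > 0"
    "\<And>z. z \<noteq> 0 \<Longrightarrow> norm z < r \<Longrightarrow> norm (1 / z - 1 / f z - 1) \<le> A * (norm z)^2"
    using prenormalized_step[OF assms(1-4)] by blast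
  have "parabolic_petal f V (-1) A r"
  proof
    show "open V" "f ` V \<subseteq> V" "\<And>z. z \<in> V \<Longrightarrow> (\<lambda>n. (f ^^ n) z) \<longlonglongrightarrow> 0"
      using petal unfolding petal_def by auto
    show "f holomorphic_on V" using assms(3,6) by (rule holomorphic_on_subset)
    show "0 \<notin> V" by (rule zero_notin_petal[OF petal])
    fix z assume "z \<in> V" "norm z < r"
    then show "norm (- 1 / f z - - 1 / z - 1) \<le> A * (norm z)^2"
      using A(3)[of z] \<open>0 \<notin> V\<close> by (auto simp: algebra_simps)
  qed (use A in auto)
  then show ?thesis by blast
qed

text \<open>At the preimage \<open>y\<close> of \<open>z\<close> the estimate for \<open>f\<close>
  is already the one for the inverse, with the error measured by \<open>norm y\<close>. As
  \<open>norm y \<le> 2 * norm z\<close> near 0, the constant becomes \<open>4 * A\<close>.\<close>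

lemma repelling_petal:
  assumes U: "open U" "0 \<in> U" and hol: "f holomorphic_on U" and inj: "inj_on f U" and f0: "f 0 = 0"
    and small: "(\<lambda>z. f z - (z + z^2 + z^3)) \<in> o[at 0](\<lambda>z. z^3)"
    and petal: "petal (inv_into U f) 1 V" and V: "V \<subseteq> f ` U"
  shows "\<exists>A r. parabolic_petal (inv_into U f) V 1 A r"
proof -
  define g where "g = inv_into U f"
  obtain A r where A: "A \<ge> 0" "r > 0"
    "\<And>z. z \<noteq> 0 \<Longrightarrow> norm z < r \<Longrightarrow> norm (1 / z - 1 / f z - 1) \<le> A * (norm z)^2"
    using prenormalized_step[OF U hol small] by blast
  obtain g' where g': "g' holomorphic_on (f ` U)" "\<And>z. z \<in> U \<Longrightarrow> g' (f z) = z"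
    using holomorphic_has_inverse[OF hol U(1) inj] by metis
  have gf: "g (f z) = z" if "z \<in> U" for z using inj that by (simp add: g_def inv_into_f_f)
  have holg: "g holomorphic_on f ` U"
    by (rule holomorphic_transform[OF g'(1)]) (auto simp: gf g'(2))
  have opfU: "open (f ` U)" using open_mapping_thm3[OF hol U(1) inj] .
  have g0: "g 0 = 0" using gf[of 0] U f0 by simp
  have "continuous_on (f ` U) g" using holg by (rule holomorphic_on_imp_continuous_on)
  moreover have "0 \<in> f ` U" using U f0 by force
  ultimately have "isCont g 0" using opfU continuous_on_eq_continuous_at by blast
  \<comment> \<open>These bounds give \<open>A * (norm y)^2 \<le> 1 / 4\<close> and
    \<open>1 / norm y \<ge> 2\<close>, which together exclude \<open>norm y > 2 * norm z\<close>
    below.\<close>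
  define s where "s = min r (1 / (2 * (A + 1)))"
  have s: "s > 0" "s \<le> r" "s \<le> 1 / 2" "A * s \<le> 1 / 2"
  proof -
    show "s > 0" "s \<le> r" using A by (auto simp: s_def)
    have "1 / (2 * (A + 1)) \<le> 1 / 2" using A by (simp add: field_simps)
    then show "s \<le> 1 / 2" by (simp add: s_def)
    have "A * s \<le> A * (1 / (2 * (A + 1)))" using A by (intro mult_left_mono) (auto simp: s_def)
    also have "\<dots> \<le> 1 / 2" using A by (simp add: field_simps)
    finally show "A * s \<le> 1 / 2" .
  qed
  obtain d where d: "d > 0" "\<And>z. norm z < d \<Longrightarrow> norm (g z) < s"
    using \<open>isCont g 0\<close> s(1) unfolding continuous_at_eps_delta by (force simp: g0 dist_norm)
  have zV: "0 \<notin> V" by (rule zero_notin_petal[OF petal])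
  have "parabolic_petal g V 1 (4 * A) d"
  proof
    show "open V" "g ` V \<subseteq> V" "\<And>z. z \<in> V \<Longrightarrow> (\<lambda>n. (g ^^ n) z) \<longlonglongrightarrow> 0"
      using petal unfolding petal_def g_def by auto
    show "g holomorphic_on V" using holg V by (rule holomorphic_on_subset)
    show "0 \<notin> V" by (rule zV)
    fix z assume z: "z \<in> V" "norm z < d"
    define y where "y = g z"
    have fy: "f y = z" using z V by (auto simp: y_def g_def f_inv_into_f)
    have z0: "z \<noteq> 0" using z zV by auto
    have y0: "y \<noteq> 0" using fy z0 f0 by auto
    have ys: "norm y < s" using d(2)[OF z(2)] by (simp add: y_def)
    have "norm y < r" using ys s by linarith
    from A(3)[OF y0 this] have e: "norm (1 / y - 1 / z - 1) \<le> A * (norm y)^2" by (simp add: fy)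
    have yz: "norm y \<le> 2 * norm z"
    proof (rule ccontr)
      assume "\<not> norm y \<le> 2 * norm z"
      then have "2 * (1 / norm y) < 1 / norm z" using z0 y0 by (simp add: field_simps)
      moreover have "1 / norm z \<le> 1 / norm y + 1 + norm (1 / y - 1 / z - 1)"
      proof -
        have "1 / norm z = norm (1 / z)" by (simp add: norm_divide)
        also have "1 / z = 1 / y - 1 - (1 / y - 1 / z - 1)" by simp
        also have "norm \<dots> \<le> norm (1 / y) + 1 + norm (1 / y - 1 / z - 1)"
          using norm_triangle_ineq4[of "1 / y - 1" "1 / y - 1 / z - 1"] norm_triangle_ineq4[of "1 / y" 1] by simp
        finally show ?thesis by (simp add: norm_divide)
      qed
      moreover have "A * (norm y)^2 \<le> 1 / 4"
      proof -
        have "A * norm y \<le> A * s" using ys A by (intro mult_left_mono) auto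
        then have "A * norm y * norm y \<le> 1 / 2 * (1 / 2)"
          using s ys A by (intro mult_mono) auto
        then show ?thesis by (simp add: power2_eq_square mult.assoc)
      qed
      moreover have "1 / norm y \<ge> 2"
        using ys s(3) y0 by (simp add: field_simps)
      ultimately show False using e by linarith
    qed
    have "A * (norm y)^2 \<le> A * (2 * norm z)^2"
      using yz A by (intro mult_left_mono power_mono) auto
    also have "\<dots> = 4 * A * (norm z)^2" by (simp add: power_mult_distrib)
    finally show "norm (1 / g z - 1 / z - 1) \<le> 4 * A * (norm z)^2"
      using e by (simp add: y_def)
  qed (use A d in auto)
  then show ?thesis by (auto simp: g_def)
qed

lemma formal_solution_nth_0: "formal_solution F a \<Longrightarrow> fps_nth a 0 = 0"
  by (simp add: formal_solution_def)

section \<open>Iterating the difference equation\<close>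

text \<open>A positive factor \<open>n\<close> does not change \<open>Arg2pi\<close>, so the
  logarithm of the orbit is that of \<open>n * (f ^^ n) z\<close>, minus \<open>ln n\<close>. The
  limit \<open>-1\<close> has argument \<open>pi\<close> and is a point of continuity of
  \<open>Arg2pi\<close>; multiplied by \<open>pi\<close> it yields \<open>pi^2\<close>.\<close>

lemma attracting_solution:
  assumes pp: "parabolic_petal f V (-1) A r" and VU: "V \<subseteq> U"
    and H: "sectorial_solution f U (-1) log_plus V H" and z: "z \<in> V"
  shows "H z - of_real (pi / 4) + \<i> * of_real (pi^2) = principal_part_of_area f V z"
proof -
  interpret parabolic_petal f V "-1" A r by (rule pp)
  obtain a where a: "formal_solution (fps_expansion f 0) a"
    "gevrey1_asymptotic (-1) V (\<lambda>z. H z - (- of_real pi * log_plus z)) a"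
    using H unfolding sectorial_solution_def by blast
  have eq: "H x - H (f x) = of_real pi * x" if "x \<in> V" for x
    using H that VU F_V unfolding sectorial_solution_def by blast
  have tele: "H z = H ((f ^^ N) z) + of_real pi * (\<Sum>n<N. (f ^^ n) z)" for N
  proof (induction N)
    case (Suc N)
    then show ?case using eq[OF iter_in[OF z, of N]] by (simp add: algebra_simps)
  qed simp
  have g: "(\<lambda>n. H ((f ^^ n) z) - (- of_real pi * log_plus ((f ^^ n) z))) \<longlonglongrightarrow> 0"
    by (rule gevrey_orbit_tendsto[OF a(2) formal_solution_nth_0[OF a(1)] z])
  have nz: "(\<lambda>n. of_nat n * (f ^^ n) z) \<longlonglongrightarrow> -1" by (rule of_nat_times_iter_tendsto[OF z])
  have l1: "(\<lambda>n. ln (norm (of_nat n * (f ^^ n) z))) \<longlonglongrightarrow> ln (norm (- 1 :: complex))"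
    by (intro tendsto_ln tendsto_norm nz) simp
  have "isCont Arg2pi (-1)" by (rule continuous_at_Arg2pi) (auto simp: complex_nonneg_Reals_iff)
  then have l2: "(\<lambda>n. Arg2pi (of_nat n * (f ^^ n) z)) \<longlonglongrightarrow> Arg2pi (-1)"
    by (rule isCont_tendsto_compose[OF _ nz])
  \<comment> \<open>Every term with \<open>n > 0\<close> is equal to \<open>H z\<close>; the
    grouping exhibits three parts that converge separately.\<close>
  have "(\<lambda>n. (H ((f ^^ n) z) - (- of_real pi * log_plus ((f ^^ n) z)))
      - of_real pi * (of_real (ln (norm (of_nat n * (f ^^ n) z))) + \<i> * of_real (Arg2pi (of_nat n * (f ^^ n) z)))
      + of_real pi * ((\<Sum>k<n. (f ^^ k) z) - (-1) * of_real (ln (real n))))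
    \<longlonglongrightarrow> 0 - of_real pi * (of_real (ln (norm (- 1 :: complex))) + \<i> * of_real (Arg2pi (-1)))
      + of_real pi * reg_sum z"
    by (intro tendsto_intros g l1 l2 reg_sum_tendsto z)
  moreover have "eventually (\<lambda>n. (H ((f ^^ n) z) - (- of_real pi * log_plus ((f ^^ n) z)))
      - of_real pi * (of_real (ln (norm (of_nat n * (f ^^ n) z))) + \<i> * of_real (Arg2pi (of_nat n * (f ^^ n) z)))
      + of_real pi * ((\<Sum>k<n. (f ^^ k) z) - (-1) * of_real (ln (real n))) = H z) sequentially"
    using eventually_gt_at_top[of 0]
  proof eventually_elim
    case (elim n)
    have "Arg2pi (of_nat n * (f ^^ n) z) = Arg2pi ((f ^^ n) z)"
      using Arg2pi_times_of_real[of "real n" "(f ^^ n) z"] elim by simp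
    moreover have "ln (norm (of_nat n * (f ^^ n) z)) = ln (real n) + ln (norm ((f ^^ n) z))"
      using elim iter_nonzero[OF z] by (simp add: norm_mult ln_mult)
    ultimately show ?case
      unfolding tele[of n] by (simp add: log_plus_def algebra_simps)
  qed
  ultimately have "(\<lambda>n::nat. H z) \<longlonglongrightarrow> 0 - of_real pi * (of_real (ln (norm (- 1 :: complex))) + \<i> * of_real (Arg2pi (-1)))
      + of_real pi * reg_sum z"
    by (rule Lim_transform_eventually)
  then have "H z = - of_real pi * (\<i> * of_real (Arg2pi (-1))) + of_real pi * reg_sum z"
    by (simp add: LIMSEQ_const_iff)
  moreover have "Arg2pi (-1) = pi" by (simp add: Arg2pi_eq_pi)
  ultimately show ?thesis
    by (simp add: principal_part_eq[OF z] power2_eq_square)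
qed

text \<open>The equation is used at \<open>g x\<close>, whose image under \<open>f\<close> is
  \<open>x\<close>. The orbit approaches 0 along the positive direction, where
  \<open>Ln 1 = 0\<close>, so no imaginary constant arises.\<close>

lemma repelling_solution:
  assumes pp: "parabolic_petal (inv_into U f) V 1 A r" and VU: "V \<subseteq> f ` U"
    and H: "sectorial_solution f U 1 Ln V H" and z: "z \<in> V"
  shows "H z - of_real (pi / 4) = of_real pi * z - principal_part_of_area (inv_into U f) V z"
proof -
  define g where "g = inv_into U f"
  interpret parabolic_petal g V 1 A r unfolding g_def by (rule pp)
  obtain a where a: "formal_solution (fps_expansion f 0) a"
    "gevrey1_asymptotic 1 V (\<lambda>z. H z - (- of_real pi * Ln z)) a"
    using H unfolding sectorial_solution_def by blast
  have eq: "H (g x) - H x = of_real pi * g x" if "x \<in> V" for x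
  proof -
    have "g x \<in> V" using F_V that by blast
    moreover have "g x \<in> U" "f (g x) = x" using that VU by (auto simp: g_def inv_into_into f_inv_into_f)
    ultimately show ?thesis using H that unfolding sectorial_solution_def by force
  qed
  \<comment> \<open>The collected points have the indices 1 to \<open>N\<close>. Written with the
    sum over \<open>n < N\<close> this adds the last point and removes \<open>z\<close>, which is
    the origin of \<open>pi * z\<close>.\<close>
  have tele: "H z = H ((g ^^ N) z) - of_real pi * ((\<Sum>n<N. (g ^^ n) z) + (g ^^ N) z - z)" for N
  proof (induction N)
    case (Suc N)
    then show ?case using eq[OF iter_in[OF z, of N]] by (simp add: algebra_simps)
  qed simp
  have gv: "(\<lambda>n. H ((g ^^ n) z) - (- of_real pi * Ln ((g ^^ n) z))) \<longlonglongrightarrow> 0"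
    by (rule gevrey_orbit_tendsto[OF a(2) formal_solution_nth_0[OF a(1)] z])
  have nz: "(\<lambda>n. of_nat n * (g ^^ n) z) \<longlonglongrightarrow> 1" by (rule of_nat_times_iter_tendsto[OF z])
  have "isCont Ln 1" by (rule continuous_at_Ln) (auto simp: complex_nonpos_Reals_iff)
  then have l: "(\<lambda>n. Ln (of_nat n * (g ^^ n) z)) \<longlonglongrightarrow> Ln 1"
    by (rule isCont_tendsto_compose[OF _ nz])
  have "(\<lambda>n. (H ((g ^^ n) z) - (- of_real pi * Ln ((g ^^ n) z))) - of_real pi * Ln (of_nat n * (g ^^ n) z)
      - of_real pi * ((\<Sum>k<n. (g ^^ k) z) - 1 * of_real (ln (real n))) - of_real pi * ((g ^^ n) z - z))
    \<longlonglongrightarrow> 0 - of_real pi * Ln 1 - of_real pi * reg_sum z - of_real pi * (0 - z)"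
    by (intro tendsto_intros gv l reg_sum_tendsto conv z)
  moreover have "eventually (\<lambda>n. (H ((g ^^ n) z) - (- of_real pi * Ln ((g ^^ n) z))) - of_real pi * Ln (of_nat n * (g ^^ n) z)
      - of_real pi * ((\<Sum>k<n. (g ^^ k) z) - 1 * of_real (ln (real n))) - of_real pi * ((g ^^ n) z - z) = H z) sequentially"
    using eventually_gt_at_top[of 0]
  proof eventually_elim
    case (elim n)
    have "Ln (of_nat n * (g ^^ n) z) = of_real (ln (real n)) + Ln ((g ^^ n) z)"
      using Ln_times_of_real[of "real n" "(g ^^ n) z"] elim iter_nonzero[OF z] by simp
    then show ?case
      unfolding tele[of n] by (simp add: algebra_simps)
  qed
  ultimately have "(\<lambda>n::nat. H z) \<longlonglongrightarrow> 0 - of_real pi * Ln 1 - of_real pi * reg_sum z - of_real pi * (0 - z)"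
    by (rule Lim_transform_eventually)
  then have "H z = - of_real pi * reg_sum z + of_real pi * z"
    by (simp add: LIMSEQ_const_iff)
  then show ?thesis
    using principal_part_eq[OF z] by (simp add: g_def)
qed

theorem theorem1:
  fixes f :: "complex \<Rightarrow> complex" and U Vp Vm :: "complex set"
  defines "finv \<equiv> inv_into U f"
  assumes "open U" and "0 \<in> U" and "f holomorphic_on U" and "inj_on f U" and "f 0 = 0"
    and "(\<lambda>z. f z - (z + z^2 + z^3)) \<in> o[at 0](\<lambda>z. z^3)"
    and "formally_conjugate (fps_expansion f 0) (fps_expansion (\<lambda>z. z / (1 - z)) 0)"
    and "petal f (-1) Vp" and "Vp \<subseteq> U"
    and "petal finv 1 Vm" and "Vm \<subseteq> f ` U"
  shows "principal_part_of_area f Vp analytic_on Vp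
    \<and> principal_part_of_area finv Vm analytic_on Vm
    \<and> (\<forall>Hp. sectorial_solution f U (-1) log_plus Vp Hp \<longrightarrow>
         (\<forall>z\<in>Vp. Hp z - of_real (pi / 4) + \<i> * of_real (pi^2) = principal_part_of_area f Vp z))
    \<and> (\<forall>Hm. sectorial_solution f U 1 Ln Vm Hm \<longrightarrow>
         (\<forall>z\<in>Vm. Hm z - of_real (pi / 4)
                   = of_real pi * z - principal_part_of_area finv Vm z))"
proof -
  obtain A r where p: "parabolic_petal f Vp (-1) A r"
    using attracting_petal[OF assms(2,3,4,7,9,10)] by blast
  obtain A' r' where m: "parabolic_petal finv Vm 1 A' r'"
    using repelling_petal[OF assms(2-7)] assms(11,12) unfolding finv_def by blast
  show ?thesis
    using parabolic_petal.principal_part_analytic[OF p] parabolic_petal.principal_part_analytic[OF m]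
      attracting_solution[OF p \<open>Vp \<subseteq> U\<close>] repelling_solution[OF m[unfolded finv_def] \<open>Vm \<subseteq> f ` U\<close>]
    unfolding finv_def by blast
qed

end
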